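(* Let $d\ge2$, $\beta,\gamma>-\tfrac12$ and $\alpha=\beta+\frac{d-1}2$. For $n=1,2,\ldots$ and $(x,t),(y,s)\in\mathbb V_0^{d+1}$, $$\mathsf P_n^O\big(w_{\beta,\gamma};(x,t),(y,s)\big)=\frac{\alpha+\gamma+1}{\alpha+\frac12}\,s\,t\;\mathsf P_{n-1}^E\big(w_{\beta+1,\gamma};(x,t),(y,s)\big).$$ Furthermore, for $\beta\ge0$, $\gamma\ge0$ and $n=0,1,2,\ldots$, $$\mathsf P_n^E\big(w_{\beta,\gamma};(x,t),(y,s)\big)=c\int_{[-1,1]^3}Z_n^{\alpha+\gamma}\big(\xi(x,t,y,s;v,z)\big)(1-z_1)^{\frac{d-2}2}(1+z_1)^{\beta-1}(1-z_2^2)^{\beta-\frac12}(1-v^2)^{\gamma-1}\,dv\,dz,$$ where $z=(z_1,z_2)$, $c=c_{\frac{d-2}2,\beta-1}\,c_\beta\,c_{\gamma-\frac12}$ and $$\xi(x,t,y,s;v,z)=\frac{1-z_1}2\langle x,y\rangle\,\mathrm{sign}(st)+\frac{1+z_1}2z_2\,st+v\sqrt{1-s^2}\sqrt{1-t^2}.$$ The formula holds under the limit $\gamma\to0$ and/or $\beta\to0$ (when $\gamma=0$ and/or $\beta=0$).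
   Context: $\mathbb V_0^{d+1}=\{(x,t)\in\mathbb R^d\times\mathbb R:\ \|x\|=|t|,\ -1\le t\le1\}$ is the surface of the double cone and $w_{\beta,\gamma}(t)=|t|^{2\beta}(1-t^2)^{\gamma-\frac12}$. Integration means $\int_{\mathbb V_0^{d+1}}f\,d\sigma=\int_{-1}^1|t|^{d-1}\int_{\mathbb S^{d-1}}f(|t|\xi,t)\,d\sigma(\xi)\,dt$. The inner product is $\langle f,g\rangle_{w_{\beta,\gamma}}=b_{\beta,\gamma}\int_{\mathbb V_0^{d+1}}f\,g\,w_{\beta,\gamma}(t)\,d\sigma$ with $b_{\beta,\gamma}$ chosen so that $\langle1,1\rangle=1$. $\mathcal V_n^E$ (resp. $\mathcal V_n^O$) is the space of restrictions to $\mathbb V_0^{d+1}$ of polynomials in $(x,t)$ of degree at most $n$ that are even (resp. odd) in $t$ and orthogonal to all polynomials of degree at most $n-1$. $\mathsf P_n^E(w_{\beta,\gamma};\cdot,\cdot)$ and $\mathsf P_n^O(w_{\beta,\gamma};\cdot,\cdot)$ are the reproducing kernels of these spaces with respect to $\langle\cdot,\cdot\rangle_{w_{\beta,\gamma}}$. $Z_n^\lambda(t)=\frac{n+\lambda}\lambda C_n^\lambda(t)$ for $\lambda>0$, with $C_n^\lambda$ the Gegenbauer polynomial. Constants: $c_\lambda=\frac{\Gamma(\lambda+1)}{\Gamma(\frac12)\Gamma(\lambda+\frac12)}$ and $c_{a,b}=\frac{\Gamma(a+b+2)}{\Gamma(a+1)\Gamma(b+1)}$.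
   Formalization: In the formula for P_n^E the constant c is divided by 2^{(d-2)/2+β-1+1}, since otherwise n=0 gives 2^{(d-2)/2+β} instead of 1, and the right side is multiplied by (-1)^n when st<0, since P_n^E is even in t but the printed integral changes sign for odd n. *)

theory Defs
  imports "HOL-Analysis.Analysis"
begin

type_synonym 'n cone_point = "(real^'n) \<times> real"

definition double_cone :: "'n::finite cone_point set" where
  "double_cone = {(x, t). norm x = \<bar>t\<bar> \<and> -1 \<le> t \<and> t \<le> 1}"


subsection \<open>Integration on the double cone\<close>

(* Surface measure of the unit sphere, as the cone measure
   sigma(A) = d * vol {r *R u | u : A, 0 < r < 1}. *)
definition sphere_measure :: "(real^'n::finite) measure" where
  "sphere_measure = scale_measure (of_nat CARD('n))
     (distr (restrict_space lborel (ball 0 1 - {0})) borel (\<lambda>x. x /\<^sub>R norm x))"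

definition cone_integral :: "('n::finite cone_point \<Rightarrow> real) \<Rightarrow> real" where
  "cone_integral f =
     (LINT t:{-1..1}|lborel.
        \<bar>t\<bar> ^ (CARD('n) - 1) * (LINT u|sphere_measure. f (\<bar>t\<bar> *\<^sub>R u, t)))"

definition cone_weight :: "real \<Rightarrow> real \<Rightarrow> real \<Rightarrow> real" where
  "cone_weight \<beta> \<gamma> t = \<bar>t\<bar> powr (2 * \<beta>) * (1 - t\<^sup>2) powr (\<gamma> - 1/2)"

definition cone_inner ::
  "real \<Rightarrow> real \<Rightarrow> ('n::finite cone_point \<Rightarrow> real) \<Rightarrow> ('n cone_point \<Rightarrow> real) \<Rightarrow> real" where
  "cone_inner \<beta> \<gamma> f g =
     (1 / cone_integral (\<lambda>(x :: real^'n, t). cone_weight \<beta> \<gamma> t))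
     * cone_integral (\<lambda>(x, t). f (x, t) * g (x, t) * cone_weight \<beta> \<gamma> t)"


subsection \<open>Orthogonal polynomials on the double cone\<close>

definition polys_le :: "nat \<Rightarrow> ('n::finite cone_point \<Rightarrow> real) set" where
  "polys_le n = {p. \<exists>c :: ('n \<Rightarrow> nat) \<Rightarrow> nat \<Rightarrow> real.
     p = (\<lambda>(x, t). \<Sum>(a, k) \<in> {(a, k). (\<Sum>i\<in>UNIV. a i) + k \<le> n}.
            c a k * (\<Prod>i\<in>UNIV. (x $ i) ^ a i) * t ^ k)}"

(* The restriction of a function to the double cone is represented by its extension by zero,
   so that two functions have the same restriction iff these representatives are equal. *)
definition cone_restrict :: "('n::finite cone_point \<Rightarrow> real) \<Rightarrow> 'n cone_point \<Rightarrow> real" where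
  "cone_restrict p = (\<lambda>z. if z \<in> double_cone then p z else 0)"

(* For n = 0 the orthogonality condition is void: no nonzero polynomial has degree below 0. *)
definition orth_even :: "nat \<Rightarrow> real \<Rightarrow> real \<Rightarrow> ('n::finite cone_point \<Rightarrow> real) set" where
  "orth_even n \<beta> \<gamma> = {cone_restrict p | p.
     p \<in> polys_le n \<and> (\<forall>x t. p (x, -t) = p (x, t)) \<and>
     (\<forall>m<n. \<forall>q\<in>polys_le m. cone_inner \<beta> \<gamma> p q = 0)}"

definition orth_odd :: "nat \<Rightarrow> real \<Rightarrow> real \<Rightarrow> ('n::finite cone_point \<Rightarrow> real) set" where
  "orth_odd n \<beta> \<gamma> = {cone_restrict p | p.
     p \<in> polys_le n \<and> (\<forall>x t. p (x, -t) = - p (x, t)) \<and>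
     (\<forall>m<n. \<forall>q\<in>polys_le m. cone_inner \<beta> \<gamma> p q = 0)}"

definition is_reproducing_kernel ::
  "('n::finite cone_point \<Rightarrow> real) set \<Rightarrow> real \<Rightarrow> real \<Rightarrow>
   ('n cone_point \<Rightarrow> 'n cone_point \<Rightarrow> real) \<Rightarrow> bool" where
  "is_reproducing_kernel V \<beta> \<gamma> K \<longleftrightarrow>
     (\<forall>w\<in>double_cone. (\<lambda>z. K z w) \<in> V) \<and>
     (\<forall>f\<in>V. \<forall>w\<in>double_cone. cone_inner \<beta> \<gamma> f (\<lambda>z. K z w) = f w)"

(* The kernel is a function on pairs of points of the double cone; like the elements of V it is
   extended by zero, which makes it unique as a function on the whole space. *)
definition reproducing_kernel ::
  "('n::finite cone_point \<Rightarrow> real) set \<Rightarrow> real \<Rightarrow> real \<Rightarrow>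
   'n cone_point \<Rightarrow> 'n cone_point \<Rightarrow> real" where
  "reproducing_kernel V \<beta> \<gamma> =
     (THE K. is_reproducing_kernel V \<beta> \<gamma> K \<and>
        (\<forall>z w. z \<notin> double_cone \<or> w \<notin> double_cone \<longrightarrow> K z w = 0))"

definition kernel_even ::
  "nat \<Rightarrow> real \<Rightarrow> real \<Rightarrow> 'n::finite cone_point \<Rightarrow> 'n cone_point \<Rightarrow> real" where
  "kernel_even n \<beta> \<gamma> = reproducing_kernel (orth_even n \<beta> \<gamma>) \<beta> \<gamma>"

definition kernel_odd ::
  "nat \<Rightarrow> real \<Rightarrow> real \<Rightarrow> 'n::finite cone_point \<Rightarrow> 'n cone_point \<Rightarrow> real" where
  "kernel_odd n \<beta> \<gamma> = reproducing_kernel (orth_odd n \<beta> \<gamma>) \<beta> \<gamma>"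


subsection \<open>The closed form\<close>

definition gegenbauer :: "nat \<Rightarrow> real \<Rightarrow> real \<Rightarrow> real" where
  "gegenbauer n l t =
     (\<Sum>k\<le>n div 2. (-1) ^ k * pochhammer l (n - k) / (fact k * fact (n - 2 * k))
        * (2 * t) ^ (n - 2 * k))"

definition zonal :: "nat \<Rightarrow> real \<Rightarrow> real \<Rightarrow> real" where
  "zonal n l t = (real n + l) / l * gegenbauer n l t"

definition gegenbauer_const :: "real \<Rightarrow> real" where
  "gegenbauer_const l = Gamma (l + 1) / (Gamma (1/2) * Gamma (l + 1/2))"

definition jacobi_const :: "real \<Rightarrow> real \<Rightarrow> real" where
  "jacobi_const a b = Gamma (a + b + 2) / (Gamma (a + 1) * Gamma (b + 1))"

definition xi ::
  "'n::finite cone_point \<Rightarrow> 'n cone_point \<Rightarrow> real \<Rightarrow> real \<Rightarrow> real \<Rightarrow> real" where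
  "xi = (\<lambda>(x, t) (y, s) z1 z2 v.
     (1 - z1) / 2 * (x \<bullet> y) * sgn (s * t) + (1 + z1) / 2 * z2 * (s * t)
     + v * sqrt (1 - s\<^sup>2) * sqrt (1 - t\<^sup>2))"

(* jacobi_const a b normalises the Jacobi weight on the unit interval.  The weight
   (1 - z1) powr a * (1 + z1) powr b on [-1,1] has total mass
   2 powr (a + b + 1) / jacobi_const a b, hence the power of two. *)
definition kernel_integral ::
  "nat \<Rightarrow> real \<Rightarrow> real \<Rightarrow> 'n::finite cone_point \<Rightarrow> 'n cone_point \<Rightarrow> real" where
  "kernel_integral n \<beta> \<gamma> p q =
     (let d = real CARD('n);
          \<alpha> = \<beta> + (d - 1) / 2;
          c = jacobi_const ((d - 2) / 2) (\<beta> - 1) / 2 powr ((d - 2) / 2 + (\<beta> - 1) + 1)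
              * gegenbauer_const \<beta> * gegenbauer_const (\<gamma> - 1/2)
      in c * (LINT (z1, z2, v):({-1..1} \<times> {-1..1} \<times> {-1..1})|lborel.
                zonal n (\<alpha> + \<gamma>) (xi p q z1 z2 v)
                * (1 - z1) powr ((d - 2) / 2) * (1 + z1) powr (\<beta> - 1)
                * (1 - z2\<^sup>2) powr (\<beta> - 1/2) * (1 - v\<^sup>2) powr (\<gamma> - 1)))"

(* xi contains sgn (s * t), but the even kernel does not change under t -> -t.  Reversing the
   sign of t (replacing also z2, v by -z2, -v) turns xi into -xi, and zonal n l has the parity
   of n, so for s * t < 0 the integral has to be multiplied by (-1)^n.  The factor is 1 for
   even n, and for all n if s and t do not have opposite signs. *)
definition even_kernel_formula ::
  "nat \<Rightarrow> real \<Rightarrow> real \<Rightarrow> 'n::finite cone_point \<Rightarrow> 'n cone_point \<Rightarrow> real" where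
  "even_kernel_formula n \<beta> \<gamma> p q =
     (if snd p * snd q < 0 then (-1) ^ n else 1) * kernel_integral n \<beta> \<gamma> p q"

end

theory Submission
  imports Defs "HOL-Probability.Distributions" "HOL-Computational_Algebra.Polynomial"
begin

text \<open>
  Write \<open>E\<close> for expectation under the normalised weights and \<open>\<lambda> = \<alpha> + \<gamma>\<close>. For a point \<open>(y, s)\<close> of the
  cone and a polynomial \<open>q\<close> of degree at most \<open>M\<close>, even in \<open>t\<close>, there is a polynomial \<open>Q\<close> in one variable,
  of degree at most \<open>M\<close>, with \<open>Q 1 = q (y, s)\<close> and \<open>E (q * \<xi> ^ N) = E (Q * T ^ N)\<close> for all \<open>N\<close>, where \<open>T\<close> follows the
  Gegenbauer law of parameter \<open>\<lambda>\<close>: \<open>Q\<close> is the conditional expectation of \<open>q\<close> given \<open>\<xi> = T\<close>. It is found in three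
  steps (the sphere, the variables \<open>z\<close>, the radius together with \<open>v\<close>); the first and the last one rest on
  Stein's identity for Gaussian moments, the second one on an addition formula for Gegenbauer polynomials.
  Since \<open>E (Q * (\<Sum>m\<le>M. Z m)) = Q 1\<close>, the functions \<open>E (Z m \<xi>)\<close>, \<open>m \<le> M\<close>, add up to the reproducing
  kernel of the even polynomials of degree at most \<open>M\<close>.

  All moments are quotients of Pochhammer symbols, so that the argument is algebraic in \<open>\<beta>\<close> and \<open>\<gamma>\<close>: it produces
  the kernel for all \<open>\<beta>, \<gamma> > -1/2\<close>, also where the integral over \<open>z\<close> and \<open>v\<close> diverges, and shows that the
  kernel is continuous in the parameters. The odd polynomials are \<open>t\<close> times the even ones for the weight
  with \<open>\<beta> + 1\<close>.
\<close>

subsection \<open>Moment functionals and Gegenbauer polynomials\<close>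

text \<open>The Gaussian steps rest on one model. If \<open>T\<close> has the Gegenbauer law of
  parameter \<open>l\<close> and \<open>R\<^sup>2\<close> is an independent
  Gamma(\<open>l + 1\<close>) variable, then \<open>R T\<close> is centred Gaussian of variance 1/2
  and \<open>R\<^sup>2 (1 - T\<^sup>2)\<close> is an independent Gamma(\<open>l + 1/2\<close>)
  variable. Multiplied by a power of \<open>R\<close>, homogeneous functions become polynomials in
  independent Gaussians, whose conditional expectation given a linear form with unit coefficient
  vector is a polynomial; division by a moment of \<open>R\<close>, a Pochhammer symbol, leads back.
  In the step with \<open>z\<close> the Beta(d/2, \<beta>) moments belong to no probability law when
  \<beta> < 0, so a conditional expectation can only be characterised by moments: it is found from
  its tests against Gegenbauer polynomials. Under the law of parameter \<open>l\<close> those of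
  parameter \<open>l + 1\<close> are the right tests, because the one of degree \<open>n\<close>
  evaluates at 1 every polynomial of degree at most \<open>n\<close> with the parity of
  \<open>n\<close>. Working with \<open>l + 1\<close> also keeps the division by \<open>l\<close> in
  \<open>Z n\<close> out of the argument.\<close>

lemma binomial_sum_Suc:
  fixes f :: "nat \<Rightarrow> nat \<Rightarrow> real"
  shows "(\<Sum>p\<le>Suc N. real (Suc N choose p) * f p (Suc N - p)) =
    (\<Sum>p\<le>N. real (N choose p) * (f (Suc p) (N - p) + f p (Suc (N - p))))"
proof -
  have "(\<Sum>p\<le>Suc N. real (Suc N choose p) * f p (Suc N - p)) =
    f 0 (Suc N) + (\<Sum>p\<le>N. real (Suc N choose Suc p) * f (Suc p) (N - p))"
    by (subst sum.atMost_Suc_shift) simp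
  also have "(\<Sum>p\<le>N. real (Suc N choose Suc p) * f (Suc p) (N - p)) =
     (\<Sum>p\<le>N. real (N choose p) * f (Suc p) (N - p)) + (\<Sum>p\<le>N. real (N choose Suc p) * f (Suc p) (N - p))"
    by (simp add: distrib_right sum.distrib)
  also have "(\<Sum>p\<le>N. real (N choose Suc p) * f (Suc p) (N - p)) =
     (\<Sum>p<N. real (N choose Suc p) * f (Suc p) (N - p))"
    by (simp flip: lessThan_Suc_atMost)
  also have "f 0 (Suc N) + ((\<Sum>p\<le>N. real (N choose p) * f (Suc p) (N - p)) + \<dots>) =
     (\<Sum>p\<le>N. real (N choose p) * f (Suc p) (N - p)) + (f 0 (Suc N) + \<dots>)" by simp
  also have "f 0 (Suc N) + (\<Sum>p<N. real (N choose Suc p) * f (Suc p) (N - p)) =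
     (\<Sum>p\<le>N. real (N choose p) * f p (Suc (N - p)))"
    by (subst sum.atMost_shift) (auto simp: Suc_diff_Suc intro!: sum.cong)
  finally show ?thesis by (simp add: distrib_left sum.distrib)
qed

lemma alternating_binomial_sum_Suc:
  fixes f :: "nat \<Rightarrow> real"
  shows "(\<Sum>l\<le>Suc M. (-1) ^ (Suc M - l) * real (Suc M choose l) * f l) =
    (\<Sum>l\<le>M. (-1) ^ (M - l) * real (M choose l) * (f (Suc l) - f l))"
  using binomial_sum_Suc[of M "\<lambda>l r. (-1) ^ r * f l"]
  by (simp add: algebra_simps del: sum.atMost_Suc)

lemma pochhammer_diff:
  "pochhammer (a + 1) (Suc n) - pochhammer (a::real) (Suc n) = (n + 1) * pochhammer (a + 1) n"
  unfolding pochhammer_rec[of a] pochhammer_Suc[of "a+1"] by (simp add: algebra_simps)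

text \<open>An \<open>M\<close>-th finite difference of a polynomial in \<open>l\<close> that is
  monic of degree \<open>M\<close>. The induction applies the discrete product rule: the difference
  of a rising factorial is again a rising factorial, so both resulting products have total degree
  one less.\<close>

lemma alternating_pochhammer_sum:
  fixes a b :: real
  assumes "A + B = M"
  shows "(\<Sum>l\<le>M. (-1) ^ (M - l) * real (M choose l) * (pochhammer (a + l) A * pochhammer (b + l) B))
    = fact M"
  using assms
proof (induction M arbitrary: A B a b)
  case 0
  then show ?case by simp
next
  case (Suc M)
  \<comment> \<open>For \<open>n = 0\<close> both sides are 0: the factor \<open>n\<close> makes the
    truncated \<open>n - 1\<close> harmless. The same holds for \<open>A - 1\<close> and
    \<open>B - 1\<close> below.\<close>
  have d: "pochhammer (a + Suc l) n - pochhammer (a + l) n = n * pochhammer ((a + 1) + l) (n - 1)"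
    for a :: real and l n
    by (cases n) (use pochhammer_diff[of "a + l"] in \<open>simp_all add: add_ac\<close>)
  have "pochhammer (a + Suc l) A * pochhammer (b + Suc l) B - pochhammer (a + l) A * pochhammer (b + l) B
    = B * (pochhammer ((a+1) + l) A * pochhammer ((b+1) + l) (B-1))
     + A * (pochhammer ((a+1) + l) (A-1) * pochhammer (b + l) B)" for l
  proof -
    have product_rule: "x' * y' - x * y = B * (x'' * q) + A * (p * y)"
      if "x'' = x'" "x' - x = A * p" "y' - y = B * q" for x x' x'' y y' p q :: real
    proof -
      have "x' * y' - x * y = x' * (y' - y) + (x' - x) * y" by (simp add: algebra_simps)
      then show ?thesis unfolding that(2,3) by (simp add: that(1) mult_ac)
    qed
    show ?thesis
      by (rule product_rule[OF _ d d]) (simp add: add_ac)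
  qed
  then have "(\<Sum>l\<le>Suc M. (-1) ^ (Suc M - l) * real (Suc M choose l) * (pochhammer (a + l) A * pochhammer (b + l) B))
    = B * (\<Sum>l\<le>M. (-1) ^ (M - l) * real (M choose l) * (pochhammer ((a+1) + l) A * pochhammer ((b+1) + l) (B-1)))
    + A * (\<Sum>l\<le>M. (-1) ^ (M - l) * real (M choose l) * (pochhammer ((a+1) + l) (A-1) * pochhammer (b + l) B))"
    unfolding alternating_binomial_sum_Suc sum_distrib_left sum.distrib[symmetric]
    by (intro sum.cong refl) (simp add: algebra_simps)
  moreover have "real B * (\<Sum>l\<le>M. (-1) ^ (M - l) * real (M choose l) * (pochhammer ((a+1) + l) A * pochhammer ((b+1) + l) (B-1)))
     = real B * fact M"
    using Suc.prems by (cases B) (simp_all add: Suc.IH distrib_right)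
  moreover have "real A * (\<Sum>l\<le>M. (-1) ^ (M - l) * real (M choose l) * (pochhammer ((a+1) + l) (A-1) * pochhammer (b + l) B))
     = real A * fact M"
    using Suc.prems by (cases A) (simp_all add: Suc.IH distrib_right)
  moreover have "real A + real B = real (Suc M)"
    unfolding Suc.prems[symmetric] by simp
  ultimately show ?case
    by (simp only: fact_Suc distrib_right[symmetric] add.commute)
qed

text \<open>Moments of the centred Gaussian law of variance \<open>1/2\<close>, whose density is proportional to \<open>exp (- x\<^sup>2)\<close>.\<close>

definition gauss_moment :: "nat \<Rightarrow> real" where
  "gauss_moment k = (if even k then pochhammer (1/2) (k div 2) else 0)"

text \<open>For \<open>l > -1/2\<close> these are the moments of the probability law on [-1,1] with
  density proportional to \<open>(1 - t\<^sup>2) powr (l - 1/2)\<close>. The quotient is also used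
  for \<open>-1 < l \<le> -1/2\<close>, where that density is not integrable.\<close>

definition gegen_moment :: "real \<Rightarrow> nat \<Rightarrow> real" where
  "gegen_moment l k = gauss_moment k / pochhammer (l + 1) (k div 2)"

definition moment_functional :: "(nat \<Rightarrow> real) \<Rightarrow> real poly \<Rightarrow> real" where
  "moment_functional m p = (\<Sum>i\<le>degree p. coeff p i * m i)"

abbreviation gegen_functional :: "real \<Rightarrow> real poly \<Rightarrow> real" where
  "gegen_functional l \<equiv> moment_functional (gegen_moment l)"

definition gegen_poly :: "nat \<Rightarrow> real \<Rightarrow> real poly" where
  "gegen_poly n l = (\<Sum>k\<le>n div 2. monom ((-1) ^ k * pochhammer l (n - k) * 2 ^ (n - 2 * k)
      / (fact k * fact (n - 2 * k))) (n - 2 * k))"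

text \<open>In this form of \<open>Z n\<close> the parameter \<open>l = 0\<close> and negative \<open>l\<close> are not exceptional.\<close>

definition zonal_poly :: "nat \<Rightarrow> real \<Rightarrow> real poly" where
  "zonal_poly n l = gegen_poly n (l + 1) - (if n \<ge> 2 then gegen_poly (n - 2) (l + 1) else 0)"

section \<open>Linear functionals given by moments\<close>

lemma gauss_moment_Suc_Suc: "gauss_moment (Suc (Suc k)) = (k + 1) / 2 * gauss_moment k"
  by (auto simp: gauss_moment_def pochhammer_Suc elim!: evenE)

lemma moment_functional_eq:
  assumes "degree p \<le> n"
  shows "moment_functional m p = (\<Sum>i\<le>n. coeff p i * m i)"
  unfolding moment_functional_def
  by (rule sum.mono_neutral_left) (use assms in \<open>auto simp: coeff_eq_0\<close>)

lemma moment_functional_add: "moment_functional m (p + q) = moment_functional m p + moment_functional m q"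
proof -
  let ?n = "max (degree p) (degree q)"
  show ?thesis
    using moment_functional_eq[of p ?n m] moment_functional_eq[of q ?n m] moment_functional_eq[of "p + q" ?n m]
    by (simp add: degree_add_le distrib_right sum.distrib)
qed

lemma moment_functional_0 [simp]: "moment_functional m 0 = 0"
  by (simp add: moment_functional_def)

lemma moment_functional_smult: "moment_functional m (smult c p) = c * moment_functional m p"
  using moment_functional_eq[of p "degree p" m] moment_functional_eq[of "smult c p" "degree p" m]
  by (simp add: degree_smult_le sum_distrib_left mult_ac)

lemma moment_functional_diff: "moment_functional m (p - q) = moment_functional m p - moment_functional m q"
  using moment_functional_add[of m p "smult (-1) q"] unfolding moment_functional_smult by simp

lemma moment_functional_sum: "moment_functional m (\<Sum>i\<in>I. f i) = (\<Sum>i\<in>I. moment_functional m (f i))"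
  by (induction I rule: infinite_finite_induct) (auto simp: moment_functional_add)

lemma moment_functional_monom: "moment_functional m (monom c n) = c * m n"
  using moment_functional_eq[of "monom c n" n m] by (simp add: degree_monom_le if_distrib[of "\<lambda>x. x * _"] cong: if_cong)

lemma moment_functional_times_sum:
  "moment_functional m (p * q) = (\<Sum>i\<le>degree q. coeff q i * moment_functional m (p * monom 1 i))"
proof -
  have "q = (\<Sum>i\<le>degree q. smult (coeff q i) (monom 1 i))"
    by (simp add: smult_monom poly_as_sum_of_monoms)
  then have "p * q = (\<Sum>i\<le>degree q. smult (coeff q i) (p * monom 1 i))"
    by (metis (no_types, lifting) mult_smult_right sum.cong sum_distrib_left)
  then show ?thesis by (simp add: moment_functional_sum moment_functional_smult)
qed

lemma moment_functional_shift:
  "moment_functional m (p * monom 1 k) = moment_functional (\<lambda>i. m (i + k)) p"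
proof -
  have "p * monom 1 k = (\<Sum>i\<le>degree p. monom (coeff p i) (i + k))"
    by (subst poly_as_sum_of_monoms[of p, symmetric]) (simp add: sum_distrib_right mult_monom)
  then show ?thesis
    by (simp add: moment_functional_sum moment_functional_monom) (simp add: moment_functional_def)
qed

section \<open>Gegenbauer polynomials of parameter \<open>l + 1\<close> under the law of parameter
  \<open>l\<close>\<close>

lemma poly_gegen_poly:
  "poly (gegen_poly n l) t = (\<Sum>k\<le>n div 2. (-1) ^ k * pochhammer l (n - k)
      / (fact k * fact (n - 2 * k)) * (2 * t) ^ (n - 2 * k))"
  by (simp add: gegen_poly_def poly_sum poly_monom power_mult_distrib mult_ac)

lemma degree_gegen_poly_le: "degree (gegen_poly n l) \<le> n"
  unfolding gegen_poly_def
  by (rule degree_sum_le) (auto intro: order_trans[OF degree_monom_le])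

lemma pochhammer_half_fact_even: "4 ^ k * fact k * pochhammer (1/2) k = (fact (2 * k) :: real)"
proof (induction k)
  case (Suc k)
  have "4 ^ Suc k * fact (Suc k) * pochhammer (1/2) (Suc k) =
      (4 ^ k * fact k * pochhammer (1/2) k) * ((2 * k + 1) * (2 * k + 2) :: real)"
    by (simp add: pochhammer_Suc field_simps)
  also have "\<dots> = fact (2 * Suc k)"
    unfolding Suc.IH by (simp add: algebra_simps)
  finally show ?case .
qed simp

lemma pochhammer_half_fact_odd:
  "2 * 4 ^ k * fact k * pochhammer (1/2) (Suc k) = (fact (Suc (2 * k)) :: real)"
proof -
  have "2 * 4 ^ k * fact k * pochhammer (1/2) (Suc k) =
      (4 ^ k * fact k * pochhammer (1/2) k) * (2 * k + 1 :: real)"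
    by (simp add: pochhammer_Suc field_simps)
  then show ?thesis
    unfolding pochhammer_half_fact_even by (simp add: algebra_simps)
qed

text \<open>The duplication formulas for (2k)! and (2k+1)! in one form: \<open>\<delta>\<close>
  stands for the parity of a degree, so that even and odd degrees can be treated together.\<close>

lemma pochhammer_half_fact:
  assumes "\<delta> < 2"
  shows "2 ^ (2 * k + \<delta>) * pochhammer (1/2) (k + \<delta>) / fact (2 * k + \<delta>) = 1 / (fact k :: real)"
proof (cases "\<delta> = 0")
  case True
  then show ?thesis using pochhammer_half_fact_even[of k]
    by (simp add: power_mult divide_simps) (simp add: mult_ac)
next
  case False
  with assms have "\<delta> = 1" by simp
  then show ?thesis using pochhammer_half_fact_odd[of k]
    by (simp add: power_mult divide_simps del: fact_Suc) (simp add: mult_ac)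
qed

lemma pochhammer_nonzero: "x > 0 \<Longrightarrow> pochhammer (x::real) n \<noteq> 0"
  using pochhammer_pos[of x n] by simp

text \<open>After cancellation the sum over the coefficients becomes an alternating binomial sum of a polynomial.\<close>

lemma gegen_functional_gegen_poly_monom:
  assumes l: "l > -1" and k: "k \<le> n"
  shows "gegen_functional l (gegen_poly n (l + 1) * monom 1 k) = (if even (n - k) then 1 else 0)"
proof -
  have *: "gegen_functional l (gegen_poly n (l + 1) * monom 1 k) =
     (\<Sum>j\<le>n div 2. (-1) ^ j * pochhammer (l + 1) (n - j) * 2 ^ (n - 2 * j)
      / (fact j * fact (n - 2 * j)) * gegen_moment l (n - 2 * j + k))"
    by (simp add: gegen_poly_def sum_distrib_right mult_monom moment_functional_sum moment_functional_monom)
  show ?thesis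
  proof (cases "even (n - k)")
    case False
    then have "gegen_moment l (n - 2 * j + k) = 0" if "j \<le> n div 2" for j
      using k that by (auto simp: gegen_moment_def gauss_moment_def)
    then show ?thesis using False unfolding * by simp
  next
    case True
    \<comment> \<open>\<open>\<delta>\<close> is the common parity of \<open>n\<close> and
      \<open>k\<close>. With the summation reversed by \<open>j = M - i\<close>, the factors
      depending on \<open>i\<close> form an alternating binomial weight times a product of two
      rising factorials of lengths \<open>M - K\<close> and \<open>K\<close>, hence a monic
      polynomial of degree \<open>M\<close> in \<open>i\<close>.\<close>
    define \<delta> M K where "\<delta> = n mod 2" and "M = n div 2" and "K = k div 2"
    have \<delta>: "\<delta> < 2" by (simp add: \<delta>_def)
    have n: "n = 2 * M + \<delta>" by (simp add: \<delta>_def M_def)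
    have kk: "k = 2 * K + \<delta>" using True k unfolding \<delta>_def K_def by presburger
    have KM: "K \<le> M" using k unfolding n kk by simp
    let ?T = "\<lambda>j. (-1) ^ j * pochhammer (l + 1) (n - j) * 2 ^ (n - 2 * j)
      / (fact j * fact (n - 2 * j)) * gegen_moment l (n - 2 * j + k)"
    have T: "?T (M - i) = (-1) ^ (M - i) * real (M choose i) *
       (pochhammer ((l + 1 + K + \<delta>) + i) (M - K) * pochhammer ((1/2 + \<delta>) + i) K) / fact M" if "i \<le> M" for i
    proof -
      have e1: "n - 2 * (M - i) = 2 * i + \<delta>" and e2: "n - (M - i) = M + \<delta> + i"
        using that by (auto simp: n)
      have e3: "2 * i + \<delta> + k = 2 * (i + \<delta> + K)" by (simp add: kk)
      have p1: "pochhammer (l + 1) (M + \<delta> + i) =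
          pochhammer (l + 1) (i + \<delta> + K) * pochhammer ((l + 1 + K + \<delta>) + i) (M - K)"
        using pochhammer_product'[of "l + 1" "i + \<delta> + K" "M - K"] KM by (simp add: add_ac)
      have p2: "pochhammer (1/2) (i + \<delta> + K) =
          pochhammer (1/2) (i + \<delta>) * (pochhammer ((1/2 + \<delta>) + i) K :: real)"
        using pochhammer_product'[of "1/2 :: real" "i + \<delta>" "K"] by (simp add: add_ac)
      have p3: "pochhammer (l + 1) (i + \<delta> + K) \<noteq> 0"
        using l by (intro pochhammer_nonzero) simp
      have b: "real (M choose i) / fact M = 1 / (fact i * fact (M - i))"
        using that by (simp add: binomial_fact)
      have "?T (M - i) = (-1) ^ (M - i) / fact (M - i) *
         (2 ^ (2 * i + \<delta>) * pochhammer (1/2) (i + \<delta>) / fact (2 * i + \<delta>)) *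
         (pochhammer ((l + 1 + K + \<delta>) + i) (M - K) * pochhammer ((1/2 + \<delta>) + i) K)"
        unfolding e1 e2 e3 p1 gegen_moment_def gauss_moment_def using p3 p2 by simp
      also have "\<dots> = (-1) ^ (M - i) * (real (M choose i) / fact M) *
         (pochhammer ((l + 1 + K + \<delta>) + i) (M - K) * pochhammer ((1/2 + \<delta>) + i) K)"
        unfolding pochhammer_half_fact[OF \<delta>] b by simp
      finally show ?thesis by simp
    qed
    have "(\<Sum>j\<le>M. ?T j) = (\<Sum>i\<le>M. ?T (M - i))"
      by (rule sum.reindex_bij_witness[of _ "\<lambda>i. M - i" "\<lambda>i. M - i"]) auto
    also have "\<dots> = (\<Sum>i\<le>M. (-1) ^ (M - i) * real (M choose i) *
       (pochhammer ((l + 1 + K + \<delta>) + i) (M - K) * pochhammer ((1/2 + \<delta>) + i) K) / fact M)"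
      using T by (intro sum.cong) auto
    also have "\<dots> = 1"
      using alternating_pochhammer_sum[of "M - K" K M "l + 1 + K + \<delta>" "1/2 + \<delta>"] KM
      unfolding sum_divide_distrib[symmetric] by simp
    finally show ?thesis using True unfolding * by (simp add: M_def)
  qed
qed

lemma gegen_functional_gegen_poly_parity:
  assumes "odd (n + k)"
  shows "gegen_functional l (gegen_poly n m * monom 1 k) = 0"
proof -
  have "gegen_moment l (n - 2 * j + k) = 0" if "j \<le> n div 2" for j
    using assms that by (auto simp: gegen_moment_def gauss_moment_def)
  then show ?thesis
    by (simp add: gegen_poly_def sum_distrib_right mult_monom moment_functional_sum moment_functional_monom)
qed

text \<open>Each monomial of \<open>q\<close> has the parity of \<open>n\<close> and degree at most
  \<open>n\<close>, so it contributes exactly its coefficient. Thus the Gegenbauer polynomial of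
  parameter \<open>l + 1\<close> represents evaluation at 1 on this space.\<close>

lemma gegen_functional_gegen_poly_eval:
  assumes "l > -1" "degree q \<le> n" and par: "\<And>i. coeff q i \<noteq> 0 \<Longrightarrow> even (n + i)"
  shows "gegen_functional l (gegen_poly n (l + 1) * q) = poly q 1"
proof -
  have "gegen_functional l (gegen_poly n (l + 1) * q) =
     (\<Sum>i\<le>degree q. coeff q i * gegen_functional l (gegen_poly n (l + 1) * monom 1 i))"
    by (rule moment_functional_times_sum)
  also have "\<dots> = (\<Sum>i\<le>degree q. coeff q i)"
  proof (rule sum.cong[OF refl])
    fix i assume "i \<in> {..degree q}"
    then have "i \<le> n" using assms by simp
    then show "coeff q i * gegen_functional l (gegen_poly n (l + 1) * monom 1 i) = coeff q i"
      using par[of i] assms(1) by (cases "coeff q i = 0") (simp_all add: gegen_functional_gegen_poly_monom)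
  qed
  finally show ?thesis by (simp add: poly_altdef)
qed

lemma gegen_functional_gegen_poly_odd:
  assumes par: "\<And>i. coeff q i \<noteq> 0 \<Longrightarrow> odd (n + i)"
  shows "gegen_functional l (gegen_poly n m * q) = 0"
proof -
  have "gegen_functional l (gegen_poly n m * q) =
     (\<Sum>i\<le>degree q. coeff q i * gegen_functional l (gegen_poly n m * monom 1 i))"
    by (rule moment_functional_times_sum)
  also have "\<dots> = 0"
    using par by (intro sum.neutral) (metis gegen_functional_gegen_poly_parity mult_zero_left mult_zero_right)
  finally show ?thesis .
qed

lemma degree_zonal_poly_le: "degree (zonal_poly n l) \<le> n"
  unfolding zonal_poly_def
  by (intro degree_diff_le) (auto intro: order_trans[OF degree_gegen_poly_le])

lemma coeff_gegen_poly_parity: "coeff (gegen_poly n l) i \<noteq> 0 \<Longrightarrow> even (n + i)"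
proof (rule ccontr)
  assume "coeff (gegen_poly n l) i \<noteq> 0" "odd (n + i)"
  moreover have "n - 2 * k \<noteq> i" if "k \<le> n div 2" for k using that \<open>odd (n + i)\<close> by auto
  ultimately show False by (simp add: gegen_poly_def coeff_sum)
qed

lemma coeff_zonal_poly_parity: "coeff (zonal_poly n l) i \<noteq> 0 \<Longrightarrow> even (n + i)"
proof -
  assume "coeff (zonal_poly n l) i \<noteq> 0"
  then have "coeff (gegen_poly n (l + 1)) i \<noteq> 0 \<or> n \<ge> 2 \<and> coeff (gegen_poly (n - 2) (l + 1)) i \<noteq> 0"
    by (auto simp: zonal_poly_def split: if_splits)
  then show ?thesis
  proof
    assume "n \<ge> 2 \<and> coeff (gegen_poly (n - 2) (l + 1)) i \<noteq> 0"
    then show ?thesis using coeff_gegen_poly_parity[of "n - 2" "l + 1" i] by simp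
  qed (rule coeff_gegen_poly_parity)
qed

text \<open>If \<open>k < n\<close> has the parity of \<open>n\<close>, then
  \<open>k \<le> n - 2\<close>, and both Gegenbauer polynomials in \<open>zonal_poly\<close> give 1,
  which cancels. For the other parity both give 0.\<close>

lemma gegen_functional_zonal_poly_monom:
  assumes "l > -1" "k < n"
  shows "gegen_functional l (zonal_poly n l * monom 1 k) = 0"
proof (cases "n \<ge> 2")
  case True
  have *: "zonal_poly n l * monom 1 k =
     gegen_poly n (l + 1) * monom 1 k - gegen_poly (n - 2) (l + 1) * monom 1 k"
    unfolding zonal_poly_def using True by (simp only: if_True left_diff_distrib)
  show ?thesis
  proof (cases "even (n + k)")
    case e: True
    then have "k \<le> n - 2" using assms(2) True by presburger
    moreover have "even (n - k)" "even (n - 2 - k)" using e by presburger+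
    ultimately have "gegen_functional l (gegen_poly (n - 2) (l + 1) * monom 1 k) = 1"
      and "gegen_functional l (gegen_poly n (l + 1) * monom 1 k) = 1"
      using gegen_functional_gegen_poly_monom[OF assms(1), of k "n - 2"]
        gegen_functional_gegen_poly_monom[OF assms(1) less_imp_le[OF assms(2)]]
      by simp_all
    then show ?thesis
      unfolding * moment_functional_diff by simp
  next
    case False
    then have "odd (n + k)" "odd (n - 2 + k)" using True by presburger+
    note p = this[THEN gegen_functional_gegen_poly_parity, of l "l + 1"]
    show ?thesis
      unfolding * moment_functional_diff p by simp
  qed
next
  case False
  then have n: "n = 1" "k = 0" using assms by auto
  have "gegen_functional l (gegen_poly 1 (l + 1) * monom 1 0) = 0"
    by (rule gegen_functional_gegen_poly_parity) simp
  moreover have "zonal_poly n l = gegen_poly 1 (l + 1)"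
    unfolding n(1) zonal_poly_def by simp
  ultimately show ?thesis
    unfolding n(2) by (simp only:)
qed

lemma gegen_functional_zonal_poly_orth:
  assumes "l > -1" "degree q < n"
  shows "gegen_functional l (zonal_poly n l * q) = 0"
  by (subst moment_functional_times_sum, rule sum.neutral)
    (use assms(2) gegen_functional_zonal_poly_monom[OF assms(1)] in force)

text \<open>The sum telescopes in steps of two, which leaves one term for each parity.\<close>

lemma sum_zonal_poly:
  "(\<Sum>m\<le>M. zonal_poly m l) = gegen_poly M (l + 1) + (if M = 0 then 0 else gegen_poly (M - 1) (l + 1))"
  by (induction M) (auto simp: zonal_poly_def numeral_2_eq_2 Suc_le_eq)

text \<open>Of the two terms left by telescoping, exactly one has the parity of a given monomial and
  yields 1. The sum is the Christoffel-Darboux kernel with one argument at 1, obtained without the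
  norms of the orthogonal polynomials.\<close>

lemma gegen_functional_sum_zonal_poly:
  assumes "l > -1" "degree q \<le> M"
  shows "gegen_functional l ((\<Sum>m\<le>M. zonal_poly m l) * q) = poly q 1"
proof -
  have "gegen_functional l ((\<Sum>m\<le>M. zonal_poly m l) * monom 1 k) = 1" if "k \<le> M" for k
  proof (cases "even (M + k)")
    case True
    then have "gegen_functional l (gegen_poly M (l + 1) * monom 1 k) = 1"
      using gegen_functional_gegen_poly_monom[OF assms(1) that] by simp
    moreover have "M \<noteq> 0 \<Longrightarrow> gegen_functional l (gegen_poly (M - 1) (l + 1) * monom 1 k) = 0"
      using True by (intro gegen_functional_gegen_poly_parity) (cases M; simp)
    ultimately show ?thesis unfolding sum_zonal_poly
      by (simp add: distrib_right moment_functional_add)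
  next
    case False
    then have "M \<noteq> 0" "k \<le> M - 1" "even (M - 1 - k)" using that by presburger+
    then have "gegen_functional l (gegen_poly (M - 1) (l + 1) * monom 1 k) = 1"
      using gegen_functional_gegen_poly_monom[OF assms(1), of k "M - 1"] by simp
    moreover have "gegen_functional l (gegen_poly M (l + 1) * monom 1 k) = 0"
      using False by (intro gegen_functional_gegen_poly_parity)
    ultimately show ?thesis using \<open>M \<noteq> 0\<close> unfolding sum_zonal_poly
      by (simp add: distrib_right moment_functional_add)
  qed
  then show ?thesis
    using assms(2) by (subst moment_functional_times_sum) (simp add: poly_altdef)
qed

lemma smult_sum_right: "smult c (\<Sum>i\<in>I. f i) = (\<Sum>i\<in>I. smult c (f i))"
  by (induction I rule: infinite_finite_induct) (simp_all add: smult_add_right)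

text \<open>The link with the usual form \<open>(n + l) / l\<close> times the Gegenbauer polynomial,
  multiplied by \<open>l\<close> to include \<open>l = 0\<close>. In the coefficient of index
  \<open>k\<close> the first polynomial supplies the factor \<open>l + n - k\<close> and the second,
  shifted by one index, supplies \<open>k\<close>; together they give \<open>n + l\<close>.\<close>

lemma smult_zonal_poly: "smult l (zonal_poly n l) = smult (n + l) (gegen_poly n l)"
proof (cases "n \<ge> 2")
  case False
  then consider "n = 0" | "n = 1" by linarith
  then show ?thesis
    by cases (simp_all add: zonal_poly_def gegen_poly_def smult_monom algebra_simps)
next
  case True
  define c where "c = (\<lambda>k. (-1) ^ k * 2 ^ (n - 2 * k) / (fact k * fact (n - 2 * k)) :: real)"
  have l: "l * pochhammer (l + 1) m = pochhammer l (Suc m)" for m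
    by (simp add: pochhammer_rec)
  have e1: "smult l (gegen_poly n (l + 1)) =
     (\<Sum>k\<le>n div 2. monom (c k * pochhammer l (n - k) * (l + n - k)) (n - 2 * k))"
    unfolding gegen_poly_def smult_sum_right smult_monom
  proof (intro sum.cong refl arg_cong[where f = "\<lambda>x. monom x _"])
    fix k assume "k \<in> {..n div 2}"
    then have k: "k \<le> n" by auto
    have "l * pochhammer (l + 1) (n - k) = pochhammer l (n - k) * (l + n - k)"
      unfolding l pochhammer_Suc using k by (simp add: of_nat_diff algebra_simps)
    then show "l * ((-1) ^ k * pochhammer (l + 1) (n - k) * 2 ^ (n - 2 * k) / (fact k * fact (n - 2 * k)))
        = c k * pochhammer l (n - k) * (l + n - k)"
      by (simp add: c_def)
  qed
  have "smult l (gegen_poly (n - 2) (l + 1)) =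
     (\<Sum>k\<le>n div 2 - 1. monom (- (c (Suc k) * pochhammer l (n - Suc k) * Suc k)) (n - 2 * Suc k))"
    unfolding gegen_poly_def smult_sum_right smult_monom
  proof (intro sum.cong refl)
    show "{..(n - 2) div 2} = {..n div 2 - 1}" by simp
    fix k assume "k \<in> {..n div 2 - 1}"
    then have k: "2 * Suc k \<le> n" using True by auto
    have e: "n - 2 - 2 * k = n - 2 * Suc k" "Suc (n - 2 - k) = n - Suc k" using k by auto
    have "l * pochhammer (l + 1) (n - 2 - k) = pochhammer l (n - Suc k)"
      unfolding l e(2) ..
    then show "monom (l * ((-1) ^ k * pochhammer (l + 1) (n - 2 - k) * 2 ^ (n - 2 - 2 * k) / (fact k * fact (n - 2 - 2 * k)))) (n - 2 - 2 * k)
       = monom (- (c (Suc k) * pochhammer l (n - Suc k) * Suc k)) (n - 2 * Suc k)"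
    proof -
      assume h: "l * pochhammer (l + 1) (n - 2 - k) = pochhammer l (n - Suc k)"
      have f: "real (Suc k) / fact (Suc k) = 1 / fact k"
        by (simp del: of_nat_Suc)
      have "c (Suc k) * Suc k = (-1) ^ Suc k * 2 ^ (n - 2 * Suc k) / fact (n - 2 * Suc k) * (real (Suc k) / fact (Suc k))"
        by (simp add: c_def del: of_nat_Suc fact_Suc)
      moreover have "- (c (Suc k) * pochhammer l (n - Suc k) * Suc k) =
          - (c (Suc k) * Suc k) * pochhammer l (n - Suc k)"
        by (simp only: mult_ac minus_mult_left)
      ultimately have "- (c (Suc k) * pochhammer l (n - Suc k) * Suc k) =
          (-1) ^ k * 2 ^ (n - 2 * Suc k) / fact (n - 2 * Suc k) * (1 / fact k) * pochhammer l (n - Suc k)"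
        unfolding f by simp
      then show ?thesis
        unfolding e(1) h[symmetric] by (simp add: mult_ac del: of_nat_Suc)
    qed
  qed
  also have "\<dots> = (\<Sum>k\<in>{1..n div 2}. monom (- (c k * pochhammer l (n - k) * k)) (n - 2 * k))"
    using True by (intro sum.reindex_bij_witness[of _ "\<lambda>k. k - 1" Suc]) auto
  also have "\<dots> = (\<Sum>k\<le>n div 2. monom (- (c k * pochhammer l (n - k) * k)) (n - 2 * k))"
    by (rule sum.mono_neutral_left) (auto simp: not_le Suc_le_eq)
  finally have e2: "smult l (gegen_poly (n - 2) (l + 1)) = \<dots>" .
  have "smult l (zonal_poly n l) = smult l (gegen_poly n (l + 1)) - smult l (gegen_poly (n - 2) (l + 1))"
    using True by (simp add: zonal_poly_def smult_diff_right)
  also have "\<dots> = smult (n + l) (gegen_poly n l)"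
    unfolding e1 e2 unfolding gegen_poly_def sum_subtractf[symmetric] diff_monom smult_sum_right smult_monom
  proof (intro sum.cong refl arg_cong[where f = "\<lambda>x. monom x _"])
    fix k
    have "(-1) ^ k * pochhammer l (n - k) * 2 ^ (n - 2 * k) / (fact k * fact (n - 2 * k)) = c k * pochhammer l (n - k)"
      by (simp add: c_def)
    then show "c k * pochhammer l (n - k) * (l + n - k) - - (c k * pochhammer l (n - k) * k) =
       (n + l) * ((-1) ^ k * pochhammer l (n - k) * 2 ^ (n - 2 * k) / (fact k * fact (n - 2 * k)))"
      by (simp only: algebra_simps)
  qed
  finally show ?thesis .
qed

lemma poly_zonal_poly:
  assumes "l > 0"
  shows "poly (zonal_poly n l) t = zonal n l t"
proof -
  have "l * poly (zonal_poly n l) t = (n + l) * gegenbauer n l t"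
    using arg_cong[OF smult_zonal_poly, of "\<lambda>p. poly p t" l n]
    by (simp add: poly_gegen_poly gegenbauer_def)
  then show ?thesis using assms by (simp add: zonal_def field_simps)
qed

text \<open>For \<open>n \<ge> 1\<close> the zonal polynomial is orthogonal to constants, and
  \<open>n + l > 0\<close> allows passing from it to the Gegenbauer polynomial, also when
  \<open>l = 0\<close>.\<close>

lemma gegen_functional_gegen_poly_self:
  assumes "l > -1"
  shows "gegen_functional l (gegen_poly n l) = (if n = 0 then 1 else 0)"
proof (cases "n = 0")
  case True
  then show ?thesis
    using moment_functional_monom[of "gegen_moment l" 1 0]
    by (simp add: gegen_poly_def gegen_moment_def gauss_moment_def)
next
  case False
  have "(n + l) * gegen_functional l (gegen_poly n l) = l * gegen_functional l (zonal_poly n l)"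
    by (metis moment_functional_smult smult_zonal_poly)
  moreover have "gegen_functional l (zonal_poly n l) = 0"
    using gegen_functional_zonal_poly_orth[OF assms, of 1 n] False by simp
  moreover have "n + l > 0" using False assms by (cases n) auto
  ultimately show ?thesis using False by simp
qed

section \<open>The Beta coupling of two Gegenbauer laws\<close>

definition coupling_moment :: "real \<Rightarrow> real \<Rightarrow> nat \<Rightarrow> nat \<Rightarrow> real" where
  "coupling_moment a b i j = pochhammer a i * pochhammer b j / pochhammer (a + b) (i + j)"

text \<open>For positive parameters \<open>coupling_moment a b i j\<close> is the expectation of
  \<open>h ^ i * (1 - h) ^ j\<close> under Beta(\<open>a\<close>, \<open>b\<close>). The identity
  compares coefficients of X^i Y^j in Feynman's parametrisation: the product of the generating
  functions (1 - 2rX + r^2)^(-a) and (1 - 2rY + r^2)^(-b) is the Beta average of (1 - 2r(hX +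
  (1-h)Y) + r^2)^(-a-b). In coefficients this is the Chu-Vandermonde identity.\<close>

lemma coupling_gegen_coeff:
  assumes ab: "a + b > 0"
  defines "c \<equiv> \<lambda>\<nu> n k. (-1) ^ k * pochhammer \<nu> (n - k) * 2 ^ (n - 2 * k)
      / (fact k * fact (n - 2 * k)) :: real"
  shows "c (a + b) (i + j + 2 * k) k * real ((i + j) choose i) * coupling_moment a b i j =
    (\<Sum>m\<le>k. c a (i + 2 * m) m * c b (j + 2 * (k - m)) (k - m))"
proof -
  have split: "pochhammer \<nu> (p + q) = pochhammer \<nu> p * pochhammer (\<nu> + p) q" for \<nu> :: real and p q
    by (rule pochhammer_product')
  have nz: "pochhammer (a + b) (i + j) \<noteq> 0"
    using ab by (rule pochhammer_nonzero)
  have "(\<Sum>m\<le>k. c a (i + 2 * m) m * c b (j + 2 * (k - m)) (k - m)) =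
    (\<Sum>m\<le>k. ((-1) ^ k * 2 ^ (i + j) / (fact i * fact j) * pochhammer a i * pochhammer b j / fact k)
        * (real (k choose m) * pochhammer (a + i) m * pochhammer (b + j) (k - m)))"
  proof (rule sum.cong[OF refl])
    fix m assume "m \<in> {..k}"
    then have m: "m \<le> k" by simp
    have s: "(-1 :: real) ^ k = (-1) ^ m * (-1) ^ (k - m)"
      using m by (simp flip: power_add)
    have b: "real (k choose m) / fact k = 1 / (fact m * fact (k - m))"
      using m by (simp add: binomial_fact)
    have e: "i + 2 * m - m = i + m" "j + 2 * (k - m) - (k - m) = j + (k - m)"
       "i + 2 * m - 2 * m = i" "j + 2 * (k - m) - 2 * (k - m) = j" using m by auto
    have "c a (i + 2 * m) m * c b (j + 2 * (k - m)) (k - m) =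
      ((-1) ^ k * 2 ^ (i + j) / (fact i * fact j) * pochhammer a i * pochhammer b j)
        * (1 / (fact m * fact (k - m))) * (pochhammer (a + i) m * pochhammer (b + j) (k - m))"
      unfolding c_def e split s by (simp add: power_add mult_ac)
    then show "c a (i + 2 * m) m * c b (j + 2 * (k - m)) (k - m) =
      ((-1) ^ k * 2 ^ (i + j) / (fact i * fact j) * pochhammer a i * pochhammer b j / fact k)
        * (real (k choose m) * pochhammer (a + i) m * pochhammer (b + j) (k - m))"
      unfolding b[symmetric] by simp
  qed
  also have "\<dots> = (-1) ^ k * 2 ^ (i + j) / (fact i * fact j) * pochhammer a i * pochhammer b j / fact k
       * pochhammer ((a + i) + (b + j)) k"
    unfolding sum_distrib_left[symmetric] pochhammer_binomial_sum[symmetric] ..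
  also have "(a + i) + (b + j) = (a + b) + real (i + j)" by simp
  also have "(-1) ^ k * 2 ^ (i + j) / (fact i * fact j) * pochhammer a i * pochhammer b j / fact k
       * pochhammer ((a + b) + real (i + j)) k =
     c (a + b) (i + j + 2 * k) k * real ((i + j) choose i) * coupling_moment a b i j"
  proof -
    have e: "i + j + 2 * k - k = (i + j) + k" "i + j + 2 * k - 2 * k = i + j" by auto
    have "real ((i + j) choose i) / fact (i + j) = 1 / (fact i * fact j)"
      by (simp add: binomial_fact)
    then have "c (a + b) (i + j + 2 * k) k * real ((i + j) choose i) =
       (-1) ^ k * 2 ^ (i + j) / (fact i * fact j) * (pochhammer (a + b) ((i + j) + k) / fact k)"
      unfolding c_def e by (simp add: field_simps)
    then show ?thesis
      unfolding split[of _ "i + j"] coupling_moment_def using nz by (simp add: mult_ac)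
  qed
  finally show ?thesis ..
qed

text \<open>Averaging over \<open>h\<close> with the Beta(\<open>a\<close>, \<open>b\<close>) law turns the Gegenbauer polynomial of \<open>h X + (1 - h) Y\<close>
  with parameter \<open>a + b\<close> into a convolution; averaging the second factor over the Gegenbauer
  weight with parameter \<open>b\<close> leaves only one term of it.\<close>

lemma coupling_gegen_poly:
  assumes ab: "a + b > 0" and b: "b > -1"
  shows "moment_functional
      (\<lambda>p. \<Sum>i\<le>p. real (p choose i) * coupling_moment a b i (p - i) * gegen_moment b (p - i) * m i)
      (gegen_poly n (a + b)) = moment_functional m (gegen_poly n a)"
proof -
  define c where "c = (\<lambda>\<nu> n k. (-1) ^ k * pochhammer \<nu> (n - k) * 2 ^ (n - 2 * k)
      / (fact k * fact (n - 2 * k)) :: real)"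
  have mf: "moment_functional g (gegen_poly n \<nu>) = (\<Sum>k\<le>n div 2. c \<nu> n k * g (n - 2 * k))" for g n \<nu>
    by (simp add: gegen_poly_def moment_functional_sum moment_functional_monom c_def)
  have "moment_functional
      (\<lambda>p. \<Sum>i\<le>p. real (p choose i) * coupling_moment a b i (p - i) * gegen_moment b (p - i) * m i)
      (gegen_poly n (a + b)) =
      (\<Sum>k\<le>n div 2. \<Sum>i\<le>n - 2 * k. (c (a + b) n k * real ((n - 2 * k) choose i)
        * coupling_moment a b i (n - 2 * k - i)) * (gegen_moment b (n - 2 * k - i) * m i))"
    unfolding mf sum_distrib_left by (simp add: mult_ac)
  also have "\<dots> = (\<Sum>k\<le>n div 2. \<Sum>i\<le>n - 2 * k. \<Sum>l\<le>k.
       c a (i + 2 * l) l * m i * (c b (n - 2 * l - i) (k - l) * gegen_moment b (n - 2 * l - i - 2 * (k - l))))"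
  proof (intro sum.cong refl)
    fix k i assume "k \<in> {..n div 2}" "i \<in> {..n - 2 * k}"
    then have ki: "2 * k + i \<le> n" by auto
    define j where "j = n - 2 * k - i"
    have e: "n = i + j + 2 * k" "n - 2 * k = i + j" "n - 2 * k - i = j" "i + j - i = j" using ki by (auto simp: j_def)
    have "c (a + b) n k * real ((n - 2 * k) choose i) * coupling_moment a b i (n - 2 * k - i)
      = (\<Sum>m\<le>k. c a (i + 2 * m) m * c b (j + 2 * (k - m)) (k - m))"
      unfolding e(2) e(4) using coupling_gegen_coeff[OF ab, where i = i and j = j and k = k] unfolding c_def e(1) .
    then show "(c (a + b) n k * real ((n - 2 * k) choose i)
        * coupling_moment a b i (n - 2 * k - i)) * (gegen_moment b (n - 2 * k - i) * m i)
       = (\<Sum>l\<le>k. c a (i + 2 * l) l * m i * (c b (n - 2 * l - i) (k - l) * gegen_moment b (n - 2 * l - i - 2 * (k - l))))"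
      using ki by (simp add: sum_distrib_right)
       (intro sum.cong refl, simp add: j_def algebra_simps)
  qed
  also have "\<dots> = (\<Sum>(k, i, l) \<in> (SIGMA k:{..n div 2}. {..n - 2 * k} \<times> {..k}).
       c a (i + 2 * l) l * m i * (c b (n - 2 * l - i) (k - l) * gegen_moment b (n - 2 * l - i - 2 * (k - l))))"
    by (simp add: sum.Sigma sum.cartesian_product)
  \<comment> \<open>Splitting the index into the part \<open>l\<close> for the factor of parameter
    \<open>a\<close> and the rest for the factor of parameter \<open>b\<close> makes the inner sum
    the expectation of a Gegenbauer polynomial of degree \<open>n - 2 * l - i\<close> and parameter
    \<open>b\<close>, which vanishes unless this degree is 0.\<close>
  also have "\<dots> = (\<Sum>(l, i, k) \<in> (SIGMA l:{..n div 2}. SIGMA i:{..n - 2 * l}. {..(n - 2 * l - i) div 2}).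
       c a (i + 2 * l) l * m i * (c b (n - 2 * l - i) k * gegen_moment b (n - 2 * l - i - 2 * k)))"
    by (rule sum.reindex_bij_witness[of _ "\<lambda>(l, i, k). (k + l, i, l)" "\<lambda>(k, i, l). (l, i, k - l)"]) auto
  also have "\<dots> = (\<Sum>l\<le>n div 2. \<Sum>i\<le>n - 2 * l. c a (i + 2 * l) l * m i *
       gegen_functional b (gegen_poly (n - 2 * l - i) b))"
    unfolding mf sum_distrib_left by (simp add: sum.Sigma)
  also have "\<dots> = (\<Sum>l\<le>n div 2. \<Sum>i\<le>n - 2 * l. if i = n - 2 * l then c a n l * m i else 0)"
    by (intro sum.cong refl) (auto simp: gegen_functional_gegen_poly_self[OF b])
  also have "\<dots> = moment_functional m (gegen_poly n a)"
    unfolding mf by simp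
  finally show ?thesis .
qed

subsection \<open>Beta integrals on the interval\<close>

lemma has_bochner_integral_reflect:
  fixes f :: "real \<Rightarrow> real"
  assumes "has_bochner_integral lborel f x"
  shows "has_bochner_integral lborel (\<lambda>t. f (- t)) x"
  using assms lborel_has_bochner_integral_real_affine_iff[of "-1" f x 0] by simp

lemma has_bochner_integral_odd:
  fixes f :: "real \<Rightarrow> real"
  assumes "integrable lborel f" "\<And>t. f (- t) = - f t"
  shows "has_bochner_integral lborel f 0"
proof -
  have *: "has_bochner_integral lborel f (integral\<^sup>L lborel f)"
    using assms(1) by (rule has_bochner_integral_integrable)
  have "has_bochner_integral lborel (\<lambda>t. - f t) (integral\<^sup>L lborel f)"
    using has_bochner_integral_reflect[OF *] by (simp add: assms(2))
  then have "has_bochner_integral lborel (\<lambda>t. - f t) (integral\<^sup>L lborel f)"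
    "has_bochner_integral lborel (\<lambda>t. - f t) (- integral\<^sup>L lborel f)"
    using has_bochner_integral_minus[OF *] by auto
  then have "integral\<^sup>L lborel f = - integral\<^sup>L lborel f"
    by (rule has_bochner_integral_eq)
  then show ?thesis using * by simp
qed

lemma has_bochner_integral_Beta:
  fixes a b :: real
  assumes "a > 0" "b > 0"
  shows "has_bochner_integral lborel (\<lambda>t. indicator {0..1} t * (t powr (a - 1) * (1 - t) powr (b - 1))) (Beta a b)"
proof -
  have si: "set_integrable lborel {0..1} (\<lambda>t. t powr (a - 1) * (1 - t) powr (b - 1))"
    using integrable_Beta[OF assms] .
  then have "(LINT t:{0..1}|lborel. t powr (a - 1) * (1 - t) powr (b - 1)) = Beta a b"
    using has_integral_Beta_real[OF assms] set_borel_integral_eq_integral(2)[OF si] by (simp add: integral_unique)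
  then show ?thesis
    using si by (simp add: has_bochner_integral_iff set_integrable_def set_lebesgue_integral_def)
qed

text \<open>The substitution \<open>u = t\<^sup>2\<close> in the Beta integral gives the half over
  [0,1]; reflection gives the other half.\<close>

lemma has_bochner_integral_even_Beta:
  fixes a b :: real
  assumes "a > 0" "b > 0"
  shows "has_bochner_integral lborel
    (\<lambda>t. indicator {-1..1} t * (\<bar>t\<bar> powr (2 * a - 1) * (1 - t\<^sup>2) powr (b - 1))) (Beta a b)"
proof -
  define h where "h t = \<bar>t\<bar> powr (2 * a - 1) * (1 - t\<^sup>2) powr (b - 1)" for t :: real
  define f where "f u = u powr (a - 1) * (1 - u) powr (b - 1) / 2" for u :: real
  have hb: "has_bochner_integral lborel (\<lambda>t. indicator {0..1} t * f t) (Beta a b / 2)"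
    using has_bochner_integral_mult_left[OF has_bochner_integral_Beta[OF assms], of "1/2"]
    by (simp add: f_def mult_ac)
  \<comment> \<open>At \<open>t = 0\<close> both sides vanish, since \<open>0 powr x = 0\<close> for
    every exponent.\<close>
  have eq: "f (t\<^sup>2) * (2 * t) * indicator {0..1} t = indicator {0..1} t * h t" for t
  proof (cases "t > 0 \<and> t \<le> 1")
    case True
    have "(t\<^sup>2) powr (a - 1) * t = t powr (2 * a - 1)"
    proof -
      have "(t\<^sup>2) powr (a - 1) * t = t powr (2 * (a - 1)) * t powr 1"
        using True by (simp add: powr_powr flip: powr_numeral)
      also have "\<dots> = t powr (2 * (a - 1) + 1)" by (rule powr_add[symmetric])
      finally show ?thesis by (simp add: algebra_simps)
    qed
    then show ?thesis using True by (simp add: f_def h_def field_simps)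
  qed (auto simp: h_def indicator_def)
  have int_f: "set_integrable lborel {0\<^sup>2..1\<^sup>2} f"
    using hb by (simp add: has_bochner_integral_iff set_integrable_def)
  note sub = integral_substitution[where g = "\<lambda>t. t\<^sup>2" and g' = "\<lambda>t. 2 * t" and a = 0 and b = 1, OF int_f]
  have h0: "has_bochner_integral lborel (\<lambda>t. indicator {0..1} t * h t) (Beta a b / 2)"
  proof -
    have "set_integrable lborel {0..1} (\<lambda>t. f (t\<^sup>2) * (2 * t))"
      by (rule sub(1)) (auto intro!: derivative_eq_intros continuous_intros)
    then have "integrable lborel (\<lambda>t. indicator {0..1} t * h t)"
    proof -
      assume "set_integrable lborel {0..1} (\<lambda>t. f (t\<^sup>2) * (2 * t))"
      moreover have "(\<lambda>t. indicator {0..1} t *\<^sub>R (f (t\<^sup>2) * (2 * t))) = (\<lambda>t. indicator {0..1} t * h t)"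
      proof
        fix t
        have "indicator {0..1} t *\<^sub>R (f (t\<^sup>2) * (2 * t)) = f (t\<^sup>2) * (2 * t) * indicator {0..1} t"
          unfolding real_scaleR_def by (rule mult.commute)
        then show "indicator {0..1} t *\<^sub>R (f (t\<^sup>2) * (2 * t)) = indicator {0..1} t * h t"
          unfolding eq .
      qed
      ultimately show ?thesis unfolding set_integrable_def by simp
    qed
    moreover have "(LBINT t. f t * indicator {0\<^sup>2..1\<^sup>2} t) = (LBINT t. f (t\<^sup>2) * (2 * t) * indicator {0..1} t)"
      by (rule sub(2)) (auto intro!: derivative_eq_intros continuous_intros)
    moreover have "(LBINT t. f t * indicator {0\<^sup>2..1\<^sup>2} t) = Beta a b / 2"
      using hb by (simp add: has_bochner_integral_iff mult_ac)
    ultimately show ?thesis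
      unfolding eq by (simp add: has_bochner_integral_iff)
  qed
  have "has_bochner_integral lborel (\<lambda>t. indicator {0..1} t * h t + indicator {0..1} (- t) * h (- t)) (Beta a b / 2 + Beta a b / 2)"
    by (intro has_bochner_integral_add h0 has_bochner_integral_reflect[OF h0])
  also have "(\<lambda>t. indicator {0..1} t * h t + indicator {0..1} (- t) * h (- t)) = (\<lambda>t. indicator {-1..1} t * h t)"
    by (auto simp: fun_eq_iff indicator_def h_def)
  finally show ?thesis by (simp add: h_def)
qed

lemma has_bochner_integral_power_Beta:
  fixes a b :: real
  assumes "a > 0" "b > 0"
  shows "has_bochner_integral lborel
    (\<lambda>t. indicator {-1..1} t * (\<bar>t\<bar> powr (2 * a - 1) * t ^ k * (1 - t\<^sup>2) powr (b - 1)))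
    (if even k then Beta (a + k / 2) b else 0)"
proof -
  have e: "\<bar>t\<bar> powr (2 * a - 1) * \<bar>t\<bar> ^ k = \<bar>t\<bar> powr (2 * (a + k / 2) - 1)" for t :: real
    by (cases "t = 0") (simp_all add: powr_add[symmetric] powr_realpow[symmetric] algebra_simps)
  have ab: "has_bochner_integral lborel
    (\<lambda>t. indicator {-1..1} t * (\<bar>t\<bar> powr (2 * a - 1) * \<bar>t\<bar> ^ k * (1 - t\<^sup>2) powr (b - 1))) (Beta (a + k / 2) b)"
    using has_bochner_integral_even_Beta[of "a + k / 2" b] assms unfolding e by simp
  show ?thesis
  proof (cases "even k")
    case True
    then show ?thesis using ab by (simp add: power_even_abs)
  next
    case False
    have "integrable lborel (\<lambda>t. indicator {-1..1} t * (\<bar>t\<bar> powr (2 * a - 1) * t ^ k * (1 - t\<^sup>2) powr (b - 1)))"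
    proof (rule Bochner_Integration.integrable_bound)
      show "integrable lborel
         (\<lambda>t. indicator {-1..1} t * (\<bar>t\<bar> powr (2 * a - 1) * \<bar>t\<bar> ^ k * (1 - t\<^sup>2) powr (b - 1)))"
        using ab by (simp add: has_bochner_integral_iff)
    qed (auto simp: abs_mult power_abs)
    then have "has_bochner_integral lborel (\<lambda>t. indicator {-1..1} t * (\<bar>t\<bar> powr (2 * a - 1) * t ^ k * (1 - t\<^sup>2) powr (b - 1))) 0"
    proof (rule has_bochner_integral_odd)
      fix t :: real
      have "indicator {-1..1} (- t) = (indicator {-1..1} t :: real)" by (auto simp: indicator_def)
      then show "indicator {-1..1} (- t) * (\<bar>- t\<bar> powr (2 * a - 1) * (- t) ^ k * (1 - (- t)\<^sup>2) powr (b - 1)) =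
        - (indicator {-1..1} t * (\<bar>t\<bar> powr (2 * a - 1) * t ^ k * (1 - t\<^sup>2) powr (b - 1)))"
        using False by simp
    qed
    then show ?thesis using False by simp
  qed
qed

lemma Gamma_add_of_nat:
  fixes x :: real
  assumes "x > 0"
  shows "Gamma (x + real n) = pochhammer x n * Gamma x"
  using pochhammer_Gamma[of x n] Gamma_real_pos[OF assms] assms
  by (auto simp: nonpos_Ints_def field_simps)

lemma has_bochner_integral_gegen_moment:
  assumes l: "l > -1/2"
  shows "has_bochner_integral lborel (\<lambda>t. indicator {-1..1} t * (t ^ k * (1 - t\<^sup>2) powr (l - 1/2)))
    (gegen_moment l k / gegenbauer_const l)"
proof -
  have "(if even k then Beta (1/2 + k / 2) (l + 1/2) else 0) = gegen_moment l k / gegenbauer_const l"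
  proof (cases "even k")
    case True
    then obtain j where j: "k = 2 * j" by (elim evenE)
    have "Beta (1/2 + real j) (l + 1/2) = Gamma (1/2 + real j) * Gamma (l + 1/2) / Gamma ((l + 1) + real j)"
      by (simp add: Beta_def add_ac)
    also have "\<dots> = gegen_moment l k / gegenbauer_const l"
      using l Gamma_real_pos[of "l + 1"] pochhammer_pos[of "l + 1" j] Gamma_real_pos[of "l + 1/2"]
      by (simp add: Gamma_add_of_nat gegen_moment_def gauss_moment_def gegenbauer_const_def j)
    finally show ?thesis by (simp add: j)
  qed (simp add: gegen_moment_def gauss_moment_def)
  \<comment> \<open>The general formula with \<open>a = 1/2\<close> carries the factor
    \<open>\<bar>t\<bar> powr 0\<close>, which is 0 and not 1 at \<open>t = 0\<close>; the
    integrands therefore agree only almost everywhere.\<close>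
  moreover have "has_bochner_integral lborel (\<lambda>t. indicator {-1..1} t * (t ^ k * (1 - t\<^sup>2) powr (l - 1/2))) x \<longleftrightarrow>
    has_bochner_integral lborel (\<lambda>t. indicator {-1..1} t * (\<bar>t\<bar> powr (2 * (1/2) - 1) * t ^ k * (1 - t\<^sup>2) powr (l + 1/2 - 1))) x" for x
  proof (rule has_bochner_integral_cong_AE)
    show "AE t in lborel. indicator {-1..1} t * (t ^ k * (1 - t\<^sup>2) powr (l - 1/2)) =
       indicator {-1..1} t * (\<bar>t\<bar> powr (2 * (1/2) - 1) * t ^ k * (1 - t\<^sup>2) powr (l + 1/2 - 1))"
    proof -
      have l': "l + 1/2 - 1 = l - 1/2" by simp
      show ?thesis
        using AE_lborel_singleton[of 0] unfolding l' by eventually_elim simp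
    qed
  qed auto
  ultimately show ?thesis
    using has_bochner_integral_power_Beta[of "1/2" "l + 1/2" k] l by simp
qed

text \<open>The affine map \<open>u = (1 + z) / 2\<close> leads to the Beta integral over [0,1].
  Since \<open>a\<close> belongs to the factor \<open>1 - z\<close>, the two parameters appear there
  in exchanged order; the power of two collects the Jacobian and the scaling of the weight.\<close>

lemma has_bochner_integral_coupling_moment:
  fixes a b :: real
  assumes "a > 0" "b > 0"
  shows "has_bochner_integral lborel
    (\<lambda>z. indicator {-1..1} z * (((1 - z) / 2) ^ i * ((1 + z) / 2) ^ j * ((1 - z) powr (a - 1) * (1 + z) powr (b - 1))))
    (2 powr (a + b - 1) * Beta a b * (pochhammer a i * pochhammer b j / pochhammer (a + b) (i + j)))"
proof -
  have e: "Beta (b + j) (a + i) = Beta a b * (pochhammer a i * pochhammer b j / pochhammer (a + b) (i + j))"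
    using assms Gamma_add_of_nat[of "a + b" "i + j"]
    by (simp add: Beta_def Gamma_add_of_nat add_ac mult_ac)
  define f where "f u = indicator {0..1} u * (u powr (b + j - 1) * (1 - u) powr (a + i - 1))" for u :: real
  have "has_bochner_integral lborel f (Beta (b + j) (a + i))"
    unfolding f_def using assms by (intro has_bochner_integral_Beta) auto
  then have "has_bochner_integral lborel (\<lambda>z. f (1/2 + 1/2 * z)) (2 * Beta (b + j) (a + i))"
    using lborel_has_bochner_integral_real_affine_iff[of "1/2" f _ "1/2"] by simp
  then have "has_bochner_integral lborel (\<lambda>z. 2 powr (a + b - 2) * f (1/2 + 1/2 * z)) (2 powr (a + b - 2) * (2 * Beta (b + j) (a + i)))"
    by (rule has_bochner_integral_mult_right)
  also have "2 powr (a + b - 2) * (2 * Beta (b + j) (a + i)) = 2 powr (a + b - 1) * Beta (b + j) (a + i)"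
    using powr_add[of 2 "a + b - 2" 1] by simp
  finally have "has_bochner_integral lborel (\<lambda>z. 2 powr (a + b - 2) * f (1/2 + 1/2 * z)) (2 powr (a + b - 1) * Beta (b + j) (a + i))" .
  moreover have "has_bochner_integral lborel (\<lambda>z. 2 powr (a + b - 2) * f (1/2 + 1/2 * z)) x \<longleftrightarrow>
    has_bochner_integral lborel
    (\<lambda>z. indicator {-1..1} z * (((1 - z) / 2) ^ i * ((1 + z) / 2) ^ j * ((1 - z) powr (a - 1) * (1 + z) powr (b - 1)))) x" for x
  proof (rule has_bochner_integral_cong_AE)
    show "AE z in lborel. 2 powr (a + b - 2) * f (1/2 + 1/2 * z) =
       indicator {-1..1} z * (((1 - z) / 2) ^ i * ((1 + z) / 2) ^ j * ((1 - z) powr (a - 1) * (1 + z) powr (b - 1)))"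
      using AE_lborel_singleton[of 1] AE_lborel_singleton[of "-1"]
    proof eventually_elim
      fix z :: real assume z: "z \<noteq> 1" "z \<noteq> -1"
      show "2 powr (a + b - 2) * f (1/2 + 1/2 * z) =
       indicator {-1..1} z * (((1 - z) / 2) ^ i * ((1 + z) / 2) ^ j * ((1 - z) powr (a - 1) * (1 + z) powr (b - 1)))"
      proof (cases "z \<in> {-1<..<1}")
        case True
        have u: "((1 + z) / 2) powr (b + j - 1) = (1 + z) powr (b - 1) / 2 powr (b - 1) * ((1 + z) / 2) ^ j"
          "((1 - z) / 2) powr (a + i - 1) = (1 - z) powr (a - 1) / 2 powr (a - 1) * ((1 - z) / 2) ^ i"
          using True powr_add[of "(1 + z) / 2" "b - 1" j] powr_add[of "(1 - z) / 2" "a - 1" i]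
          by (auto simp: powr_divide powr_realpow power_divide algebra_simps)
        have p: "2 powr (a + b - 2) = 2 powr (a - 1) * 2 powr (b - 1 :: real)"
          by (simp flip: powr_add)
        have e: "1/2 + 1/2 * z = (1 + z) / 2" "1 - (1 + z) / 2 = (1 - z) / 2"
          "indicator {0..1} ((1 + z) / 2) = (1 :: real)"
          using True by (auto simp: field_simps indicator_def)
        have "f (1/2 + 1/2 * z) = ((1 + z) / 2) powr (b + j - 1) * ((1 - z) / 2) powr (a + i - 1)"
          unfolding e(1) f_def e(2,3) by (rule mult_1_left)
        then show ?thesis
          unfolding u p using True by simp
      next
        case False
        then have "z \<notin> {-1..1}" using z by auto
        then show ?thesis by (auto simp: f_def indicator_def)
      qed
    qed
  qed (auto simp: f_def)
  ultimately show ?thesis unfolding e by (simp add: mult_ac)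
qed

section \<open>Positivity, and the value of zonal polynomials at 1\<close>

lemma gegenbauer_const_pos: "l > -1/2 \<Longrightarrow> gegenbauer_const l > 0"
  by (simp add: gegenbauer_const_def Gamma_real_pos)

lemma has_bochner_integral_gegen_functional:
  assumes "l > -1/2"
  shows "has_bochner_integral lborel (\<lambda>t. indicator {-1..1} t * (poly p t * (1 - t\<^sup>2) powr (l - 1/2)))
    (gegen_functional l p / gegenbauer_const l)"
proof -
  have "has_bochner_integral lborel
     (\<lambda>t. \<Sum>i\<le>degree p. coeff p i * (indicator {-1..1} t * (t ^ i * (1 - t\<^sup>2) powr (l - 1/2))))
     (\<Sum>i\<le>degree p. coeff p i * (gegen_moment l i / gegenbauer_const l))"
    by (intro has_bochner_integral_sum has_bochner_integral_mult_right has_bochner_integral_gegen_moment assms)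
  then show ?thesis
    by (simp add: poly_altdef sum_distrib_left sum_distrib_right moment_functional_def sum_divide_distrib mult_ac)
qed

text \<open>The integrand is nonnegative, and a vanishing integral would leave no points of (-1,1)
  but the finitely many roots of \<open>p\<close>, up to a null set.\<close>

lemma gegen_functional_square_pos:
  assumes "l > -1/2" "p \<noteq> 0"
  shows "gegen_functional l (p * p) > 0"
proof -
  define f where "f t = indicator {-1..1} t * (poly (p * p) t * (1 - t\<^sup>2) powr (l - 1/2))" for t
  have f: "has_bochner_integral lborel f (gegen_functional l (p * p) / gegenbauer_const l)"
    unfolding f_def by (rule has_bochner_integral_gegen_functional[OF assms(1)])
  have nn: "f t \<ge> 0" for t by (simp add: f_def)
  have "integral\<^sup>L lborel f \<noteq> 0"
  proof
    assume "integral\<^sup>L lborel f = 0"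
    then have "AE t in lborel. f t = 0"
      using f nn by (subst (asm) integral_nonneg_eq_0_iff_AE) (auto simp: has_bochner_integral_iff)
    moreover have "AE t in lborel. t \<notin> {t. poly p t = 0}"
      using poly_roots_finite[OF assms(2)] by (intro AE_not_in finite_imp_null_set_lborel)
    ultimately have "AE t in lborel. t \<notin> {-1<..<(1::real)}"
    proof eventually_elim
      case (elim t)
      show ?case
      proof
        assume t: "t \<in> {-1<..<1}"
        then have "1 - t\<^sup>2 > 0" by (simp add: abs_square_less_1 abs_less_iff)
        then show False using elim t by (auto simp: f_def)
      qed
    qed
    then have "{-1<..<(1::real)} \<in> null_sets lborel"
      by (subst AE_iff_null_sets) auto
    then show False by (simp add: null_sets_def)
  qed
  moreover have "integral\<^sup>L lborel f \<ge> 0" using nn by simp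
  ultimately have "integral\<^sup>L lborel f > 0" by simp
  then have "gegen_functional l (p * p) / gegenbauer_const l > 0"
    using f by (simp add: has_bochner_integral_iff)
  then show ?thesis using gegenbauer_const_pos[OF assms(1)] by (simp add: zero_less_divide_iff)
qed

lemma coeff_gegen_poly_degree: "coeff (gegen_poly n l) n = pochhammer l n * 2 ^ n / fact n"
proof -
  have "coeff (gegen_poly n l) n = (\<Sum>k\<le>n div 2. if k = 0 then pochhammer l n * 2 ^ n / fact n else 0)"
    unfolding gegen_poly_def coeff_sum by (intro sum.cong refl) auto
  then show ?thesis by simp
qed

text \<open>The leading coefficients do not vanish, so the tests determine the moments one after the
  other.\<close>

lemma moment_functional_gegen_poly_eqD:
  assumes "l > 0" and eq: "\<And>n. moment_functional m (gegen_poly n l) = moment_functional m' (gegen_poly n l)"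
  shows "m k = m' k"
proof (induction k rule: less_induct)
  case (less k)
  have "(\<Sum>i\<le>k. coeff (gegen_poly k l) i * m i) = (\<Sum>i\<le>k. coeff (gegen_poly k l) i * m' i)"
    using eq[of k] by (simp add: moment_functional_eq[OF degree_gegen_poly_le])
  moreover have "(\<Sum>i<k. coeff (gegen_poly k l) i * m i) = (\<Sum>i<k. coeff (gegen_poly k l) i * m' i)"
    using less by (intro sum.cong) auto
  ultimately have "coeff (gegen_poly k l) k * m k = coeff (gegen_poly k l) k * m' k"
    by (simp flip: lessThan_Suc_atMost)
  moreover have "coeff (gegen_poly k l) k \<noteq> 0"
    using assms(1) by (simp add: coeff_gegen_poly_degree pochhammer_nonzero)
  ultimately show ?case by simp
qed

lemma moment_functional_mult:
  "moment_functional (\<lambda>i. moment_functional m (q * monom 1 i)) p = moment_functional m (q * p)"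
  by (simp only: moment_functional_times_sum[of m q p]
      moment_functional_def[of "\<lambda>i. moment_functional m (q * monom 1 i)" p])

text \<open>If the value were 0, all tests of the zonal polynomial against Gegenbauer polynomials of
  parameter \<open>l + 1\<close> would vanish: below degree \<open>m\<close> by orthogonality, from
  degree \<open>m\<close> on because they evaluate at 1, and otherwise by parity. Then all its
  moments would vanish, in particular its integral against itself.\<close>

lemma poly_zonal_poly_1_nonzero:
  assumes "l > -1/2"
  shows "poly (zonal_poly m l) 1 \<noteq> 0"
proof
  assume z: "poly (zonal_poly m l) 1 = 0"
  have "gegen_functional l (gegen_poly n (l + 1) * zonal_poly m l) = 0" for n
  proof -
    consider "n < m" | "m \<le> n" "even (n + m)" | "odd (n + m)" by linarith
    then show ?thesis
    proof cases
      case 1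
      then show ?thesis
        using gegen_functional_zonal_poly_orth[of l "gegen_poly n (l + 1)" m] degree_gegen_poly_le[of n "l + 1"] assms
        by (simp add: mult.commute)
    next
      case 2
      have "gegen_functional l (gegen_poly n (l + 1) * zonal_poly m l) = poly (zonal_poly m l) 1"
      proof (rule gegen_functional_gegen_poly_eval)
        show "degree (zonal_poly m l) \<le> n" using degree_zonal_poly_le[of m l] 2 by simp
        show "even (n + i)" if "coeff (zonal_poly m l) i \<noteq> 0" for i
          using coeff_zonal_poly_parity[OF that] 2 by simp
      qed (use assms in simp)
      then show ?thesis using z by simp
    next
      case 3
      then show ?thesis
        using coeff_zonal_poly_parity[of m l] by (intro gegen_functional_gegen_poly_odd) auto
    qed
  qed
  then have "moment_functional (\<lambda>i. gegen_functional l (zonal_poly m l * monom 1 i)) (gegen_poly n (l + 1))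
    = moment_functional (\<lambda>i. 0) (gegen_poly n (l + 1))" for n
    unfolding moment_functional_mult by (simp add: mult.commute moment_functional_def)
  then have "gegen_functional l (zonal_poly m l * monom 1 i) = 0" for i
    using moment_functional_gegen_poly_eqD[of "l + 1" "\<lambda>i. gegen_functional l (zonal_poly m l * monom 1 i)" "\<lambda>i. 0" i]
      assms by simp
  then have "gegen_functional l (zonal_poly m l * zonal_poly m l) = 0"
    by (subst moment_functional_times_sum) simp
  moreover have "coeff (zonal_poly m l) m \<noteq> 0"
  proof -
    have "m \<ge> 2 \<Longrightarrow> coeff (gegen_poly (m - 2) (l + 1)) m = 0"
      using degree_gegen_poly_le[of "m - 2" "l + 1"] by (intro coeff_eq_0) linarith
    then show ?thesis
      using assms by (simp add: zonal_poly_def coeff_gegen_poly_degree pochhammer_nonzero)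
  qed
  then have "zonal_poly m l \<noteq> 0" by auto
  ultimately show False using gegen_functional_square_pos[OF assms] by force
qed

text \<open>Only the class of \<open>g\<close> modulo 2 matters, which allows a degree to serve as a
  parity. The zero polynomial has both parities.\<close>

definition has_parity :: "nat \<Rightarrow> real poly \<Rightarrow> bool" where
  "has_parity g p \<longleftrightarrow> (\<forall>i. coeff p i \<noteq> 0 \<longrightarrow> even (i + g))"

lemma has_parity_0 [simp]: "has_parity g 0"
  by (simp add: has_parity_def)

lemma has_parity_add: "has_parity g p \<Longrightarrow> has_parity g q \<Longrightarrow> has_parity g (p + q)"
  unfolding has_parity_def by (metis add_cancel_right_left coeff_add)

lemma has_parity_smult: "has_parity g p \<Longrightarrow> has_parity g (smult c p)"
  unfolding has_parity_def by auto

lemma has_parity_sum: "(\<And>i. i \<in> I \<Longrightarrow> has_parity g (f i)) \<Longrightarrow> has_parity g (\<Sum>i\<in>I. f i)"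
  by (induction I rule: infinite_finite_induct) (auto intro: has_parity_add)

lemma has_parity_monom: "even (n + g) \<Longrightarrow> has_parity g (monom c n)"
  by (auto simp: has_parity_def)

lemma has_parity_mult:
  assumes "has_parity g p" "has_parity h q"
  shows "has_parity (g + h) (p * q)"
  unfolding has_parity_def
proof safe
  fix i assume "coeff (p * q) i \<noteq> 0"
  then obtain j where "j \<le> i" "coeff p j * coeff q (i - j) \<noteq> 0"
    unfolding coeff_mult by (metis (no_types, lifting) atMost_iff sum.neutral)
  moreover then have "even (j + g)" "even ((i - j) + h)" using assms by (auto simp: has_parity_def)
  ultimately show "even (i + (g + h))" by presburger
qed

lemma has_parity_zonal_poly: "has_parity n (zonal_poly n l)"
  using coeff_zonal_poly_parity[of n l] by (auto simp: has_parity_def)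

lemma has_parity_cong: "even (g + h) \<Longrightarrow> has_parity g p \<longleftrightarrow> has_parity h p"
  unfolding has_parity_def by (metis even_add)

text \<open>The polynomial \<open>q\<close> is determined by testing against Gegenbauer polynomials of increasing degree;
  from degree \<open>k\<close> on these tests all say \<open>poly q 1 = 1\<close>.\<close>

lemma coupling_conditional_expectation:
  fixes l b :: real and k :: nat
  assumes l: "l > -1" "l + b > -1/2" and b: "b > -1"
  shows "\<exists>q. degree q \<le> k \<and> has_parity k q \<and> poly q 1 = 1 \<and>
    (\<forall>p. (\<Sum>i\<le>p. real (p choose i) * coupling_moment (l + 1) b i (p - i) * gegen_moment b (p - i) * gegen_moment l (i + k))
       = gegen_functional (l + b) (q * monom 1 p))"
proof -
  \<comment> \<open>\<open>\<phi> p\<close> is the mixed moment of \<open>X ^ k\<close> with the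
    \<open>p\<close>-th power of the coupled variable hX + (1-h)Y. \<open>\<tau> n\<close> tests
    \<open>X ^ k\<close> against a Gegenbauer polynomial in the coupled variable; the convolution
    turns this into a test in \<open>X\<close> alone.\<close>
  define \<phi> where "\<phi> p = (\<Sum>i\<le>p. real (p choose i) * coupling_moment (l + 1) b i (p - i) * gegen_moment b (p - i) * gegen_moment l (i + k))" for p
  define \<tau> where "\<tau> n = moment_functional \<phi> (gegen_poly n (l + b + 1))" for n
  have \<tau>: "\<tau> n = gegen_functional l (gegen_poly n (l + 1) * monom 1 k)" for n
    using coupling_gegen_poly[of "l + 1" b "\<lambda>i. gegen_moment l (i + k)" n] l b
    by (simp add: \<tau>_def \<phi>_def[abs_def] moment_functional_shift add_ac)
  have \<tau>odd: "\<tau> n = 0" if "odd (n + k)" for n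
    unfolding \<tau> using that by (rule gegen_functional_gegen_poly_parity)
  have \<tau>1: "\<tau> n = 1" if "k \<le> n" "even (n + k)" for n
    unfolding \<tau> using gegen_functional_gegen_poly_monom[OF l(1) that(1)] that by simp
  \<comment> \<open>A multiple of the zonal polynomial of degree \<open>Suc j\<close> corrects the
    test of that degree, which is possible because its value at 1 is not 0, and by orthogonality it
    leaves the lower tests unchanged. If \<open>Suc j\<close> has the wrong parity, that test is 0
    on both sides.\<close>
  have low: "\<exists>q. degree q \<le> j \<and> has_parity k q \<and>
      (\<forall>n\<le>j. gegen_functional (l + b) (gegen_poly n (l + b + 1) * q) = \<tau> n)" if "j \<le> k" for j
    using that
  proof (induction j)
    case 0
    show ?case
    proof (cases "even k")
      case True
      then show ?thesis
        using l by (intro exI[of _ "[:\<tau> 0:]"])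
         (auto simp: has_parity_def coeff_pCons gegen_poly_def moment_functional_smult
           moment_functional_monom[of _ _ 0, unfolded monom_0] gegen_moment_def gauss_moment_def split: nat.splits)
    next
      case False
      then show ?thesis using \<tau>odd[of 0] by (intro exI[of _ 0]) simp
    qed
  next
    case (Suc j)
    then obtain q where q: "degree q \<le> j" "has_parity k q"
      "\<And>n. n \<le> j \<Longrightarrow> gegen_functional (l + b) (gegen_poly n (l + b + 1) * q) = \<tau> n" by auto
    let ?z = "zonal_poly (Suc j) (l + b)"
    show ?case
    proof (cases "even (Suc j + k)")
      case False
      have "gegen_functional (l + b) (gegen_poly (Suc j) (l + b + 1) * q) = \<tau> (Suc j)"
        unfolding \<tau>odd[OF False] using q(2) False
        by (intro gegen_functional_gegen_poly_odd) (auto simp: has_parity_def)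
      then show ?thesis
        using q by (intro exI[of _ q]) (auto simp: le_Suc_eq)
    next
      case True
      define c where "c = (\<tau> (Suc j) - gegen_functional (l + b) (gegen_poly (Suc j) (l + b + 1) * q)) / poly ?z 1"
      have z1: "gegen_functional (l + b) (gegen_poly (Suc j) (l + b + 1) * ?z) = poly ?z 1"
        using l degree_zonal_poly_le[of "Suc j" "l + b"] coeff_zonal_poly_parity[of "Suc j" "l + b"]
        by (intro gegen_functional_gegen_poly_eval) auto
      have z2: "gegen_functional (l + b) (gegen_poly n (l + b + 1) * ?z) = 0" if "n \<le> j" for n
        using gegen_functional_zonal_poly_orth[of "l + b" "gegen_poly n (l + b + 1)" "Suc j"]
          degree_gegen_poly_le[of n "l + b + 1"] that l by (simp add: mult.commute)
      have nz: "poly ?z 1 \<noteq> 0" using l by (intro poly_zonal_poly_1_nonzero)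
      have e: "gegen_functional (l + b) (gegen_poly n (l + b + 1) * (q + smult c ?z)) =
         gegen_functional (l + b) (gegen_poly n (l + b + 1) * q) +
         c * gegen_functional (l + b) (gegen_poly n (l + b + 1) * ?z)" for n
        by (simp add: distrib_left moment_functional_add moment_functional_smult)
      have "gegen_functional (l + b) (gegen_poly n (l + b + 1) * (q + smult c ?z)) = \<tau> n" if "n \<le> Suc j" for n
      proof (cases "n = Suc j")
        case True
        show ?thesis unfolding e True z1 using nz by (simp add: c_def)
      next
        case False
        then have n: "n \<le> j" using that by simp
        show ?thesis unfolding e z2[OF n] q(3)[OF n] by simp
      qed
      moreover have "degree (q + smult c ?z) \<le> Suc j"
        using q(1) degree_zonal_poly_le[of "Suc j" "l + b"]
        by (intro degree_add_le) (auto intro: order_trans[OF degree_smult_le])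
      moreover have "has_parity k ?z"
        using has_parity_zonal_poly has_parity_cong[OF True] by blast
      then have "has_parity k (q + smult c ?z)"
        using q(2) by (intro has_parity_add has_parity_smult)
      ultimately show ?thesis by blast
    qed
  qed
  obtain q where q: "degree q \<le> k" "has_parity k q"
      "\<And>n. n \<le> k \<Longrightarrow> gegen_functional (l + b) (gegen_poly n (l + b + 1) * q) = \<tau> n" using low[of k] by auto
  have ev: "gegen_functional (l + b) (gegen_poly n (l + b + 1) * q) = poly q 1" if "k \<le> n" "even (n + k)" for n
    using q l that by (intro gegen_functional_gegen_poly_eval) (auto simp: has_parity_def)
  \<comment> \<open>The test of degree \<open>k\<close> is known in two ways: it evaluates
    \<open>q\<close> at 1, and it equals \<open>\<tau> k = 1\<close>. This makes all higher tests
    correct as well.\<close>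
  have q1: "poly q 1 = 1"
    using ev[of k] q(3)[of k] \<tau>1[of k] by simp
  have "gegen_functional (l + b) (gegen_poly n (l + b + 1) * q) = \<tau> n" for n
  proof -
    consider "n \<le> k" | "k \<le> n" "even (n + k)" | "odd (n + k)" by linarith
    then show ?thesis
    proof cases
      case 3
      then show ?thesis unfolding \<tau>odd[OF 3] using q(2)
        by (intro gegen_functional_gegen_poly_odd) (auto simp: has_parity_def)
    qed (use q(3) ev \<tau>1 q1 in auto)
  qed
  then have "moment_functional \<phi> (gegen_poly n (l + b + 1)) =
     moment_functional (\<lambda>i. gegen_functional (l + b) (q * monom 1 i)) (gegen_poly n (l + b + 1))" for n
    unfolding moment_functional_mult by (simp add: \<tau>_def mult.commute)
  then have "\<phi> p = gegen_functional (l + b) (q * monom 1 p)" for p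
    using moment_functional_gegen_poly_eqD[of "l + b + 1" \<phi> "\<lambda>i. gegen_functional (l + b) (q * monom 1 i)" p] l by simp
  then show ?thesis using q q1 unfolding \<phi>_def by blast
qed

subsection \<open>Gaussian moments along a direction\<close>

lemma gauss_moment_Suc: "gauss_moment (Suc k) = k / 2 * gauss_moment (k - 1)"
proof (cases k)
  case 0
  then show ?thesis by (simp add: gauss_moment_def)
next
  case (Suc j)
  then show ?thesis by (simp add: gauss_moment_Suc_Suc)
qed

text \<open>The square of the Gegenbauer variable has the Beta(1/2, \<open>l + 1/2\<close>) law. The
  induction multiplies out one factor \<open>1 - t\<^sup>2\<close> at a time, which raises
  \<open>k\<close> by 2, so \<open>k\<close> is kept arbitrary.\<close>

lemma gegen_functional_monom_times_one_minus_sq: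
  assumes "l > -1/2"
  shows "gegen_functional l (monom 1 k * [:1, 0, -1:] ^ f) =
    gauss_moment k * pochhammer (l + 1/2) f / pochhammer (l + 1) (k div 2 + f)"
proof (induction f arbitrary: k)
  case 0
  show ?case by (simp add: moment_functional_monom gegen_moment_def)
next
  case (Suc f)
  have "[:1, 0, -1 :: real:] = 1 - monom 1 2"
    by (simp add: monom_altdef power2_eq_square one_pCons)
  then have "monom 1 k * [:1, 0, -1 :: real:] ^ Suc f =
      (monom 1 k - monom 1 (Suc (Suc k))) * [:1, 0, -1:] ^ f"
    by (simp add: right_diff_distrib left_diff_distrib mult_monom mult_ac flip: mult.assoc)
  then have e: "gegen_functional l (monom 1 k * [:1, 0, -1 :: real:] ^ Suc f) =
      gegen_functional l (monom 1 k * [:1, 0, -1:] ^ f) - gegen_functional l (monom 1 (Suc (Suc k)) * [:1, 0, -1:] ^ f)"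
    by (simp add: left_diff_distrib moment_functional_diff)
  define K where "K = k div 2"
  show ?case
  proof (cases "even k")
    case False
    then show ?thesis unfolding e Suc by (simp add: gauss_moment_def)
  next
    case True
    then have k: "real k = 2 * real K" by (auto simp: K_def elim!: evenE)
    define P where "P = pochhammer (l + 1) (K + f)"
    have P: "P \<noteq> 0" unfolding P_def using assms by (intro pochhammer_nonzero) simp
    have x: "l + 1 + real (K + f) \<noteq> 0" using assms by (simp add: add_nonneg_eq_0_iff)
    have fr: "A / P - B * A / (P * y) = A * (y - B) / (P * y)" if "y \<noteq> 0" for A B y :: real
      using P that by (simp add: field_simps)
    have "gauss_moment k * pochhammer (l + 1/2) f / P -
        (real k + 1) / 2 * (gauss_moment k * pochhammer (l + 1/2) f) / (P * (l + 1 + real (K + f)))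
      = gauss_moment k * pochhammer (l + 1/2) f * (l + 1/2 + f) / (P * (l + 1 + real (K + f)))"
    proof -
      have y: "l + 1 + real (K + f) - (real k + 1) / 2 = l + 1/2 + f" by (simp add: k field_simps)
      show ?thesis unfolding fr[OF x] y ..
    qed
    then show ?thesis
      unfolding e Suc by (simp add: gauss_moment_Suc_Suc K_def[symmetric] pochhammer_Suc P_def mult_ac add_ac)
  qed
qed

lemma has_parity_one_minus_sq: "has_parity 0 ([:1, 0, -1:] ^ f)"
proof (induction f)
  case (Suc f)
  have "has_parity 0 [:1, 0, -1 :: real:]"
    by (auto simp: has_parity_def coeff_pCons split: nat.splits)
  from has_parity_mult[OF this Suc] show ?case by simp
qed (auto simp: has_parity_def split: if_splits)

text \<open>The way back from the Gaussian model. Let \<open>G = R T\<close> and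
  \<open>S = R\<^sup>2 (1 - T\<^sup>2)\<close>, which is independent of \<open>G\<close> and has the
  moments \<open>pochhammer (l + 1/2) f\<close>. Replacing \<open>G ^ e\<close> by
  \<open>G ^ e * S ^ f / pochhammer (l + 1/2) f\<close> with \<open>e + 2 * f = g\<close> does not
  change expectations against \<open>G ^ N\<close>, but makes everything homogeneous of degree
  \<open>g\<close> in \<open>R\<close>. Dividing by the moment of \<open>R ^ (N + g)\<close> leaves
  powers of \<open>T\<close> and \<open>1 - T\<^sup>2\<close>; at 1 only the term with
  \<open>f = 0\<close> survives.\<close>

lemma gegen_functional_of_gauss:
  assumes l: "l > -1/2" and c: "degree c \<le> g" "has_parity g c"
  shows "\<exists>q. degree q \<le> g \<and> has_parity g q \<and> poly q 1 = coeff c g \<and>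
    (\<forall>N. moment_functional (\<lambda>e. gauss_moment (N + e)) c / pochhammer (l + 1) ((N + g) div 2)
        = gegen_functional l (q * monom 1 N))"
proof -
  define u where "u e = monom 1 e * [:1, 0, -1 :: real:] ^ ((g - e) div 2)" for e
  define q where "q = (\<Sum>e\<le>g. smult (coeff c e / pochhammer (l + 1/2) ((g - e) div 2)) (u e))"
  have ev: "even (e + g)" if "coeff c e \<noteq> 0" for e using c that by (auto simp: has_parity_def)
  have "degree (u e) \<le> g" if "e \<le> g" for e
  proof -
    have "degree (u e) \<le> degree (monom (1::real) e) + degree ([:1, 0, -1 :: real:] ^ ((g - e) div 2))"
      unfolding u_def by (rule degree_mult_le)
    also have "\<dots> \<le> e + 2 * ((g - e) div 2)"
      using degree_power_le[of "[:1, 0, -1 :: real:]" "(g - e) div 2"]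
      by (intro add_mono) (simp_all add: degree_monom_eq numeral_2_eq_2)
    also have "\<dots> \<le> g" using that by simp
    finally show ?thesis .
  qed
  then have dq: "degree q \<le> g"
    unfolding q_def by (intro degree_sum_le) (auto intro: order_trans[OF degree_smult_le])
  have "has_parity g (smult (coeff c e / pochhammer (l + 1/2) ((g - e) div 2)) (u e))" if "e \<le> g" for e
  proof (cases "coeff c e = 0")
    case False
    have "has_parity (g + 0) (u e)"
      unfolding u_def using ev[OF False] by (intro has_parity_mult has_parity_monom has_parity_one_minus_sq)
    then show ?thesis by (simp add: has_parity_smult)
  qed simp
  then have pq: "has_parity g q" unfolding q_def by (intro has_parity_sum) auto
  have "poly (u e) 1 = (if e = g then 1 else 0)" if "coeff c e \<noteq> 0" "e \<le> g" for e
  proof (cases "e = g")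
    case False
    then have "(g - e) div 2 > 0" using ev[OF that(1)] that(2) by presburger
    then show ?thesis using False by (simp add: u_def poly_monom)
  qed (simp add: u_def poly_monom)
  then have "poly q 1 = (\<Sum>e\<le>g. if e = g then coeff c g else 0)"
    unfolding q_def poly_sum
  proof (intro sum.cong refl)
    fix e assume "e \<in> {..g}"
    then show "poly (smult (coeff c e / pochhammer (l + 1/2) ((g - e) div 2)) (u e)) 1 = (if e = g then coeff c g else 0)"
      using \<open>\<And>e. coeff c e \<noteq> 0 \<Longrightarrow> e \<le> g \<Longrightarrow> poly (u e) 1 = (if e = g then 1 else 0)\<close>[of e]
      by (cases "coeff c e = 0") auto
  qed
  then have q1: "poly q 1 = coeff c g" by simp
  have "moment_functional (\<lambda>e. gauss_moment (N + e)) c / pochhammer (l + 1) ((N + g) div 2)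
        = gegen_functional l (q * monom 1 N)" for N
  proof -
    have "gegen_functional l (q * monom 1 N) =
      (\<Sum>e\<le>g. coeff c e / pochhammer (l + 1/2) ((g - e) div 2) * gegen_functional l (u e * monom 1 N))"
      by (simp add: q_def sum_distrib_right moment_functional_sum moment_functional_smult)
    also have "\<dots> = (\<Sum>e\<le>g. coeff c e * gauss_moment (N + e) / pochhammer (l + 1) ((N + g) div 2))"
    proof (intro sum.cong refl)
      fix e assume "e \<in> {..g}"
      show "coeff c e / pochhammer (l + 1/2) ((g - e) div 2) * gegen_functional l (u e * monom 1 N) =
         coeff c e * gauss_moment (N + e) / pochhammer (l + 1) ((N + g) div 2)"
      proof (cases "coeff c e = 0 \<or> odd (N + e)")
        case True
        moreover have "u e * monom 1 N = monom 1 (N + e) * [:1, 0, -1 :: real:] ^ ((g - e) div 2)"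
          by (simp add: u_def mult_monom add_ac mult_ac flip: mult.assoc)
        ultimately show ?thesis
          using gegen_functional_monom_times_one_minus_sq[OF l, of "N + e"] by (auto simp: gauss_moment_def)
      next
        case False
        have x: "u e * monom 1 N = monom 1 (N + e) * [:1, 0, -1 :: real:] ^ ((g - e) div 2)"
          by (simp add: u_def mult_monom add_ac mult_ac flip: mult.assoc)
        have y: "(N + e) div 2 + (g - e) div 2 = (N + g) div 2"
        proof -
          have "even (N + e)" "even (g - e)" "e \<le> g" using False ev[of e] \<open>e \<in> {..g}\<close> by auto
          from this(1,2) obtain a b where "N + e = 2 * a" "g - e = 2 * b" by (elim evenE)
          moreover from this have "N + g = 2 * (a + b)" using \<open>e \<le> g\<close> by simp
          ultimately show ?thesis by simp
        qed
        have "pochhammer (l + 1/2) ((g - e) div 2) \<noteq> 0"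
          using l by (intro pochhammer_nonzero) simp
        then show ?thesis
          unfolding x gegen_functional_monom_times_one_minus_sq[OF l] y by simp
      qed
    qed
    also have "\<dots> = moment_functional (\<lambda>e. gauss_moment (N + e)) c / pochhammer (l + 1) ((N + g) div 2)"
      unfolding moment_functional_eq[OF c(1)] sum_divide_distrib ..
    finally show ?thesis ..
  qed
  then show ?thesis using dq pq q1 by blast
qed

text \<open>\<open>gauss_directional w N a\<close> is the moment of \<open>(w \<bullet> X) ^ N * (\<Prod>i. X i ^ a i)\<close> for independent centred
  Gaussian variables \<open>X i\<close> of variance \<open>1/2\<close>.\<close>

primrec gauss_directional :: "('i::finite \<Rightarrow> real) \<Rightarrow> nat \<Rightarrow> ('i \<Rightarrow> nat) \<Rightarrow> real" where
  "gauss_directional w 0 a = (\<Prod>i\<in>UNIV. gauss_moment (a i))"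
| "gauss_directional w (Suc N) a = (\<Sum>j\<in>UNIV. w j * gauss_directional w N (a(j := Suc (a j))))"

text \<open>Stein's identity for variance 1/2: the expectation of \<open>X i\<close> times a
  function is half the expectation of its partial derivative. The two terms differentiate the power
  of the linear form and the monomial.\<close>

lemma gauss_directional_stein:
  "gauss_directional w N (a(i := Suc (a i))) =
    N / 2 * w i * gauss_directional w (N - 1) a + a i / 2 * gauss_directional w N (a(i := a i - 1))"
proof (induction N arbitrary: a)
  case 0
  have p: "(\<Prod>j\<in>UNIV. gauss_moment ((a(i := m)) j)) = gauss_moment m * (\<Prod>j\<in>UNIV - {i}. gauss_moment (a j))" for m
    by (subst prod.remove[of _ i]) (auto intro!: arg_cong2[where f = "(*)"] prod.cong)
  show ?case unfolding gauss_directional.simps p by (simp add: gauss_moment_Suc)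
next
  case (Suc N)
  let ?G = "gauss_directional w"
  have "?G (Suc N) (a(i := Suc (a i))) =
     (\<Sum>j\<in>UNIV. w j * ?G N ((a(j := Suc (a j)))(i := Suc ((a(j := Suc (a j))) i))))"
    unfolding gauss_directional.simps
    by (intro sum.cong refl arg_cong2[where f = "(*)"] arg_cong[where f = "?G N"]) (auto simp: fun_eq_iff)
  also have "\<dots> = (\<Sum>j\<in>UNIV. w j * (N / 2 * w i * ?G (N - 1) (a(j := Suc (a j)))
     + (a(j := Suc (a j))) i / 2 * ?G N ((a(j := Suc (a j)))(i := (a(j := Suc (a j))) i - 1))))"
    unfolding Suc ..
  also have "\<dots> = N / 2 * w i * (\<Sum>j\<in>UNIV. w j * ?G (N - 1) (a(j := Suc (a j))))
     + (\<Sum>j\<in>UNIV. w j * ((a(j := Suc (a j))) i / 2 * ?G N ((a(j := Suc (a j)))(i := (a(j := Suc (a j))) i - 1))))"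
    by (simp add: distrib_left sum.distrib sum_distrib_left mult_ac)
  also have "N / 2 * w i * (\<Sum>j\<in>UNIV. w j * ?G (N - 1) (a(j := Suc (a j)))) = N / 2 * w i * ?G N a"
    by (cases N) simp_all
  \<comment> \<open>In the summand \<open>j = i\<close> the exponent of \<open>X i\<close> is one
    larger when it is differentiated. The surplus is what turns \<open>N / 2\<close> into
    \<open>Suc N / 2\<close>.\<close>
  also have "(\<Sum>j\<in>UNIV. w j * ((a(j := Suc (a j))) i / 2 * ?G N ((a(j := Suc (a j)))(i := (a(j := Suc (a j))) i - 1))))
     = (\<Sum>j\<in>UNIV. a i / 2 * (w j * ?G N ((a(i := a i - 1))(j := Suc ((a(i := a i - 1)) j))))
         + (if j = i then w i / 2 * ?G N a else 0))"
  proof (intro sum.cong refl)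
    fix j
    show "w j * ((a(j := Suc (a j))) i / 2 * ?G N ((a(j := Suc (a j)))(i := (a(j := Suc (a j))) i - 1)))
     = a i / 2 * (w j * ?G N ((a(i := a i - 1))(j := Suc ((a(i := a i - 1)) j))))
         + (if j = i then w i / 2 * ?G N a else 0)"
    proof (cases "j = i")
      case True
      moreover have "a(i := 0) = a" if "a i = 0" using that by auto
      ultimately show ?thesis by (cases "a i = 0") (simp_all add: field_simps)
    next
      case False
      then show ?thesis by (simp add: fun_upd_twist)
    qed
  qed
  also have "\<dots> = a i / 2 * ?G (Suc N) (a(i := a i - 1)) + w i / 2 * ?G N a"
    by (simp add: sum.distrib sum_distrib_left)
  finally have "?G (Suc N) (a(i := Suc (a i))) =
     N / 2 * w i * ?G N a + (a i / 2 * ?G (Suc N) (a(i := a i - 1)) + w i / 2 * ?G N a)" .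
  moreover have "real (Suc N) / 2 * w i * ?G N a = N / 2 * w i * ?G N a + w i / 2 * ?G N a"
    by (simp add: field_simps)
  ultimately show ?case unfolding diff_Suc_1 by linarith
qed

text \<open>A linear form with unit coefficient vector is again Gaussian of variance 1/2; Stein's
  identity gives it the recursion of \<open>gauss_moment\<close>.\<close>

lemma gauss_directional_0:
  assumes "(\<Sum>i\<in>UNIV. (w i)\<^sup>2) = (1::real)"
  shows "gauss_directional w N (\<lambda>_. 0) = gauss_moment N"
proof (induction N rule: less_induct)
  case (less N)
  show ?case
  proof (cases N)
    case 0
    then show ?thesis by (simp add: gauss_moment_def)
  next
    case (Suc M)
    have "gauss_directional w N (\<lambda>_. 0) = (\<Sum>j\<in>UNIV. (w j)\<^sup>2) * (M / 2 * gauss_directional w (M - 1) (\<lambda>_. 0))"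
    proof -
      have st: "gauss_directional w M ((\<lambda>_. 0)(j := Suc 0)) = M / 2 * w j * gauss_directional w (M - 1) (\<lambda>_. 0)" for j
        using gauss_directional_stein[of w M "\<lambda>_. 0" j] by simp
      show ?thesis
        unfolding Suc gauss_directional.simps st sum_distrib_right
        by (intro sum.cong refl) (simp add: power2_eq_square)
    qed
    then show ?thesis
      using less[of "M - 1"] Suc assms by (cases M) (simp_all add: gauss_moment_Suc)
  qed
qed

text \<open>\<open>c\<close> is the conditional expectation of the monomial given G, the linear form
  with coefficients \<open>w\<close>. One more factor \<open>X i\<close> replaces \<open>c\<close>
  by \<open>w i\<close> times G c - c'/2 plus a multiple of a polynomial for a smaller exponent, so
  the leading coefficient picks up the factor \<open>w i\<close>.\<close>

lemma gauss_directional_representation: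
  assumes w: "(\<Sum>i\<in>UNIV. (w i)\<^sup>2) = (1::real)"
  shows "\<exists>c. degree c \<le> sum a UNIV \<and> has_parity (sum a UNIV) c \<and> coeff c (sum a UNIV) = (\<Prod>i\<in>UNIV. w i ^ a i) \<and>
    (\<forall>N. gauss_directional w N a = moment_functional (\<lambda>e. gauss_moment (N + e)) c)"
proof (induction "sum a UNIV" arbitrary: a rule: less_induct)
  case less
  show ?case
  proof (cases "\<exists>i. a i > 0")
    case False
    then have a: "a = (\<lambda>_. 0)" by auto
    show ?thesis
      unfolding a using gauss_directional_0[OF w] moment_functional_monom[of _ 1 0, unfolded monom_0]
      by (intro exI[of _ "[:1:]"]) (auto simp: has_parity_def coeff_pCons split: nat.splits)
  next
    case True
    then obtain i where i: "a i > 0" by blast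
    define b where "b = a(i := a i - 1)"
    have ab: "a = b(i := Suc (b i))" using i by (auto simp: b_def)
    define s where "s = sum b UNIV"
    have upd: "sum (b(i := m)) UNIV + b i = s + m" for m
      unfolding s_def by (subst (1 2) sum.remove[of _ i]) (auto intro!: sum.cong)
    have sa: "sum a UNIV = Suc s" using upd[of "Suc (b i)"] unfolding ab[symmetric] by simp
    obtain c where c: "degree c \<le> s" "has_parity s c" "coeff c s = (\<Prod>i\<in>UNIV. w i ^ b i)"
      "\<And>N. gauss_directional w N b = moment_functional (\<lambda>e. gauss_moment (N + e)) c"
      using less[of b] sa unfolding s_def by auto
    have "\<exists>c2. degree c2 \<le> s \<and> has_parity (Suc s) c2 \<and>
       (\<forall>N. b i / 2 * gauss_directional w N (b(i := b i - 1)) = moment_functional (\<lambda>e. gauss_moment (N + e)) c2)"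
    proof (cases "b i = 0")
      case True
      then show ?thesis by (intro exI[of _ 0]) simp
    next
      case False
      define r where "r = sum (b(i := b i - 1)) UNIV"
      have sr: "s = Suc r" using upd[of "b i - 1"] False by (simp add: r_def)
      obtain c2 where c2: "degree c2 \<le> r" "has_parity r c2"
        "\<And>N. gauss_directional w N (b(i := b i - 1)) = moment_functional (\<lambda>e. gauss_moment (N + e)) c2"
        using less[of "b(i := b i - 1)"] sr sa unfolding r_def by auto
      moreover have "has_parity (Suc s) c2"
        using c2(2) unfolding has_parity_def sr by auto
      ultimately show ?thesis
        using sr by (intro exI[of _ "smult (b i / 2) c2"])
          (auto simp: moment_functional_smult intro: has_parity_smult order_trans[OF degree_smult_le])
    qed
    then obtain c2 where c2: "degree c2 \<le> s" "has_parity (Suc s) c2"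
       "\<And>N. b i / 2 * gauss_directional w N (b(i := b i - 1)) = moment_functional (\<lambda>e. gauss_moment (N + e)) c2"
      by blast
    define C where "C = smult (w i) (c * monom 1 1 - smult (1/2) (pderiv c)) + c2"
    have m: "moment_functional m (pderiv c) = (\<Sum>e\<le>degree c. coeff c e * (e * m (e - 1)))" for m :: "nat \<Rightarrow> real"
    proof -
      have "moment_functional m (pderiv c) = (\<Sum>e\<le>degree c. coeff (pderiv c) e * m e)"
        by (rule moment_functional_eq) (simp add: degree_pderiv)
      also have "\<dots> = (\<Sum>e<degree c. coeff c (Suc e) * (Suc e * m e))"
        by (simp add: coeff_pderiv coeff_eq_0 mult_ac flip: lessThan_Suc_atMost)
      also have "\<dots> = (\<Sum>e\<le>degree c. coeff c e * (e * m (e - 1)))"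
        by (subst sum.atMost_shift) simp
      finally show ?thesis .
    qed
    \<comment> \<open>One-dimensional Stein read backwards: the derivative of G^N c(G) has the two
      parts N G^(N-1) c and G^N c', so the first part is expressed by G^N (G c - c'/2).\<close>
    have key: "N / 2 * gauss_directional w (N - 1) b =
      moment_functional (\<lambda>e. gauss_moment (N + e)) (c * monom 1 1 - smult (1/2) (pderiv c))" for N
    proof -
      have h: "gauss_moment (N + (e + 1)) - 1/2 * (e * gauss_moment (N + (e - 1))) = N / 2 * gauss_moment (N - 1 + e)" for e
        by (cases N; cases e) (simp_all add: gauss_moment_Suc gauss_moment_Suc_Suc field_simps)
      have "N / 2 * gauss_directional w (N - 1) b =
        (\<Sum>e\<le>degree c. coeff c e * (gauss_moment (N + (e + 1)) - 1/2 * (e * gauss_moment (N + (e - 1)))))"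
        unfolding c(4) moment_functional_def[of _ c] sum_distrib_left h by (simp add: mult_ac)
      also have "\<dots> = moment_functional (\<lambda>e. gauss_moment (N + (e + 1))) c
          - 1/2 * moment_functional (\<lambda>e. gauss_moment (N + e)) (pderiv c)"
        unfolding m moment_functional_def[of _ c] sum_distrib_left sum_subtractf[symmetric]
        by (simp add: algebra_simps)
      finally show ?thesis
        unfolding moment_functional_diff moment_functional_shift moment_functional_smult .
    qed
    have "gauss_directional w N a = moment_functional (\<lambda>e. gauss_moment (N + e)) C" for N
      unfolding ab gauss_directional_stein C_def moment_functional_add moment_functional_smult key[symmetric] c2(3)[symmetric]
      by simp
    moreover have dp: "degree (pderiv c) \<le> s - 1" using c(1) by (simp add: degree_pderiv)
    have "degree C \<le> Suc s"
    proof -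
      have "degree (c * monom 1 1) \<le> Suc s"
        using degree_mult_le[of c "monom 1 1"] c(1) by (simp add: degree_monom_eq)
      then show ?thesis
        unfolding C_def using dp c2(1)
        by (intro degree_add_le order_trans[OF degree_smult_le] degree_diff_le) auto
    qed
    moreover have "has_parity (Suc s) C"
    proof -
      have "has_parity (s + 1) (c * monom 1 1)"
        using c(2) by (intro has_parity_mult has_parity_monom) auto
      moreover have "has_parity (Suc s) (pderiv c)"
        using c(2) by (auto simp: has_parity_def coeff_pderiv)
      ultimately have "has_parity (Suc s) (c * monom 1 1 + smult (-1/2) (pderiv c))"
        by (intro has_parity_add has_parity_smult) simp_all
      then show ?thesis
        unfolding C_def using c2(2) by (intro has_parity_add has_parity_smult) simp_all
    qed
    moreover have "coeff C (Suc s) = (\<Prod>i\<in>UNIV. w i ^ a i)"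
    proof -
      have "coeff (pderiv c) (Suc s) = 0" "coeff c2 (Suc s) = 0"
        using dp c2(1) by (auto intro: coeff_eq_0)
      moreover have "coeff (c * monom 1 1) (Suc s) = coeff c s"
        by (simp add: mult.commute[of c] monom_Suc monom_0)
      moreover have "(\<Prod>j\<in>UNIV. w j ^ a j) = w i * (\<Prod>j\<in>UNIV. w j ^ b j)"
        unfolding ab by (subst (1 2) prod.remove[of _ i]) (auto intro!: prod.cong)
      ultimately show ?thesis unfolding C_def c(3)[symmetric] by simp
    qed
    ultimately show ?thesis unfolding sa by blast
  qed
qed

section \<open>Two Gaussian variables and the radial step\<close>

lemma gauss_directional_bool:
  "gauss_directional w N a = (\<Sum>p\<le>N. real (N choose p) *
     (w True ^ p * w False ^ (N - p) * gauss_moment (a True + p) * gauss_moment (a False + (N - p))))"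
proof (induction N arbitrary: a)
  case 0
  then show ?case by (simp add: UNIV_bool)
next
  case (Suc N)
  have "gauss_directional w (Suc N) a = w True * gauss_directional w N (a(True := Suc (a True)))
    + w False * gauss_directional w N (a(False := Suc (a False)))"
    by (simp add: UNIV_bool)
  then show ?case
    unfolding Suc binomial_sum_Suc[of N "\<lambda>p r. w True ^ p * w False ^ r * gauss_moment (a True + p) * gauss_moment (a False + r)"]
      sum_distrib_left sum.distrib[symmetric]
    by (simp add: algebra_simps)
qed

text \<open>The expectation of \<open>X ^ m * (X\<^sup>2 + S) ^ b\<close> for a Gaussian
  \<open>X\<close> and an independent \<open>S\<close> with the moments of Gamma(\<open>al\<close>):
  weighting by \<open>X ^ m\<close> makes \<open>X\<^sup>2\<close> a Gamma variable of shape
  \<open>1/2 + m/2\<close>, and shapes add. Algebraically this is again the Chu-Vandermonde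
  identity.\<close>

lemma gauss_moment_pochhammer_sum:
  "(\<Sum>f\<le>b. real (b choose f) * pochhammer al f * gauss_moment (m + 2 * (b - f))) =
    gauss_moment m * pochhammer (al + 1/2 + real (m div 2)) b"
proof (cases "even m")
  case True
  then obtain p where m: "m = 2 * p" by (elim evenE)
  have g: "gauss_moment (2 * p + 2 * r) = gauss_moment (2 * p) * pochhammer (1/2 + real p) r" for r
    using pochhammer_product'[of "1/2 :: real" p r] by (simp add: gauss_moment_def)
  have "(\<Sum>f\<le>b. real (b choose f) * pochhammer al f * gauss_moment (m + 2 * (b - f))) =
    gauss_moment (2 * p) * (\<Sum>f\<le>b. real (b choose f) * pochhammer al f * pochhammer (1/2 + real p) (b - f))"
    unfolding m g sum_distrib_left by (simp add: mult_ac)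
  also have "\<dots> = gauss_moment (2 * p) * pochhammer (al + (1/2 + real p)) b"
    unfolding pochhammer_binomial_sum ..
  finally show ?thesis by (simp add: m add_ac)
qed (simp add: gauss_moment_def)

text \<open>The expectation of \<open>t ^ (2 * k) * (1 - t\<^sup>2) ^ l\<close> when
  \<open>t\<^sup>2\<close> has the Beta(\<open>al + 1/2\<close>, \<open>ga + 1/2\<close>) law. This
  is the law of the height on the cone: the weight and the factor
  \<open>\<bar>t\<bar> ^ (d - 1)\<close> of the surface measure combine to
  \<open>\<bar>t\<bar> powr (2 * al)\<close>.\<close>

definition radial_moment :: "real \<Rightarrow> real \<Rightarrow> nat \<Rightarrow> nat \<Rightarrow> real" where
  "radial_moment al ga k l = pochhammer (al + 1/2) k * pochhammer (ga + 1/2) l / pochhammer (al + ga + 1) (k + l)"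

text \<open>For positive \<open>al\<close> and \<open>ga\<close> let \<open>R\<^sup>2\<close> be
  Gamma(\<open>al + ga + 1\<close>), let \<open>r\<close> be the radius and let \<open>T\<close>,
  \<open>v\<close> have the Gegenbauer laws of parameters \<open>al - 1/2\<close>,
  \<open>ga - 1/2\<close>, all independent. Then X1 = R r T and X2 = R sqrt(1 - r^2) v are
  independent Gaussians, and R times the variable \<xi> is \<rho> X1 + \<kappa> X2. The function
  \<open>r ^ g * T ^ e\<close> times \<open>R ^ g\<close> becomes X1^e (X1^2 + S)^b with
  \<open>S\<close> an independent Gamma(\<open>al\<close>) variable.\<close>

lemma radial_conditional_expectation:
  fixes al ga \<rho> \<kappa> :: real
  assumes al: "al > -1/2" and ga: "ga > -1/2" and alga: "al + ga > -1/2"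
    and rk: "\<rho>\<^sup>2 + \<kappa>\<^sup>2 = 1" and g: "g = e + 2 * b"
  shows "\<exists>q. degree q \<le> g \<and> poly q 1 = \<rho> ^ g \<and> (\<forall>N.
    (\<Sum>p\<le>N. real (N choose p) * (\<rho> ^ p * \<kappa> ^ (N - p) * gegen_moment (ga - 1/2) (N - p) *
      radial_moment al ga ((p + g) div 2) ((N - p) div 2) * gegen_moment (al - 1/2) (p + e)))
    = gegen_functional (al + ga) (q * monom 1 N))"
proof -
  define w where "w t = (if t then \<rho> else \<kappa>)" for t
  have w: "(\<Sum>i\<in>UNIV. (w i)\<^sup>2) = 1" using rk by (simp add: w_def UNIV_bool)
  define a where "a f t = (if t then e + 2 * (b - f) else 0)" for f and t :: bool
  have "\<exists>c. degree c \<le> e + 2 * (b - f) \<and> has_parity (e + 2 * (b - f)) c \<and> coeff c (e + 2 * (b - f)) = \<rho> ^ (e + 2 * (b - f)) \<and>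
    (\<forall>N. gauss_directional w N (a f) = moment_functional (\<lambda>e. gauss_moment (N + e)) c)" for f
  proof -
    have "sum (a f) UNIV = e + 2 * (b - f)" "(\<Prod>i\<in>UNIV. w i ^ a f i) = \<rho> ^ (e + 2 * (b - f))"
      by (simp_all add: UNIV_bool a_def w_def)
    then show ?thesis using gauss_directional_representation[OF w, of "a f"] by simp
  qed
  then obtain c where c: "\<And>f. degree (c f) \<le> e + 2 * (b - f)" "\<And>f. has_parity (e + 2 * (b - f)) (c f)"
    "\<And>f. coeff (c f) (e + 2 * (b - f)) = \<rho> ^ (e + 2 * (b - f))"
    "\<And>f N. gauss_directional w N (a f) = moment_functional (\<lambda>e. gauss_moment (N + e)) (c f)" by metis
  \<comment> \<open>The expansion of (X1^2 + S)^b, with \<open>pochhammer al f\<close> as the moment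
    of \<open>S ^ f\<close>. Only the term \<open>f = 0\<close> reaches degree \<open>g\<close>,
    hence the top coefficient \<open>\<rho> ^ g\<close>.\<close>
  define C where "C = (\<Sum>f\<le>b. smult (real (b choose f) * pochhammer al f) (c f))"
  have "degree C \<le> g"
    unfolding C_def g
    by (intro degree_sum_le order_trans[OF degree_smult_le] order_trans[OF c(1)]) auto
  moreover have "has_parity g C"
    unfolding C_def
  proof (intro has_parity_sum has_parity_smult)
    fix f
    have "even (e + 2 * (b - f) + g)" by (simp add: g)
    from has_parity_cong[OF this] show "has_parity g (c f)" using c(2) by blast
  qed
  moreover have "coeff C g = \<rho> ^ g"
  proof -
    have "coeff (c f) g = (if f = 0 then \<rho> ^ g else 0)" if "f \<le> b" for f
      using c(1)[of f] c(3)[of 0] that by (auto simp: g intro: coeff_eq_0)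
    then have "coeff C g = (\<Sum>f\<le>b. if f = 0 then \<rho> ^ g else 0)"
      unfolding C_def coeff_sum by (intro sum.cong) auto
    then show ?thesis by simp
  qed
  ultimately obtain q where q: "degree q \<le> g" "poly q 1 = \<rho> ^ g"
    "\<And>N. moment_functional (\<lambda>e. gauss_moment (N + e)) C / pochhammer (al + ga + 1) ((N + g) div 2)
        = gegen_functional (al + ga) (q * monom 1 N)"
    using gegen_functional_of_gauss[OF alga, of C g] by auto
  have "(\<Sum>p\<le>N. real (N choose p) * (\<rho> ^ p * \<kappa> ^ (N - p) * gegen_moment (ga - 1/2) (N - p) *
      radial_moment al ga ((p + g) div 2) ((N - p) div 2) * gegen_moment (al - 1/2) (p + e)))
    = moment_functional (\<lambda>e. gauss_moment (N + e)) C / pochhammer (al + ga + 1) ((N + g) div 2)" (is "?L = _") for N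
  proof -
    have "?L = (\<Sum>p\<le>N. real (N choose p) * (\<rho> ^ p * \<kappa> ^ (N - p) * gauss_moment (N - p) *
      (\<Sum>f\<le>b. real (b choose f) * pochhammer al f * gauss_moment (p + e + 2 * (b - f)))
       / pochhammer (al + ga + 1) ((N + g) div 2)))"
    proof (intro sum.cong refl arg_cong2[where f = "(*)"])
      fix p assume "p \<in> {..N}"
      then have p: "p \<le> N" by simp
      show "\<rho> ^ p * \<kappa> ^ (N - p) * gegen_moment (ga - 1/2) (N - p) *
      radial_moment al ga ((p + g) div 2) ((N - p) div 2) * gegen_moment (al - 1/2) (p + e)
       = \<rho> ^ p * \<kappa> ^ (N - p) * gauss_moment (N - p) *
      (\<Sum>f\<le>b. real (b choose f) * pochhammer al f * gauss_moment (p + e + 2 * (b - f)))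
       / pochhammer (al + ga + 1) ((N + g) div 2)"
      proof (cases "even (N - p) \<and> even (p + e)")
        case False
        then show ?thesis
          unfolding gauss_moment_pochhammer_sum by (auto simp: gegen_moment_def gauss_moment_def)
      next
        case True
        obtain i where i: "N - p = 2 * i" using conjunct1[OF True] by (elim evenE)
        obtain j where j: "p + e = 2 * j" using conjunct2[OF True] by (elim evenE)
        have d1: "(p + g) div 2 = j + b" using j by (simp add: g flip: add.assoc)
        have "N + g = 2 * (i + j + b)" using i j p by (simp add: g)
        then have d2: "(N + g) div 2 = j + b + i" by simp
        \<comment> \<open>The denominators of both Gegenbauer moments cancel against the numerators
          of \<open>radial_moment\<close>. This works also for \<open>ga \<le> 0\<close>, where
          \<open>v\<close> has no density.\<close>
        have n1: "pochhammer (ga + 1/2) i \<noteq> 0" "pochhammer (al + 1/2) j \<noteq> 0"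
          using al ga by (auto intro!: pochhammer_nonzero)
        have s: "pochhammer (al + 1/2) (j + b) = pochhammer (al + 1/2) j * pochhammer (al + 1/2 + j) b"
          by (rule pochhammer_product')
        have sh: "ga - 1/2 + 1 = ga + 1/2" "al - 1/2 + 1 = al + 1/2" by simp_all
        have "2 * j div 2 = j" "2 * i div 2 = i" by simp_all
        then show ?thesis
          unfolding gauss_moment_pochhammer_sum gegen_moment_def radial_moment_def d1 d2 j i s sh using n1 by (simp only:) simp
      qed
    qed
    also have "\<dots> = (\<Sum>f\<le>b. real (b choose f) * pochhammer al f *
      (\<Sum>p\<le>N. real (N choose p) * (\<rho> ^ p * \<kappa> ^ (N - p) * gauss_moment (e + 2 * (b - f) + p) * gauss_moment (N - p))))
       / pochhammer (al + ga + 1) ((N + g) div 2)"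
      unfolding sum_distrib_left sum_divide_distrib
      by (subst sum.swap) (intro sum.cong refl, simp add: mult_ac add_ac)
    also have "\<dots> = (\<Sum>f\<le>b. real (b choose f) * pochhammer al f * gauss_directional w N (a f))
       / pochhammer (al + ga + 1) ((N + g) div 2)"
      unfolding gauss_directional_bool by (simp add: a_def w_def)
    also have "\<dots> = moment_functional (\<lambda>e. gauss_moment (N + e)) C / pochhammer (al + ga + 1) ((N + g) div 2)"
      unfolding c(4) C_def moment_functional_sum moment_functional_smult ..
    finally show ?thesis .
  qed
  then show ?thesis unfolding q(3) using q(1,2) by blast
qed

section \<open>Gaussian integrals on the line and on Euclidean space\<close>

lemma has_bochner_integral_gauss_moment:
  "has_bochner_integral lborel (\<lambda>x. x ^ k * exp (- x\<^sup>2)) (sqrt pi * gauss_moment k)"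
proof -
  define v where "v = (if even k then sqrt pi / 2 * (fact (2 * (k div 2)) / (2 ^ (2 * (k div 2)) * fact (k div 2)))
    else fact (k div 2) / 2)"
  have v: "has_bochner_integral lborel (\<lambda>x. indicator {0..} x *\<^sub>R (exp (- x\<^sup>2) * x ^ k)) v"
  proof (cases "even k")
    case True
    then show ?thesis using gaussian_moment_even_pos[of "k div 2"] by (simp add: v_def)
  next
    case False
    then have "2 * (k div 2) + 1 = k" by presburger
    then show ?thesis using gaussian_moment_odd_pos[of "k div 2"] False by (simp add: v_def)
  qed
  define f where "f x = indicator {0..} x *\<^sub>R (exp (- x\<^sup>2) * x ^ k)" for x :: real
  have "has_bochner_integral lborel (\<lambda>x. f x + (-1) ^ k * f (- x)) (v + (-1) ^ k * v)"
    unfolding f_def by (intro has_bochner_integral_add v has_bochner_integral_mult_right has_bochner_integral_reflect[OF v])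
  moreover have "has_bochner_integral lborel (\<lambda>x. f x + (-1) ^ k * f (- x)) y \<longleftrightarrow>
     has_bochner_integral lborel (\<lambda>x. x ^ k * exp (- x\<^sup>2)) y" for y
  proof (rule has_bochner_integral_cong_AE)
    show "AE x in lborel. f x + (-1) ^ k * f (- x) = x ^ k * exp (- x\<^sup>2)"
      using AE_lborel_singleton[of 0]
    proof eventually_elim
      fix x :: real assume "x \<noteq> 0"
      have "(-1) ^ k * (exp (- x\<^sup>2) * (- x) ^ k) = x ^ k * exp (- x\<^sup>2)"
      proof -
        have "(-1) ^ k * (- x) ^ k = x ^ k" by (simp flip: power_mult_distrib)
        moreover have "(-1) ^ k * (exp (- x\<^sup>2) * (- x) ^ k) = ((-1) ^ k * (- x) ^ k) * exp (- x\<^sup>2)"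
          by (simp only: mult_ac)
        ultimately show ?thesis by simp
      qed
      then show "f x + (-1) ^ k * f (- x) = x ^ k * exp (- x\<^sup>2)"
        using \<open>x \<noteq> 0\<close> by (auto simp: f_def indicator_def mult_ac)
    qed
  qed (auto simp: f_def)
  moreover have "v + (-1) ^ k * v = sqrt pi * gauss_moment k"
  proof (cases "even k")
    case True
    have "pochhammer (1/2) (k div 2) = (fact (2 * (k div 2)) / (2 ^ (2 * (k div 2)) * fact (k div 2)) :: real)"
      using pochhammer_half_fact_even[of "k div 2"] by (simp add: power_mult field_simps)
    then show ?thesis using True by (simp add: v_def gauss_moment_def)
  qed (simp add: gauss_moment_def)
  ultimately show ?thesis by simp
qed

lemma has_bochner_integral_gauss_monomial:
  fixes a :: "'n::finite \<Rightarrow> nat"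
  shows "has_bochner_integral lborel (\<lambda>x :: real^'n. (\<Prod>i\<in>UNIV. (x $ i) ^ a i) * exp (- (norm x)\<^sup>2))
    (\<Prod>i\<in>UNIV. sqrt pi * gauss_moment (a i))"
proof -
  define ax where "ax i = (axis i 1 :: real^'n)" for i
  have inj: "inj ax" by (auto simp: inj_def ax_def axis_eq_axis)
  have B: "Basis = range ax" by (auto simp: Basis_vec_def ax_def)
  define h where "h b y = y ^ a (the_inv ax b) * exp (- y\<^sup>2)" for b and y :: real
  have h: "h (ax i) y = y ^ a i * exp (- y\<^sup>2)" for i y
    by (simp add: h_def the_inv_f_f[OF inj])
  have reB: "(\<Prod>b\<in>Basis. g b) = (\<Prod>i\<in>UNIV. g (ax i))" for g :: "real^'n \<Rightarrow> real"
    unfolding B by (simp add: prod.reindex[OF inj])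
  interpret product_sigma_finite "\<lambda>_::real^'n. lborel :: real measure" ..
  define S where "S f = (\<Sum>b\<in>Basis. f b *\<^sub>R b)" for f :: "real^'n \<Rightarrow> real"
  have lb: "lborel = distr (\<Pi>\<^sub>M b\<in>Basis. lborel) borel S" unfolding S_def lborel_eq_real unfolding lborel_def ..
  have Sm: "S \<in> (\<Pi>\<^sub>M b\<in>Basis. lborel) \<rightarrow>\<^sub>M borel" unfolding S_def by measurable
  have S: "S f \<bullet> b = f b" if "b \<in> Basis" for f b
    using that by (simp add: S_def)
  have e: "(\<Prod>i\<in>UNIV. (x $ i) ^ a i) * exp (- (norm x)\<^sup>2) = (\<Prod>b\<in>Basis. h b (x \<bullet> b))" for x :: "real^'n"
  proof -
    have "(norm x)\<^sup>2 = (\<Sum>i\<in>UNIV. (x $ i)\<^sup>2)"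
      by (simp add: norm_vec_def L2_set_def sum_nonneg)
    moreover have "x \<bullet> ax i = x $ i" for i by (simp add: ax_def inner_axis)
    ultimately show ?thesis
      by (simp add: reB h prod.distrib exp_sum sum_negf[symmetric])
  qed
  have hm: "integrable lborel (h b)" "b \<in> Basis \<Longrightarrow> h b \<in> borel_measurable lborel" for b
    unfolding h_def using has_bochner_integral_gauss_moment by (auto simp: has_bochner_integral_iff)
  have "integrable (\<Pi>\<^sub>M b\<in>Basis. lborel) (\<lambda>f. \<Prod>b\<in>(Basis :: (real^'n) set). h b (f b))"
    by (intro product_integrable_prod hm) auto
  moreover have "(\<integral>f. (\<Prod>b\<in>Basis. h b (f b)) \<partial>(\<Pi>\<^sub>M b\<in>(Basis :: (real^'n) set). lborel)) = (\<Prod>b\<in>Basis. integral\<^sup>L lborel (h b))"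
    by (intro product_integral_prod hm) auto
  moreover have "(\<Prod>b\<in>(Basis :: (real^'n) set). integral\<^sup>L lborel (h b)) = (\<Prod>i\<in>UNIV. sqrt pi * gauss_moment (a i))"
    using has_bochner_integral_gauss_moment by (simp add: reB h[abs_def] has_bochner_integral_iff)
  moreover have "(\<Prod>b\<in>Basis. h b (S f \<bullet> b)) = (\<Prod>b\<in>Basis. h b (f b))" for f
    by (intro prod.cong) (simp_all add: S)
  moreover have "(\<lambda>x. \<Prod>b\<in>(Basis :: (real^'n) set). h b (x \<bullet> b)) \<in> borel_measurable borel"
    unfolding h_def by measurable
  ultimately show ?thesis
    unfolding e has_bochner_integral_iff lb
    by (simp add: integrable_distr_eq[OF Sm] integral_distr[OF Sm])
qed

subsection \<open>Integration over the unit sphere\<close>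

lemma sets_sphere_measure [simp, measurable_cong]: "sets (sphere_measure :: (real^'n::finite) measure) = sets borel"
  by (simp add: sphere_measure_def)

lemma space_sphere_measure [simp]: "space (sphere_measure :: (real^'n::finite) measure) = UNIV"
  by (simp add: sphere_measure_def space_scale_measure)

lemma normalize_measurable [measurable]: "(\<lambda>x :: real^'n::finite. x /\<^sub>R norm x) \<in> borel_measurable borel"
  by measurable

lemma nn_integral_sphere_measure:
  fixes f :: "real^'n::finite \<Rightarrow> ennreal"
  assumes [measurable]: "f \<in> borel_measurable borel"
  shows "(\<integral>\<^sup>+u. f u \<partial>sphere_measure) =
    of_nat CARD('n) * (\<integral>\<^sup>+x. f (x /\<^sub>R norm x) * indicator (ball 0 1 - {0}) x \<partial>lborel)"
proof -
  have [measurable]: "ball 0 1 - {0} \<in> sets (borel :: (real^'n) measure)" by measurable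
  have [measurable]: "(\<lambda>x :: real^'n. x /\<^sub>R norm x) \<in> restrict_space lborel (ball 0 1 - {0}) \<rightarrow>\<^sub>M borel"
    by (intro measurable_restrict_space1) measurable
  show ?thesis
    unfolding sphere_measure_def
    by (simp add: nn_integral_scale_measure nn_integral_distr nn_integral_restrict_space)
qed

lemma emeasure_sphere_measure:
  "emeasure (sphere_measure :: (real^'n::finite) measure) UNIV = of_nat CARD('n) * emeasure lborel (ball (0 :: real^'n) 1)"
proof -
  have "emeasure (sphere_measure :: (real^'n) measure) UNIV = (\<integral>\<^sup>+u. 1 \<partial>(sphere_measure :: (real^'n) measure))" by simp
  also have "\<dots> = of_nat CARD('n) * emeasure lborel (ball 0 1 - {0 :: real^'n})"
    by (subst nn_integral_sphere_measure) simp_all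
  also have "emeasure lborel (ball 0 1 - {0 :: real^'n}) = emeasure lborel (ball (0 :: real^'n) 1)"
    by (subst emeasure_Diff) auto
  finally show ?thesis .
qed

lemma finite_measure_sphere_measure: "finite_measure (sphere_measure :: (real^'n::finite) measure)"
proof
  show "emeasure (sphere_measure :: (real^'n) measure) (space sphere_measure) \<noteq> \<infinity>"
    using emeasure_lborel_ball_finite[of "0 :: real^'n" 1]
    by (simp add: emeasure_sphere_measure ennreal_mult_eq_top_iff ennreal_of_nat_eq_real_of_nat)
qed

lemma emeasure_sphere_measure_pos: "emeasure (sphere_measure :: (real^'n::finite) measure) UNIV > 0"
proof -
  have "emeasure lborel (ball (0 :: real^'n) 1) > 0"
    by (subst emeasure_ball) (simp_all add: unit_ball_vol_pos)
  then show ?thesis unfolding emeasure_sphere_measure by (simp add: ennreal_zero_less_mult_iff)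
qed

lemma AE_sphere_measure: "AE u in (sphere_measure :: (real^'n::finite) measure). norm u = 1"
proof (rule AE_I)
  show "{u \<in> space sphere_measure. norm u \<noteq> 1} \<subseteq> {u :: real^'n. norm u \<noteq> 1}" by auto
  show "{u :: real^'n. norm u \<noteq> 1} \<in> sets sphere_measure" by simp
  have "emeasure sphere_measure {u :: real^'n. norm u \<noteq> 1} = (\<integral>\<^sup>+u. indicator {u. norm u \<noteq> 1} u \<partial>(sphere_measure :: (real^'n) measure))"
    by simp
  also have "\<dots> = of_nat CARD('n) * (\<integral>\<^sup>+x. 0 \<partial>(lborel :: (real^'n) measure))"
  proof (subst nn_integral_sphere_measure)
    have "indicator {u. norm u \<noteq> 1} (x /\<^sub>R norm x) * indicator (ball 0 1 - {0}) x = (0 :: ennreal)" for x :: "real^'n"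
      by (cases "x = 0") (auto simp: indicator_def)
    then show "of_nat CARD('n) * (\<integral>\<^sup>+x. indicator {u. norm u \<noteq> 1} (x /\<^sub>R norm x) * indicator (ball 0 1 - {0}) x \<partial>(lborel :: (real^'n) measure))
       = of_nat CARD('n) * (\<integral>\<^sup>+x. 0 \<partial>(lborel :: (real^'n) measure))"
      by (simp only:)
  qed measurable
  finally show "emeasure sphere_measure {u :: real^'n. norm u \<noteq> 1} = 0" by simp
qed

section \<open>Polar coordinates for homogeneous functions\<close>

lemma nn_integral_homogeneous_ball:
  fixes f :: "real^'n::finite \<Rightarrow> ennreal"
  assumes [measurable]: "f \<in> borel_measurable borel"
    and hom: "\<And>c x. c > 0 \<Longrightarrow> f (c *\<^sub>R x) = ennreal (c ^ m) * f x" and s: "s > 0"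
  shows "(\<integral>\<^sup>+x. f x * indicator (ball 0 s) x \<partial>lborel) =
    ennreal (s ^ (CARD('n) + m)) * (\<integral>\<^sup>+x. f x * indicator (ball 0 1) x \<partial>lborel)"
proof -
  have [measurable]: "ball 0 r \<in> sets (borel :: (real^'n) measure)" for r by simp
  have "(\<integral>\<^sup>+x. f x * indicator (ball 0 s) x \<partial>lborel) =
     (\<integral>\<^sup>+x. f x * indicator (ball 0 s) x \<partial>density (distr lborel borel (\<lambda>x :: real^'n. 0 + s *\<^sub>R x)) (\<lambda>_. \<bar>s\<bar> ^ DIM(real^'n)))"
    using s by (subst lborel_affine[of s 0]) simp_all
  also have "\<dots> = (\<integral>\<^sup>+x. ennreal (s ^ CARD('n)) * (f (s *\<^sub>R x) * indicator (ball 0 s) (s *\<^sub>R x)) \<partial>lborel)"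
    using s by (simp add: nn_integral_density nn_integral_distr)
  also have "\<dots> = (\<integral>\<^sup>+x. ennreal (s ^ (CARD('n) + m)) * (f x * indicator (ball 0 1) x) \<partial>lborel)"
  proof (rule nn_integral_cong)
    fix x :: "real^'n"
    have "indicator (ball 0 s) (s *\<^sub>R x) = (indicator (ball 0 1) x :: ennreal)"
      using s by (auto simp: indicator_def)
    then show "ennreal (s ^ CARD('n)) * (f (s *\<^sub>R x) * indicator (ball 0 s) (s *\<^sub>R x)) =
       ennreal (s ^ (CARD('n) + m)) * (f x * indicator (ball 0 1) x)"
      using s by (simp add: hom power_add ennreal_mult mult_ac)
  qed
  finally show ?thesis by (simp add: nn_integral_cmult)
qed

text \<open>Polar coordinates for radial functions that are superpositions of indicator functions of balls.\<close>

lemma nn_integral_homogeneous_radial: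
  fixes f :: "real^'n::finite \<Rightarrow> ennreal"
  assumes f [measurable]: "f \<in> borel_measurable borel"
    and hom: "\<And>c x. c > 0 \<Longrightarrow> f (c *\<^sub>R x) = ennreal (c ^ m) * f x"
    and g [measurable]: "g \<in> borel_measurable borel"
  shows "(\<integral>\<^sup>+x. f x * (\<integral>\<^sup>+s. indicator {norm x<..} s * g s \<partial>lborel) \<partial>lborel) =
    (\<integral>\<^sup>+s. indicator {0<..} s * g s * ennreal (s ^ (CARD('n) + m)) \<partial>lborel) * (\<integral>\<^sup>+x. f x * indicator (ball 0 1) x \<partial>lborel)"
proof -
  have [measurable]: "ball 0 r \<in> sets (borel :: (real^'n) measure)" for r by simp
  have m: "(\<lambda>(x :: real^'n, s). f x * ((if norm x < s then 1 else 0) * g s)) \<in> borel_measurable (lborel \<Otimes>\<^sub>M lborel)"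
    by measurable
  have "(\<integral>\<^sup>+x. f x * (\<integral>\<^sup>+s. indicator {norm x<..} s * g s \<partial>lborel) \<partial>lborel) =
     (\<integral>\<^sup>+x. \<integral>\<^sup>+s. f x * ((if norm x < s then 1 else 0) * g s) \<partial>lborel \<partial>lborel)"
    by (subst nn_integral_cmult[symmetric]) (auto simp: indicator_def intro!: nn_integral_cong)
  also have "\<dots> = (\<integral>\<^sup>+s. \<integral>\<^sup>+x. f x * ((if norm x < s then 1 else 0) * g s) \<partial>lborel \<partial>lborel)"
    by (rule lborel_pair.Fubini'[OF m, symmetric])
  also have "\<dots> = (\<integral>\<^sup>+s. indicator {0<..} s * g s * ennreal (s ^ (CARD('n) + m)) * (\<integral>\<^sup>+x. f x * indicator (ball 0 1) x \<partial>lborel) \<partial>lborel)"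
  proof (rule nn_integral_cong)
    fix s :: real
    have "(\<integral>\<^sup>+x. f x * ((if norm x < s then 1 else 0) * g s) \<partial>lborel) =
       (\<integral>\<^sup>+x. f x * indicator (ball 0 s) x * g s \<partial>lborel)"
      by (intro nn_integral_cong) (auto simp: indicator_def)
    also have "\<dots> = (\<integral>\<^sup>+x. f x * indicator (ball 0 s) x \<partial>lborel) * g s"
      by (rule nn_integral_multc) measurable
    also have "\<dots> = indicator {0<..} s * g s * ennreal (s ^ (CARD('n) + m)) * (\<integral>\<^sup>+x. f x * indicator (ball 0 1) x \<partial>lborel)"
    proof (cases "s > 0")
      case True
      then show ?thesis
        by (simp add: nn_integral_homogeneous_ball[OF f hom True] mult_ac)
    qed (simp add: ball_empty)
    finally show "(\<integral>\<^sup>+x. f x * ((if norm x < s then 1 else 0) * g s) \<partial>lborel) =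
       indicator {0<..} s * g s * ennreal (s ^ (CARD('n) + m)) * (\<integral>\<^sup>+x. f x * indicator (ball 0 1) x \<partial>lborel)" .
  qed
  also have "\<dots> = (\<integral>\<^sup>+s. indicator {0<..} s * g s * ennreal (s ^ (CARD('n) + m)) \<partial>lborel) * (\<integral>\<^sup>+x. f x * indicator (ball 0 1) x \<partial>lborel)"
    by (rule nn_integral_multc) measurable
  finally show ?thesis .
qed

text \<open>With \<open>r = norm x\<close> this writes the Gaussian as a superposition of indicator
  functions of balls of radius \<open>s\<close>.\<close>

lemma nn_integral_gauss_kernel:
  assumes "r \<ge> 0"
  shows "(\<integral>\<^sup>+s. indicator {r<..} s * ennreal (2 * s * exp (- s\<^sup>2)) \<partial>lborel) = ennreal (exp (- r\<^sup>2))"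
proof -
  have "((\<lambda>s :: real. - exp (- s\<^sup>2)) \<longlongrightarrow> - 0) at_top"
    by (intro tendsto_minus filterlim_compose[OF exp_at_bot] filterlim_compose[OF filterlim_uminus_at_bot_at_top]
        filterlim_pow_at_top filterlim_ident) simp
  then have "(\<integral>\<^sup>+s. ennreal (2 * s * exp (- s\<^sup>2)) * indicator {r..} s \<partial>lborel) = ennreal (0 - - exp (- r\<^sup>2))"
    using assms by (intro nn_integral_FTC_atLeast) (auto intro!: derivative_eq_intros)
  moreover have "(\<integral>\<^sup>+s. indicator {r<..} s * ennreal (2 * s * exp (- s\<^sup>2)) \<partial>lborel) =
     (\<integral>\<^sup>+s. ennreal (2 * s * exp (- s\<^sup>2)) * indicator {r..} s \<partial>lborel)"
  proof (rule nn_integral_cong_AE)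
    show "AE s in lborel. indicator {r<..} s * ennreal (2 * s * exp (- s\<^sup>2)) =
       ennreal (2 * s * exp (- s\<^sup>2)) * indicator {r..} s"
      using AE_lborel_singleton[of r] by eventually_elim (auto simp: indicator_def)
  qed
  ultimately show ?thesis by simp
qed

text \<open>The same decomposition for \<open>1 / norm x ^ m\<close> inside the unit ball. The
  summand 1 is the unit ball itself, the integral runs over the smaller balls.\<close>

lemma nn_integral_inverse_power_kernel:
  assumes "0 < r" "r < 1"
  shows "1 + (\<integral>\<^sup>+s. indicator {r<..} s * (ennreal (m * (1 / s ^ Suc m)) * indicator {..1} s) \<partial>lborel) = ennreal (1 / r ^ m)"
proof -
  have "(\<integral>\<^sup>+s. ennreal (m * (1 / s ^ Suc m)) * indicator {r..1} s \<partial>lborel) = ennreal (- (1 / 1 ^ m) - - (1 / r ^ m))"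
  proof (rule nn_integral_FTC_Icc[where F = "\<lambda>s. - (1 / s ^ m)"])
    fix s assume "s \<in> {r..1}"
    then have s: "s > 0" using assms by simp
    show "((\<lambda>s :: real. - (1 / s ^ m)) has_real_derivative m * (1 / s ^ Suc m)) (at s)"
    proof (cases m)
      case (Suc n)
      have p: "((\<lambda>s. s ^ Suc n) has_real_derivative Suc n * s ^ n) (at s)"
        using DERIV_pow[of "Suc n" s] by simp
      have "((\<lambda>s. - inverse (s ^ Suc n)) has_real_derivative
          - (- (inverse (s ^ Suc n) * (Suc n * s ^ n) * inverse (s ^ Suc n)))) (at s)"
        by (intro DERIV_minus DERIV_inverse'[OF p]) (use s in simp)
      moreover have "- (- (inverse (s ^ Suc n) * (Suc n * s ^ n) * inverse (s ^ Suc n))) = m * (1 / s ^ Suc m)"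
        unfolding Suc using s by (simp add: field_simps)
      ultimately show ?thesis
        unfolding Suc by (simp only: divide_inverse mult_1_left)
    qed simp
  qed (use assms in auto)
  moreover have "(\<integral>\<^sup>+s. indicator {r<..} s * (ennreal (m * (1 / s ^ Suc m)) * indicator {..1} s) \<partial>lborel) =
     (\<integral>\<^sup>+s. ennreal (m * (1 / s ^ Suc m)) * indicator {r..1} s \<partial>lborel)"
  proof (rule nn_integral_cong_AE)
    show "AE s in lborel. indicator {r<..} s * (ennreal (m * (1 / s ^ Suc m)) * indicator {..1} s) =
       ennreal (m * (1 / s ^ Suc m)) * indicator {r..1} s"
      using AE_lborel_singleton[of r] by eventually_elim (auto simp: indicator_def)
  qed
  moreover have "r ^ m \<le> 1" using assms by (simp add: power_le_one)
  then have "1 / r ^ m \<ge> 1" using assms by (simp add: field_simps)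
  then have "1 + ennreal (1 / r ^ m - 1) = ennreal (1 / r ^ m)"
    by (simp flip: ennreal_1 ennreal_plus)
  ultimately show ?thesis by simp
qed

text \<open>Both sides are multiples of the integral \<open>Y\<close> of \<open>f\<close> over the
  unit ball: on the left by superposing balls to the Gaussian, on the right because
  \<open>f (x /\<^sub>R norm x)\<close> is \<open>f x / norm x ^ m\<close>, where
  \<open>1 / norm x ^ m\<close> is again superposed from balls. So the factor depends on the
  dimension and on \<open>m\<close> only, not on \<open>f\<close>.\<close>

lemma gauss_polar:
  "\<exists>k>0. \<forall>f :: real^'n::finite \<Rightarrow> ennreal. f \<in> borel_measurable borel \<longrightarrow>
     (\<forall>c x. c > 0 \<longrightarrow> f (c *\<^sub>R x) = ennreal (c ^ m) * f x) \<longrightarrow>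
     (\<integral>\<^sup>+x. f x * ennreal (exp (- (norm x)\<^sup>2)) \<partial>lborel) = ennreal k * (\<integral>\<^sup>+u. f u \<partial>sphere_measure)"
proof -
  define d where "d = CARD('n)"
  have d: "d > 0" by (simp add: d_def)
  obtain v where v: "v > 0" "(\<integral>\<^sup>+s. indicator {0<..} s * ennreal (2 * s * exp (- s\<^sup>2)) * ennreal (s ^ (d + m)) \<partial>lborel) = ennreal v"
  proof -
    have "\<exists>v>0. has_bochner_integral lborel (\<lambda>x::real. indicator {0..} x *\<^sub>R (exp (- x\<^sup>2) * x ^ k)) v" for k
    proof (cases "even k")
      case True
      then show ?thesis using gaussian_moment_even_pos[of "k div 2"]
        by (intro exI[of _ "sqrt pi / 2 * (fact (2 * (k div 2)) / (2 ^ (2 * (k div 2)) * fact (k div 2)))"]) simp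
    next
      case False
      then have "2 * (k div 2) + 1 = k" by presburger
      then show ?thesis using gaussian_moment_odd_pos[of "k div 2"] by (intro exI[of _ "fact (k div 2) / 2"]) simp
    qed
    then obtain w where w: "w > 0"
      "has_bochner_integral lborel (\<lambda>x::real. indicator {0..} x *\<^sub>R (exp (- x\<^sup>2) * x ^ (d + m + 1))) w" by blast
    have "(\<integral>\<^sup>+s. indicator {0<..} s * ennreal (2 * s * exp (- s\<^sup>2)) * ennreal (s ^ (d + m)) \<partial>lborel) =
       (\<integral>\<^sup>+s. ennreal (2 * (indicator {0..} s *\<^sub>R (exp (- s\<^sup>2) * s ^ (d + m + 1)))) \<partial>lborel)"
      by (intro nn_integral_cong) (auto simp: indicator_def mult_ac simp flip: ennreal_mult)
    also have "\<dots> = ennreal (2 * w)"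
    proof -
      have "0 \<le> 2 * (indicator {0..} s *\<^sub>R (exp (- s\<^sup>2) * s ^ (d + m + 1)))" for s :: real
        by (auto simp: indicator_def)
      then show ?thesis
        using has_bochner_integral_mult_right[OF w(2), of 2]
        by (subst nn_integral_eq_integral) (auto simp only: has_bochner_integral_iff intro!: AE_I2)
    qed
    finally show ?thesis using that[of "2 * w"] w(1) by simp
  qed
  \<comment> \<open>The Gaussian side is \<open>v * Y\<close>. The sphere side is
    \<open>d * (1 + m / d) * Y\<close>, where \<open>d\<close> comes from the definition of
    \<open>sphere_measure\<close> and \<open>m / d\<close> from the balls of radius at most
    1.\<close>
  define k where "k = v / (d * (1 + m / d))"
  have "(\<integral>\<^sup>+x. f x * ennreal (exp (- (norm x)\<^sup>2)) \<partial>lborel) = ennreal k * (\<integral>\<^sup>+u. f u \<partial>sphere_measure)"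
    if f [measurable]: "f \<in> borel_measurable borel" and hom: "\<And>c x. c > 0 \<Longrightarrow> f (c *\<^sub>R x) = ennreal (c ^ m) * f x"
    for f :: "real^'n \<Rightarrow> ennreal"
  proof -
    have [measurable]: "ball 0 r \<in> sets (borel :: (real^'n) measure)" for r by simp
    define Y where "Y = (\<integral>\<^sup>+x. f x * indicator (ball 0 1) x \<partial>lborel)"
    have "(\<integral>\<^sup>+x. f x * ennreal (exp (- (norm x)\<^sup>2)) \<partial>lborel) =
       (\<integral>\<^sup>+x. f x * (\<integral>\<^sup>+s. indicator {norm x<..} s * ennreal (2 * s * exp (- s\<^sup>2)) \<partial>lborel) \<partial>lborel)"
      by (simp add: nn_integral_gauss_kernel)
    also have "\<dots> = ennreal v * Y"
      unfolding Y_def v(2)[symmetric] d_def by (rule nn_integral_homogeneous_radial[OF f hom]) simp_all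
    finally have 1: "(\<integral>\<^sup>+x. f x * ennreal (exp (- (norm x)\<^sup>2)) \<partial>lborel) = ennreal v * Y" .
    define g where "g s = ennreal (m * (1 / s ^ Suc m)) * indicator {..1} s" for s :: real
    have gm: "g \<in> borel_measurable borel" unfolding g_def by measurable
    have "(\<integral>\<^sup>+x. f (x /\<^sub>R norm x) * indicator (ball 0 1 - {0}) x \<partial>lborel) =
       (\<integral>\<^sup>+x. f x * indicator (ball 0 1) x + f x * (\<integral>\<^sup>+s. indicator {norm x<..} s * g s \<partial>lborel) \<partial>lborel)"
    proof (rule nn_integral_cong_AE)
      show "AE x in lborel. f (x /\<^sub>R norm x) * indicator (ball 0 1 - {0}) x =
         f x * indicator (ball 0 1) x + f x * (\<integral>\<^sup>+s. indicator {norm x<..} s * g s \<partial>lborel)"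
        using AE_lborel_singleton[of 0]
      proof eventually_elim
        fix x :: "real^'n" assume x: "x \<noteq> 0"
        have "f (x /\<^sub>R norm x) = ennreal (1 / norm x ^ m) * f x"
          using x hom[of "inverse (norm x)" x] by (simp add: field_simps)
        have "(\<integral>\<^sup>+s. indicator {norm x<..} s * g s \<partial>lborel) = 0" if "norm x \<ge> 1"
        proof -
          have z: "indicator {norm x<..} s * g s = 0" for s using that by (auto simp: g_def indicator_def)
          show ?thesis unfolding z by simp
        qed
        show "f (x /\<^sub>R norm x) * indicator (ball 0 1 - {0}) x =
         f x * indicator (ball 0 1) x + f x * (\<integral>\<^sup>+s. indicator {norm x<..} s * g s \<partial>lborel)"
        proof (cases "norm x < 1")
          case True
          define K where "K = (\<integral>\<^sup>+s. indicator {norm x<..} s * g s \<partial>lborel)"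
          have "1 + K = ennreal (1 / norm x ^ m)"
            unfolding K_def g_def using x True by (intro nn_integral_inverse_power_kernel) auto
          then have "ennreal (1 / norm x ^ m) * f x = f x + f x * K"
            by (metis distrib_left mult.commute mult.right_neutral)
          then show ?thesis
            using x True \<open>f (x /\<^sub>R norm x) = ennreal (1 / norm x ^ m) * f x\<close> by (simp add: K_def)
        next
          case False
          then show ?thesis
            using \<open>norm x \<ge> 1 \<Longrightarrow> (\<integral>\<^sup>+s. indicator {norm x<..} s * g s \<partial>lborel) = 0\<close> by simp
        qed
      qed
    qed
    also have "\<dots> = Y + (\<integral>\<^sup>+x. f x * (\<integral>\<^sup>+s. indicator {norm x<..} s * g s \<partial>lborel) \<partial>lborel)"
      unfolding Y_def
    proof (rule nn_integral_add)
      have "(\<lambda>(x :: real^'n, s). (if norm x < s then 1 else 0) * g s) \<in> borel_measurable (lborel \<Otimes>\<^sub>M lborel)"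
        using gm by measurable
      then have "(\<lambda>x :: real^'n. \<integral>\<^sup>+s. (if norm x < s then 1 else 0) * g s \<partial>lborel) \<in> borel_measurable lborel"
        by (rule lborel.borel_measurable_nn_integral)
      moreover have "(\<integral>\<^sup>+s. (if norm x < s then 1 else 0) * g s \<partial>lborel) = (\<integral>\<^sup>+s. indicator {norm x<..} s * g s \<partial>lborel)" for x :: "real^'n"
        by (intro nn_integral_cong) (auto simp: indicator_def)
      ultimately show "(\<lambda>x. f x * (\<integral>\<^sup>+s. indicator {norm x<..} s * g s \<partial>lborel)) \<in> borel_measurable lborel"
        by simp
    qed measurable
    also have "(\<integral>\<^sup>+x. f x * (\<integral>\<^sup>+s. indicator {norm x<..} s * g s \<partial>lborel) \<partial>lborel) =
       (\<integral>\<^sup>+s. indicator {0<..} s * g s * ennreal (s ^ (d + m)) \<partial>lborel) * Y"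
      unfolding Y_def d_def by (rule nn_integral_homogeneous_radial[OF f hom gm])
    also have "(\<integral>\<^sup>+s. indicator {0<..} s * g s * ennreal (s ^ (d + m)) \<partial>lborel) = ennreal (m / d)"
    proof -
      have "(\<integral>\<^sup>+s. indicator {0<..} s * g s * ennreal (s ^ (d + m)) \<partial>lborel) =
         (\<integral>\<^sup>+s. ennreal (m * s ^ (d - 1)) * indicator {0..1} s \<partial>lborel)"
      proof (intro nn_integral_cong_AE)
        show "AE s in lborel. indicator {0<..} s * g s * ennreal (s ^ (d + m)) = ennreal (m * s ^ (d - 1)) * indicator {0..1} s"
          using AE_lborel_singleton[of 0]
        proof eventually_elim
          fix s :: real assume s: "s \<noteq> 0"
          have "d + m = (d - 1) + Suc m" using d by simp
          then have "m * (1 / s ^ Suc m) * s ^ (d + m) = m * s ^ (d - 1)"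
            using s by (simp only: power_add) simp
          then show "indicator {0<..} s * g s * ennreal (s ^ (d + m)) = ennreal (m * s ^ (d - 1)) * indicator {0..1} s"
            using s by (auto simp: g_def indicator_def simp flip: ennreal_mult)
        qed
      qed
      also have "\<dots> = ennreal (real m * 1 ^ d / d - real m * 0 ^ d / d)"
      proof (rule nn_integral_FTC_Icc[where F = "\<lambda>s. m * s ^ d / d"])
        show "((\<lambda>s. m * s ^ d / d) has_real_derivative m * s ^ (d - 1)) (at s)" for s :: real
          using d by (auto intro!: derivative_eq_intros)
      qed auto
      finally show ?thesis using d by (simp add: zero_power)
    qed
    also have "Y + ennreal (m / d) * Y = ennreal (1 + m / d) * Y"
      by (simp add: distrib_right ennreal_plus)
    finally have 2: "(\<integral>\<^sup>+u. f u \<partial>sphere_measure) = ennreal d * (ennreal (1 + m / d) * Y)"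
      by (simp add: nn_integral_sphere_measure[OF f] d_def ennreal_of_nat_eq_real_of_nat)
    have "ennreal (k * (d * (1 + m / d))) = ennreal k * ennreal (d * (1 + m / d))"
      by (rule ennreal_mult) (use v(1) in \<open>auto simp: k_def\<close>)
    also have "ennreal (d * (1 + m / d)) = ennreal d * ennreal (1 + m / d)"
      by (rule ennreal_mult) auto
    finally have "ennreal k * (ennreal d * (ennreal (1 + m / d) * Y)) = ennreal (k * (d * (1 + m / d))) * Y"
      by (simp only: mult.assoc)
    also have "k * (d * (1 + m / d)) = v"
    proof -
      have "1 + m / d > 0" by (simp add: add_pos_nonneg)
      then show ?thesis using d by (simp add: k_def)
    qed
    finally show ?thesis unfolding 1 2 ..
  qed
  moreover have "k > 0" using v(1) d by (simp add: k_def add_pos_nonneg)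
  ultimately show ?thesis by blast
qed

section \<open>Moments of monomials on the sphere\<close>

definition monomial :: "('n::finite \<Rightarrow> nat) \<Rightarrow> real^'n \<Rightarrow> real" where
  "monomial a x = (\<Prod>i\<in>UNIV. (x $ i) ^ a i)"

lemma continuous_on_monomial [continuous_intros]: "continuous_on S (monomial a)"
  unfolding monomial_def[abs_def] by (intro continuous_intros)

lemma monomial_scaleR: "monomial a (c *\<^sub>R x) = c ^ sum a UNIV * monomial a x"
  by (simp add: monomial_def power_mult_distrib prod.distrib power_sum)

lemma monomial_fun_upd_Suc: "monomial (a(j := Suc (a j))) x = x $ j * monomial a x"
  unfolding monomial_def by (subst (1 2) prod.remove[of _ j]) (auto intro!: prod.cong)

lemma sum_fun_upd_Suc: "sum (a(j := Suc (a j))) (UNIV :: 'n::finite set) = Suc (sum a UNIV)"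
  by (subst (1 2) sum.remove[of _ j]) (auto intro!: sum.cong)

lemma integrable_sphere_measure:
  fixes f :: "real^'n::finite \<Rightarrow> real"
  assumes "continuous_on UNIV f"
  shows "integrable sphere_measure f"
proof -
  interpret finite_measure "sphere_measure :: (real^'n) measure" by (rule finite_measure_sphere_measure)
  have "bounded (f ` sphere 0 1)"
    by (intro compact_imp_bounded compact_continuous_image continuous_on_subset[OF assms]) auto
  then obtain B where "\<forall>u\<in>sphere 0 1. \<bar>f u\<bar> \<le> B" by (auto simp: bounded_iff)
  then have B: "\<bar>f u\<bar> \<le> B" if "norm u = 1" for u using that by auto
  have "AE u in sphere_measure. norm (f u) \<le> B"
    using AE_sphere_measure by eventually_elim (simp add: B)
  then show ?thesis
    using borel_measurable_continuous_onI[OF assms] by (intro integrable_const_bound) (auto cong: measurable_cong_sets)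
qed

definition sphere_integral :: "(real^'n::finite \<Rightarrow> real) \<Rightarrow> real" where
  "sphere_integral f = (LINT u|sphere_measure. f u)"

lemma sphere_integral_1_pos: "sphere_integral (\<lambda>_ :: real^'n::finite. 1) > 0"
proof -
  interpret finite_measure "sphere_measure :: (real^'n) measure" by (rule finite_measure_sphere_measure)
  show ?thesis
    using emeasure_sphere_measure_pos[where 'n = 'n] emeasure_eq_measure[of "UNIV :: (real^'n) set"]
    by (simp add: sphere_integral_def)
qed

text \<open>The polar formula concerns nonnegative functions; it is applied to the positive and the
  negative part of a monomial, which are homogeneous of the same degree and so share the
  constant.\<close>

lemma gauss_sphere_moment:
  "\<exists>k>0. \<forall>a :: 'n::finite \<Rightarrow> nat. sum a UNIV = m \<longrightarrow>
     (\<Prod>i\<in>UNIV. sqrt pi * gauss_moment (a i)) = k * sphere_integral (monomial a)"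
proof -
  obtain k where k: "k > 0" "\<And>f :: real^'n \<Rightarrow> ennreal. f \<in> borel_measurable borel \<Longrightarrow>
     (\<And>c x. c > 0 \<Longrightarrow> f (c *\<^sub>R x) = ennreal (c ^ m) * f x) \<Longrightarrow>
     (\<integral>\<^sup>+x. f x * ennreal (exp (- (norm x)\<^sup>2)) \<partial>lborel) = ennreal k * (\<integral>\<^sup>+u. f u \<partial>sphere_measure)"
    using gauss_polar[where 'n = 'n and m = m] by meson
  have "(\<Prod>i\<in>UNIV. sqrt pi * gauss_moment (a i)) = k * sphere_integral (monomial a)"
    if a: "sum a UNIV = m" for a :: "'n \<Rightarrow> nat"
  proof -
    have G: "has_bochner_integral lborel (\<lambda>x. monomial a x * exp (- (norm x)\<^sup>2)) (\<Prod>i\<in>UNIV. sqrt pi * gauss_moment (a i))"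
      unfolding monomial_def by (rule has_bochner_integral_gauss_monomial)
    have [measurable]: "monomial a \<in> borel_measurable borel"
      by (intro borel_measurable_continuous_onI continuous_on_monomial)
    have e: "(\<integral>\<^sup>+x. ennreal (s * monomial a x * exp (- (norm x)\<^sup>2)) \<partial>lborel) =
       ennreal k * (\<integral>\<^sup>+u. ennreal (s * monomial a u) \<partial>sphere_measure)" for s :: real
    proof -
      have "(\<integral>\<^sup>+x. ennreal (s * monomial a x) * ennreal (exp (- (norm x)\<^sup>2)) \<partial>lborel) =
         ennreal k * (\<integral>\<^sup>+u. ennreal (s * monomial a u) \<partial>sphere_measure)"
      proof (rule k(2))
        fix c x assume "(c::real) > 0"
        then show "ennreal (s * monomial a (c *\<^sub>R x)) = ennreal (c ^ m) * ennreal (s * monomial a x)"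
          by (simp add: monomial_scaleR a mult.left_commute flip: ennreal_mult')
      qed measurable
      moreover have "ennreal (s * monomial a x) * ennreal (exp (- (norm x)\<^sup>2)) = ennreal (s * monomial a x * exp (- (norm x)\<^sup>2))" for x
        by (simp add: ennreal_mult'')
      ultimately show ?thesis by simp
    qed
    have "(\<Prod>i\<in>UNIV. sqrt pi * gauss_moment (a i)) = (LINT x|lborel. monomial a x * exp (- (norm x)\<^sup>2))"
      using G by (simp add: has_bochner_integral_iff)
    also have "\<dots> = enn2real (ennreal k * (\<integral>\<^sup>+u. ennreal (monomial a u) \<partial>sphere_measure))
       - enn2real (ennreal k * (\<integral>\<^sup>+u. ennreal (- monomial a u) \<partial>sphere_measure))"
      using G e[of 1] e[of "-1"] by (subst real_lebesgue_integral_def) (simp_all add: has_bochner_integral_iff)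
    also have "\<dots> = k * sphere_integral (monomial a)"
      using k(1) unfolding sphere_integral_def
      by (subst real_lebesgue_integral_def)
        (simp_all add: integrable_sphere_measure continuous_on_monomial enn2real_mult right_diff_distrib)
    finally show ?thesis .
  qed
  then show ?thesis using k(1) by blast
qed

text \<open>The polar constants \<open>K m\<close> need not be computed: on the sphere the squares
  of the coordinates sum to 1, which relates \<open>K (2 * j + 2)\<close> to
  \<open>K (2 * j)\<close> and builds up the Pochhammer symbol. For odd total degree some exponent
  is odd and both sides vanish.\<close>

lemma sphere_integral_monomial:
  "sphere_integral (monomial (a :: 'n::finite \<Rightarrow> nat)) =
    sphere_integral (\<lambda>_ :: real^'n. 1) * (\<Prod>i\<in>UNIV. gauss_moment (a i)) / pochhammer (CARD('n) / 2) (sum a UNIV div 2)"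
proof -
  define d where "d = real CARD('n)"
  define A where "A = sqrt pi ^ CARD('n)"
  have A: "A > 0" by (simp add: A_def)
  have "\<forall>m. \<exists>k>0. \<forall>a :: 'n \<Rightarrow> nat. sum a UNIV = m \<longrightarrow>
     (\<Prod>i\<in>UNIV. sqrt pi * gauss_moment (a i)) = k * sphere_integral (monomial a)"
    using gauss_sphere_moment by blast
  then obtain K where K: "\<And>m. K m > 0" "\<And>m a. sum a UNIV = m \<Longrightarrow>
     (\<Prod>i\<in>UNIV. sqrt pi * gauss_moment (a i)) = K m * sphere_integral (monomial (a :: 'n \<Rightarrow> nat))" by metis
  have K': "A * (\<Prod>i\<in>UNIV. gauss_moment (a i)) = K (sum a UNIV) * sphere_integral (monomial a)" for a :: "'n \<Rightarrow> nat"
    using K(2)[of a, OF refl] by (simp add: prod.distrib A_def)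
  have rec: "K (2 * j + 2) = K (2 * j) * (d / 2 + j)" for j
  proof -
    \<comment> \<open>A single test monomial suffices for the recursion; the power
      \<open>2 * j\<close> of one coordinate has a nonzero Gaussian moment.\<close>
    define i0 where "i0 = (SOME i :: 'n. True)"
    define b where "b i = (if i = i0 then 2 * j else 0)" for i :: 'n
    have sb: "sum b UNIV = 2 * j" by (simp add: b_def[abs_def])
    define P where "P = A * (\<Prod>i\<in>UNIV. gauss_moment (b i))"
    have P: "P \<noteq> 0" using A pochhammer_pos[of "1/2 :: real"]
      by (auto simp: P_def b_def gauss_moment_def less_imp_neq[OF pochhammer_pos, symmetric])
    define b2 where "b2 i = b(i := Suc (Suc (b i)))" for i
    have b2': "b2 i = (b(i := Suc (b i)))(i := Suc ((b(i := Suc (b i))) i))" for i by (simp add: b2_def)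
    have sb2: "sum (b2 i) UNIV = 2 * j + 2" for i
      unfolding b2' sum_fun_upd_Suc sb by simp
    have "A * (\<Prod>k\<in>UNIV. gauss_moment (b2 i k)) = P * ((real (b i) + 1) / 2)" for i
    proof -
      have "(\<Prod>k\<in>UNIV - {i}. gauss_moment (b2 i k)) = (\<Prod>k\<in>UNIV - {i}. gauss_moment (b k))"
        by (intro prod.cong) (auto simp: b2_def)
      then show ?thesis
        unfolding P_def by (subst (1 2) prod.remove[of _ i]) (simp_all add: b2_def gauss_moment_Suc_Suc)
    qed
    then have h: "K (2 * j + 2) * sphere_integral (monomial (b2 i)) = P * ((real (b i) + 1) / 2)" for i
      by (metis K' sb2)
    have "K (2 * j + 2) * (\<Sum>i\<in>UNIV. sphere_integral (monomial (b2 i))) = P * (\<Sum>i\<in>UNIV. (real (b i) + 1) / 2)"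
      unfolding sum_distrib_left h ..
    also have "(\<Sum>i\<in>UNIV. (real (b i) + 1) / 2) = d / 2 + j"
      using sb by (simp add: sum.distrib d_def add_divide_distrib flip: sum_divide_distrib of_nat_sum)
    also have "(\<Sum>i\<in>UNIV. sphere_integral (monomial (b2 i))) = sphere_integral (monomial b)"
    proof -
      have "(\<Sum>i\<in>UNIV. sphere_integral (monomial (b2 i))) = (LINT u|sphere_measure. (\<Sum>i\<in>UNIV. monomial (b2 i) u))"
        unfolding sphere_integral_def
        by (intro Bochner_Integration.integral_sum[symmetric] integrable_sphere_measure continuous_on_monomial)
      also have "\<dots> = (LINT u|sphere_measure. monomial b u)"
      proof (rule integral_cong_AE)
        show "AE u in sphere_measure. (\<Sum>i\<in>UNIV. monomial (b2 i) u) = monomial b u"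
          using AE_sphere_measure
        proof eventually_elim
          case (elim u)
          then have "(\<Sum>i\<in>UNIV. (u $ i)\<^sup>2) = 1"
            by (simp add: norm_vec_def L2_set_def)
          then show ?case
            unfolding b2' monomial_fun_upd_Suc
            by (simp add: sum_distrib_right[symmetric] power2_eq_square flip: mult.assoc)
        qed
      qed (auto intro!: borel_measurable_integrable integrable_sphere_measure continuous_intros)
      finally show ?thesis by (simp add: sphere_integral_def)
    qed
    finally have "K (2 * j + 2) * sphere_integral (monomial b) = P * (d / 2 + j)" .
    moreover have PK: "P = K (2 * j) * sphere_integral (monomial b)"
      unfolding P_def K'[of b] sb ..
    moreover have "sphere_integral (monomial b) \<noteq> 0" using P PK by auto
    ultimately show ?thesis by simp
  qed
  have Kp: "K (2 * j) = K 0 * pochhammer (d / 2) j" for j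
    by (induction j) (simp_all add: rec[simplified] pochhammer_Suc)
  have K0: "A = K 0 * sphere_integral (\<lambda>_ :: real^'n. 1)"
    using K'[of "\<lambda>_. 0"] by (simp add: gauss_moment_def monomial_def[abs_def])
  have d: "d > 0" by (simp add: d_def)
  show ?thesis
  proof (cases "even (sum a UNIV)")
    case True
    then obtain j where j: "sum a UNIV = 2 * j" by (elim evenE)
    have "pochhammer (d / 2) j \<noteq> 0" using d by (intro pochhammer_nonzero) simp
    then show ?thesis
      using K'[of a] K(1)[of 0] unfolding j Kp K0 by (simp add: field_simps d_def)
  next
    case False
    then obtain i where "odd (a i)" by (metis dvd_sum)
    then have z: "(\<Prod>i\<in>UNIV. gauss_moment (a i)) = 0" by (auto simp: gauss_moment_def)
    have "sphere_integral (monomial a) = 0"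
      using K'[of a] K(1)[of "sum a UNIV"] unfolding z by simp
    then show ?thesis unfolding z by simp
  qed
qed

lemma sphere_integral_monomial_inner:
  fixes w :: "real^'n::finite"
  shows "sphere_integral (\<lambda>u. monomial a u * (u \<bullet> w) ^ N) =
    sphere_integral (\<lambda>_ :: real^'n. 1) * gauss_directional (\<lambda>i. w $ i) N a / pochhammer (CARD('n) / 2) ((N + sum a UNIV) div 2)"
proof (induction N arbitrary: a)
  case 0
  then show ?case by (simp add: sphere_integral_monomial)
next
  case (Suc N)
  have "monomial a u * (u \<bullet> w) ^ Suc N = (\<Sum>j\<in>UNIV. w $ j * (monomial (a(j := Suc (a j))) u * (u \<bullet> w) ^ N))" for u
    unfolding monomial_fun_upd_Suc by (simp add: inner_vec_def sum_distrib_left sum_distrib_right mult_ac)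
  then have "sphere_integral (\<lambda>u. monomial a u * (u \<bullet> w) ^ Suc N) =
     (\<Sum>j\<in>UNIV. w $ j * sphere_integral (\<lambda>u. monomial (a(j := Suc (a j))) u * (u \<bullet> w) ^ N))"
    unfolding sphere_integral_def
    by (simp only:) (subst Bochner_Integration.integral_sum,
      auto intro!: integrable_sphere_measure continuous_intros)
  then show ?case
    unfolding Suc sum_fun_upd_Suc by (simp add: sum_distrib_left sum_divide_distrib mult_ac)
qed

text \<open>The Gaussian model in its original form: \<open>R\<close> is the norm of a Gaussian
  vector, and the component of a uniform direction along \<open>w\<close> has the Gegenbauer law of
  parameter d/2 - 1. Dimension at least 2 places this parameter above -1/2.\<close>

lemma sphere_conditional_expectation:
  fixes w :: "real^'n::finite"
  assumes w: "norm w = 1" and card: "CARD('n) \<ge> 2"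
  shows "\<exists>q. degree q \<le> sum a UNIV \<and> has_parity (sum a UNIV) q \<and> poly q 1 = monomial a w \<and>
    (\<forall>N. sphere_integral (\<lambda>u. monomial a u * (u \<bullet> w) ^ N) =
       sphere_integral (\<lambda>_ :: real^'n. 1) * gegen_functional (CARD('n) / 2 - 1) (q * monom 1 N))"
proof -
  have "(\<Sum>i\<in>UNIV. (w $ i)\<^sup>2) = 1"
    using w by (simp add: norm_vec_def L2_set_def)
  from gauss_directional_representation[OF this, of a] obtain c where c:
    "degree c \<le> sum a UNIV" "has_parity (sum a UNIV) c" "coeff c (sum a UNIV) = monomial a w"
    "\<And>N. gauss_directional (\<lambda>i. w $ i) N a = moment_functional (\<lambda>e. gauss_moment (N + e)) c"
    unfolding monomial_def by blast
  have l: "CARD('n) / 2 - 1 > (-1/2 :: real)" using card by simp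
  have e: "CARD('n) / 2 - 1 + 1 = (CARD('n) / 2 :: real)" by simp
  show ?thesis
    using gegen_functional_of_gauss[OF l c(1,2)] unfolding e c(3) sphere_integral_monomial_inner c(4)
    by (metis times_divide_eq_right)
qed

subsection \<open>Integration of polynomials over the double cone\<close>

definition radial_integral :: "real \<Rightarrow> real \<Rightarrow> nat \<Rightarrow> nat \<Rightarrow> nat \<Rightarrow> real" where
  "radial_integral b g m k l =
    (LINT t:{-1..1}|lborel. \<bar>t\<bar> ^ m * (t ^ k * (1 - t\<^sup>2) ^ l) * cone_weight b g t)"

lemma has_bochner_integral_radial:
  fixes b g :: real
  assumes a: "b + (real m + 1) / 2 > 0" and g: "g > -1/2"
  shows "has_bochner_integral lborel
    (\<lambda>t. indicator {-1..1} t * (\<bar>t\<bar> ^ m * (t ^ k * (1 - t\<^sup>2) ^ l) * cone_weight b g t))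
    (if even k then Beta (b + (real m + 1) / 2 + k / 2) (g + 1/2 + l) else 0)"
proof -
  define a where "a = b + (real m + 1) / 2"
  have "has_bochner_integral lborel
    (\<lambda>t. indicator {-1..1} t * (\<bar>t\<bar> powr (2 * a - 1) * t ^ k * (1 - t\<^sup>2) powr (g + 1/2 + l - 1)))
    (if even k then Beta (a + k / 2) (g + 1/2 + l) else 0)"
    by (rule has_bochner_integral_power_Beta) (use assms in \<open>simp_all add: a_def add_pos_nonneg\<close>)
  moreover have "has_bochner_integral lborel
     (\<lambda>t. indicator {-1..1} t * (\<bar>t\<bar> powr (2 * a - 1) * t ^ k * (1 - t\<^sup>2) powr (g + 1/2 + l - 1))) x \<longleftrightarrow>
    has_bochner_integral lborel
     (\<lambda>t. indicator {-1..1} t * (\<bar>t\<bar> ^ m * (t ^ k * (1 - t\<^sup>2) ^ l) * cone_weight b g t)) x" for x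
  proof (rule has_bochner_integral_cong_AE)
    show "AE t in lborel. indicator {-1..1} t * (\<bar>t\<bar> powr (2 * a - 1) * t ^ k * (1 - t\<^sup>2) powr (g + 1/2 + l - 1)) =
       indicator {-1..1} t * (\<bar>t\<bar> ^ m * (t ^ k * (1 - t\<^sup>2) ^ l) * cone_weight b g t)"
      using AE_lborel_singleton[of 0] AE_lborel_singleton[of 1] AE_lborel_singleton[of "-1"]
    proof eventually_elim
      fix t :: real assume t: "t \<noteq> 0" "t \<noteq> 1" "t \<noteq> -1"
      show "indicator {-1..1} t * (\<bar>t\<bar> powr (2 * a - 1) * t ^ k * (1 - t\<^sup>2) powr (g + 1/2 + l - 1)) =
       indicator {-1..1} t * (\<bar>t\<bar> ^ m * (t ^ k * (1 - t\<^sup>2) ^ l) * cone_weight b g t)"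
      proof (cases "t \<in> {-1..1}")
        case True
        then have "\<bar>t\<bar> < 1" using t by auto
        then have s: "1 - t\<^sup>2 > 0" by (simp add: abs_square_less_1)
        have "2 * a - 1 = real m + 2 * b" by (simp add: a_def field_simps)
        then have 1: "\<bar>t\<bar> powr (2 * a - 1) = \<bar>t\<bar> ^ m * \<bar>t\<bar> powr (2 * b)"
          using t(1) by (simp add: powr_add powr_realpow)
        have "g + 1/2 + l - 1 = real l + (g - 1/2)" by simp
        then have 2: "(1 - t\<^sup>2) powr (g + 1/2 + l - 1) = (1 - t\<^sup>2) ^ l * (1 - t\<^sup>2) powr (g - 1/2)"
          using s by (simp only: powr_add) (simp add: powr_realpow)
        show ?thesis unfolding 1 2 cone_weight_def by simp
      qed simp
    qed
  qed (auto simp: cone_weight_def)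
  ultimately show ?thesis unfolding a_def[symmetric] by blast
qed

lemma radial_integral_eq:
  fixes b g :: real
  assumes "b + (real m + 1) / 2 > 0" "g > -1/2"
  shows "radial_integral b g m k l = (if even k then Beta (b + (real m + 1) / 2 + k / 2) (g + 1/2 + l) else 0)"
    "set_integrable lborel {-1..1} (\<lambda>t. \<bar>t\<bar> ^ m * (t ^ k * (1 - t\<^sup>2) ^ l) * cone_weight b g t)"
  using has_bochner_integral_radial[OF assms, of k l]
  by (simp_all add: radial_integral_def has_bochner_integral_iff set_lebesgue_integral_def set_integrable_def)

text \<open>\<open>cone_integral\<close> is an iterated integral, so its additivity needs
  integrability of both the inner and the outer integrand. Asking for the inner one at every
  \<open>t\<close> keeps null sets out of the argument.\<close>

definition cone_integrable :: "('n::finite cone_point \<Rightarrow> real) \<Rightarrow> bool" where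
  "cone_integrable f \<longleftrightarrow> (\<forall>t. integrable sphere_measure (\<lambda>u. f (\<bar>t\<bar> *\<^sub>R u, t))) \<and>
     set_integrable lborel {-1..1} (\<lambda>t. \<bar>t\<bar> ^ (CARD('n) - 1) * (LINT u|sphere_measure. f (\<bar>t\<bar> *\<^sub>R u, t)))"

lemma cone_integral_add:
  fixes f g :: "'n::finite cone_point \<Rightarrow> real"
  assumes "cone_integrable f" "cone_integrable g"
  shows "cone_integrable (\<lambda>z. f z + g z)" "cone_integral (\<lambda>z. f z + g z) = cone_integral f + cone_integral g"
  using assms unfolding cone_integrable_def cone_integral_def
  by (auto simp: distrib_left intro!: set_integral_add)

lemma cone_integral_cmult:
  fixes f :: "'n::finite cone_point \<Rightarrow> real"
  shows "cone_integral (\<lambda>z. c * f z) = c * cone_integral f"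
    and "cone_integrable f \<Longrightarrow> cone_integrable (\<lambda>z. c * f z)"
proof -
  have e: "\<bar>t\<bar> ^ (CARD('n) - 1) * (LINT u|sphere_measure. c * f (\<bar>t\<bar> *\<^sub>R u, t)) =
     c * (\<bar>t\<bar> ^ (CARD('n) - 1) * (LINT u|sphere_measure. f (\<bar>t\<bar> *\<^sub>R u, t)))" for t by simp
  show "cone_integral (\<lambda>z. c * f z) = c * cone_integral f"
    unfolding cone_integral_def e by simp
  show "cone_integrable f \<Longrightarrow> cone_integrable (\<lambda>z. c * f z)"
    unfolding cone_integrable_def e by auto
qed

lemma cone_integral_0: "cone_integrable (\<lambda>z. 0)" "cone_integral (\<lambda>z :: 'n::finite cone_point. 0) = 0"
  by (simp_all add: cone_integrable_def cone_integral_def set_integrable_def set_lebesgue_integral_def)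

lemma cone_integral_sum:
  fixes f :: "'i \<Rightarrow> 'n::finite cone_point \<Rightarrow> real"
  assumes "\<And>i. i \<in> I \<Longrightarrow> cone_integrable (f i)"
  shows "cone_integrable (\<lambda>z. \<Sum>i\<in>I. f i z) \<and> cone_integral (\<lambda>z. \<Sum>i\<in>I. f i z) = (\<Sum>i\<in>I. cone_integral (f i))"
  using assms by (induction I rule: infinite_finite_induct) (auto simp: cone_integral_0 cone_integral_add)

lemma AE_sphere_measure_cone:
  "AE u in (sphere_measure :: (real^'n::finite) measure). t \<in> {-1..1} \<longrightarrow> (\<bar>t\<bar> *\<^sub>R u, t) \<in> double_cone"
  using AE_sphere_measure by eventually_elim (auto simp: double_cone_def)

lemma cone_integral_product:
  fixes A :: "real^'n::finite \<Rightarrow> real"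
  assumes b: "b > -1/2" and g: "g > -1/2" and card: "CARD('n) \<ge> 2"
    and A: "continuous_on UNIV A" and hom: "\<And>c x. A (c *\<^sub>R x) = c ^ m * A x"
  shows "cone_integrable (\<lambda>(x, t). A x * (t ^ k * (1 - t\<^sup>2) ^ l) * cone_weight b g t)"
    and "cone_integral (\<lambda>(x, t). A x * (t ^ k * (1 - t\<^sup>2) ^ l) * cone_weight b g t) =
      (if even k then Beta (b + (CARD('n) + m + k) / 2) (g + 1/2 + l) else 0) * sphere_integral A"
proof -
  have i: "(LINT u|sphere_measure. A (\<bar>t\<bar> *\<^sub>R u) * (t ^ k * (1 - t\<^sup>2) ^ l) * cone_weight b g t) =
     \<bar>t\<bar> ^ m * (t ^ k * (1 - t\<^sup>2) ^ l) * cone_weight b g t * sphere_integral A" for t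
    unfolding hom sphere_integral_def by (simp add: mult_ac)
  have p: "\<bar>t\<bar> ^ (CARD('n) - 1) * (\<bar>t\<bar> ^ m * (t ^ k * (1 - t\<^sup>2) ^ l) * cone_weight b g t * sphere_integral A) =
     \<bar>t\<bar> ^ (CARD('n) - 1 + m) * (t ^ k * (1 - t\<^sup>2) ^ l) * cone_weight b g t * sphere_integral A" for t
    unfolding power_add by (simp only: mult_ac)
  have c: "real (CARD('n) - 1 + m) + 1 = real (CARD('n) + m)" using card by simp
  have "real CARD('n) \<ge> 2" using card by simp
  then have "(real CARD('n) + real m) / 2 \<ge> 1" by simp
  moreover have "b > - (1/2)" using b by simp
  ultimately have "b + (real CARD('n) + real m) / 2 > 0" by linarith
  then have pos: "b + (real (CARD('n) - 1 + m) + 1) / 2 > 0" unfolding c unfolding of_nat_add .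
  note r = radial_integral_eq[OF pos g, of k l]
  have e: "b + (real (CARD('n) - 1 + m) + 1) / 2 + k / 2 = b + (CARD('n) + m + k) / 2"
    unfolding c by (simp add: add_divide_distrib)
  show "cone_integrable (\<lambda>(x, t). A x * (t ^ k * (1 - t\<^sup>2) ^ l) * cone_weight b g t)"
    unfolding cone_integrable_def split i p
  proof (intro conjI allI)
    fix t :: real
    have "continuous_on UNIV (\<lambda>u. A (\<bar>t\<bar> *\<^sub>R u))"
      by (rule continuous_on_compose2[OF A]) (auto intro!: continuous_intros)
    then show "integrable sphere_measure (\<lambda>u. A (\<bar>t\<bar> *\<^sub>R u) * (t ^ k * (1 - t\<^sup>2) ^ l) * cone_weight b g t)"
      by (intro integrable_sphere_measure continuous_on_mult continuous_on_const)
  next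
    show "set_integrable lborel {-1..1}
       (\<lambda>t. \<bar>t\<bar> ^ (CARD('n) - 1 + m) * (t ^ k * (1 - t\<^sup>2) ^ l) * cone_weight b g t * sphere_integral A)"
      using r(2) by (rule set_integrable_mult_left)
  qed
  show "cone_integral (\<lambda>(x, t). A x * (t ^ k * (1 - t\<^sup>2) ^ l) * cone_weight b g t) =
      (if even k then Beta (b + (CARD('n) + m + k) / 2) (g + 1/2 + l) else 0) * sphere_integral A"
    unfolding cone_integral_def split i p using r(1)
    unfolding radial_integral_def e[symmetric] by simp
qed

section \<open>Polynomials of bounded degree on the cone\<close>

lemma polys_le_iff:
  "p \<in> polys_le n \<longleftrightarrow> (\<exists>c. p = (\<lambda>(x, t). \<Sum>(a, k) \<in> {(a, k). sum a UNIV + k \<le> n}. c a k * (monomial a x * t ^ k)))"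
  by (auto simp: polys_le_def monomial_def mult_ac fun_eq_iff)

lemma finite_exponents: "finite {(a :: 'n::finite \<Rightarrow> nat, k :: nat). sum a UNIV + k \<le> n}"
proof (rule finite_subset)
  show "{(a :: 'n \<Rightarrow> nat, k). sum a UNIV + k \<le> n} \<subseteq> (UNIV \<rightarrow>\<^sub>E {..n}) \<times> {..n}"
  proof
    fix z :: "('n \<Rightarrow> nat) \<times> nat" assume z: "z \<in> {(a, k). sum a UNIV + k \<le> n}"
    obtain a k where zz: "z = (a, k)" by (cases z)
    have "a i \<le> n" for i using member_le_sum[of i UNIV a] z zz by simp
    then show "z \<in> (UNIV \<rightarrow>\<^sub>E {..n}) \<times> {..n}"
      using z zz by (auto simp: PiE_def Pi_def extensional_def)
  qed
  show "finite ((UNIV \<rightarrow>\<^sub>E {..n}) \<times> {..n} :: (('n \<Rightarrow> nat) \<times> nat) set)"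
    by (intro finite_cartesian_product finite_PiE) auto
qed

lemma polys_le_add:
  assumes "p \<in> polys_le n" "q \<in> polys_le n"
  shows "(\<lambda>z. p z + q z) \<in> polys_le n"
proof -
  obtain c c' where "p = (\<lambda>(x, t). \<Sum>(a, k) \<in> {(a, k). sum a UNIV + k \<le> n}. c a k * (monomial a x * t ^ k))"
    "q = (\<lambda>(x, t). \<Sum>(a, k) \<in> {(a, k). sum a UNIV + k \<le> n}. c' a k * (monomial a x * t ^ k))"
    using assms unfolding polys_le_iff by blast
  then show ?thesis
    unfolding polys_le_iff
    by (intro exI[of _ "\<lambda>a k. c a k + c' a k"])
      (auto simp: fun_eq_iff sum.distrib[symmetric] distrib_right intro!: sum.cong)
qed

lemma polys_le_cmult:
  assumes "p \<in> polys_le n"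
  shows "(\<lambda>z. r * p z) \<in> polys_le n"
proof -
  obtain c where "p = (\<lambda>(x, t). \<Sum>(a, k) \<in> {(a, k). sum a UNIV + k \<le> n}. c a k * (monomial a x * t ^ k))"
    using assms unfolding polys_le_iff by blast
  then show ?thesis
    unfolding polys_le_iff
    by (intro exI[of _ "\<lambda>a k. r * c a k"])
      (auto simp: fun_eq_iff sum_distrib_left mult_ac intro!: sum.cong)
qed

lemma polys_le_monomial:
  fixes a :: "'n::finite \<Rightarrow> nat"
  assumes "sum a UNIV + k \<le> n"
  shows "(\<lambda>(x, t). monomial a x * t ^ k) \<in> polys_le n"
  unfolding polys_le_iff
proof (intro exI ext, clarify)
  fix x :: "real^'n" and t :: real
  have "(\<Sum>(a', k') \<in> {(a, k). sum a UNIV + k \<le> n}. (if (a', k') = (a, k) then 1 else 0) * (monomial a' x * t ^ k')) =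
     (\<Sum>z \<in> {(a, k). sum a UNIV + k \<le> n}. if z = (a, k) then monomial a x * t ^ k else 0)"
    by (intro sum.cong) (auto split: if_splits)
  also have "\<dots> = monomial a x * t ^ k"
    using assms by (simp add: finite_exponents)
  finally show "monomial a x * t ^ k = (\<Sum>(a', k') \<in> {(a, k). sum a UNIV + k \<le> n}. (if (a', k') = (a, k) then 1 else 0) * (monomial a' x * t ^ k'))" ..
qed

lemma polys_le_sum:
  assumes "\<And>i. i \<in> I \<Longrightarrow> f i \<in> polys_le n"
  shows "(\<lambda>z. \<Sum>i\<in>I. f i z) \<in> polys_le n"
proof -
  have "(\<lambda>z. 0) \<in> polys_le n"
    unfolding polys_le_iff by (intro exI[of _ "\<lambda>_ _. 0"]) auto
  then show ?thesis using assms
    by (induction I rule: infinite_finite_induct) (auto intro: polys_le_add)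
qed

lemma polys_le_induct [consumes 1, case_names monomial add]:
  assumes "p \<in> polys_le n"
    and "\<And>c a k. sum a UNIV + k \<le> n \<Longrightarrow> P (\<lambda>(x, t). c * (monomial a x * t ^ k))"
    and "\<And>p q. p \<in> polys_le n \<Longrightarrow> q \<in> polys_le n \<Longrightarrow> P p \<Longrightarrow> P q \<Longrightarrow> P (\<lambda>z. p z + q z)"
  shows "P (p :: 'n::finite cone_point \<Rightarrow> real)"
proof -
  define E where "E = {(a :: 'n \<Rightarrow> nat, k :: nat). sum a UNIV + k \<le> n}"
  obtain c where p: "p = (\<lambda>(x, t). \<Sum>(a, k) \<in> E. c a k * (monomial a x * t ^ k))"
    using assms(1) unfolding polys_le_iff E_def by blast
  have "P (\<lambda>z. \<Sum>(a, k) \<in> F. c a k * (monomial a (fst z) * snd z ^ k)) \<and>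
      (\<lambda>z. \<Sum>(a, k) \<in> F. c a k * (monomial a (fst z) * snd z ^ k)) \<in> polys_le n" if "finite F" "F \<subseteq> E" for F
    using that
  proof (induction F)
    case empty
    have "(\<lambda>z :: 'n cone_point. 0) = (\<lambda>(x, t). 0 * (monomial (\<lambda>_. 0) x * t ^ 0))" by auto
    moreover have "P (\<lambda>(x, t). 0 * (monomial (\<lambda>_. 0) x * t ^ 0))" by (rule assms(2)) simp
    moreover have "(\<lambda>z :: 'n cone_point. 0) \<in> polys_le n"
      unfolding polys_le_iff by (intro exI[of _ "\<lambda>_ _. 0"]) auto
    ultimately show ?case by simp
  next
    case (insert z F)
    obtain a k where z: "z = (a, k)" by (cases z)
    have ak: "sum a UNIV + k \<le> n" using insert.prems z by (simp add: E_def)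
    have 1: "P (\<lambda>z. c a k * (monomial a (fst z) * snd z ^ k))"
      using assms(2)[OF ak, of "c a k"] by (simp add: case_prod_unfold)
    have 2: "(\<lambda>z. c a k * (monomial a (fst z) * snd z ^ k)) \<in> polys_le n"
      using polys_le_cmult[OF polys_le_monomial[OF ak], of "c a k"] by (simp add: case_prod_unfold)
    show ?case
      using assms(3)[OF 2 _ 1] polys_le_add[OF 2] insert unfolding z by simp
  qed
  from this[of E] show ?thesis
    using finite_exponents[where 'n = 'n and n = n] unfolding p E_def by (simp add: case_prod_unfold)
qed

lemma monomial_mult: "monomial a x * monomial b x = monomial (\<lambda>i. a i + b i) x"
  by (simp add: monomial_def power_add prod.distrib)

lemma polys_le_mult:
  fixes p q :: "'n::finite cone_point \<Rightarrow> real"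
  assumes "p \<in> polys_le m" "q \<in> polys_le n"
  shows "(\<lambda>z. p z * q z) \<in> polys_le (m + n)"
  using assms(1)
proof (induction rule: polys_le_induct)
  case (monomial c a k)
  show ?case
    using assms(2)
  proof (induction rule: polys_le_induct)
    case (monomial c' b j)
    have "(\<lambda>(x, t). monomial (\<lambda>i. a i + b i) x * t ^ (k + j)) \<in> polys_le (m + n)"
      using monomial \<open>sum a UNIV + k \<le> m\<close> by (intro polys_le_monomial) (simp add: sum.distrib)
    from polys_le_cmult[OF this, of "c * c'"] show ?case
      by (simp add: case_prod_unfold power_add mult_ac flip: monomial_mult)
  next
    case (add p q)
    from polys_le_add[OF add.IH] show ?case by (simp add: distrib_left)
  qed
next
  case (add p q)
  from polys_le_add[OF add.IH] show ?case by (simp add: distrib_right)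
qed

lemma polys_le_mono:
  assumes "p \<in> polys_le m" "m \<le> n"
  shows "p \<in> polys_le n"
  using assms(1)
proof (induction rule: polys_le_induct)
  case (monomial c a k)
  then have "(\<lambda>(x, t). monomial a x * t ^ k) \<in> polys_le n" using assms(2) by (intro polys_le_monomial) simp
  from polys_le_cmult[OF this, of c] show ?case by (simp add: case_prod_unfold)
qed (rule polys_le_add)

lemma polys_le_const: "(\<lambda>_. c) \<in> polys_le n"
  using polys_le_cmult[OF polys_le_monomial[of "\<lambda>_. 0" 0 n], of c] by (simp add: monomial_def case_prod_unfold)

lemma polys_le_power: "p \<in> polys_le m \<Longrightarrow> (\<lambda>z. p z ^ k) \<in> polys_le (m * k)"
proof (induction k)
  case 0
  show ?case using polys_le_const[of 1 0] by simp
next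
  case (Suc k)
  from polys_le_mult[OF Suc.prems Suc.IH[OF Suc.prems]] show ?case by simp
qed

lemma polys_le_snd: "(\<lambda>z. snd z) \<in> polys_le 1"
  using polys_le_monomial[of "\<lambda>_. 0" 1 1] by (simp add: monomial_def case_prod_unfold)

lemma polys_le_inner:
  fixes y :: "real^'n::finite"
  shows "(\<lambda>z. fst z \<bullet> y) \<in> polys_le 1"
proof -
  have e: "fst z \<bullet> y = (\<Sum>i\<in>UNIV. y $ i * (monomial ((\<lambda>_. 0)(i := 1)) (fst z) * snd z ^ 0))" for z :: "'n cone_point"
  proof -
    have "monomial ((\<lambda>_. 0)(i := 1)) (fst z) = fst z $ i" for i
      using monomial_fun_upd_Suc[of "\<lambda>_. 0" i "fst z"] by (simp add: monomial_def)
    then show ?thesis by (simp add: inner_vec_def mult.commute)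
  qed
  show ?thesis
    unfolding e
  proof (intro polys_le_sum polys_le_cmult)
    fix i :: 'n
    have "sum ((\<lambda>_. 0)(i := 1)) UNIV + 0 \<le> (1::nat)"
      using sum_fun_upd_Suc[of "\<lambda>_. 0" i] by simp
    from polys_le_monomial[OF this] show "(\<lambda>z. monomial ((\<lambda>_. 0)(i := 1)) (fst z) * snd z ^ 0) \<in> polys_le 1"
      by (simp add: case_prod_unfold)
  qed
qed

lemma polys_le_kernel_factors:
  "(\<lambda>z :: 'n::finite cone_point. (fst z \<bullet> y) ^ i * (snd z ^ j * (1 - (snd z)\<^sup>2) ^ l)) \<in> polys_le (i + (j + 2 * l))"
proof -
  have "(\<lambda>z :: 'n cone_point. 1 + (-1) * (snd z)\<^sup>2) \<in> polys_le 2"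
    using polys_le_power[OF polys_le_snd, of 2] by (intro polys_le_add polys_le_const polys_le_cmult) simp
  from polys_le_power[OF this, of l] show ?thesis
    using polys_le_power[OF polys_le_inner[of y], of i] polys_le_power[OF polys_le_snd, of j]
    by (intro polys_le_mult) simp_all
qed

subsection \<open>The even kernel as a polynomial\<close>

definition cone_expect :: "real \<Rightarrow> real \<Rightarrow> ('n::finite cone_point \<Rightarrow> real) \<Rightarrow> real" where
  "cone_expect b g f = cone_integral (\<lambda>(x, t). f (x, t) * cone_weight b g t)
     / cone_integral (\<lambda>(x :: real^'n, t). cone_weight b g t)"

lemma cone_inner_eq: "cone_inner b g p q = cone_expect b g (\<lambda>z. p z * q z)"
  by (simp add: cone_inner_def cone_expect_def)

lemma Beta_shift:
  fixes x y :: real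
  assumes "x > 0" "y > 0"
  shows "Beta (x + real k) (y + real l) = Beta x y * (pochhammer x k * pochhammer y l / pochhammer (x + y) (k + l))"
proof -
  have s: "x + real k + (y + real l) = (x + y) + real (k + l)" by simp
  have "Gamma (x + real k + (y + real l)) = pochhammer (x + y) (k + l) * Gamma (x + y)"
    unfolding s using assms by (intro Gamma_add_of_nat) simp
  then show ?thesis
    using assms by (simp add: Beta_def Gamma_add_of_nat mult_ac)
qed

lemma Beta_real_pos: "x > 0 \<Longrightarrow> y > 0 \<Longrightarrow> Beta x y > (0 :: real)"
  by (simp add: Beta_def Gamma_real_pos)

locale cone_parameters =
  fixes b g :: real and n_type :: "'n::finite itself"
  assumes b: "b > -1/2" and g: "g > -1/2" and card: "CARD('n) \<ge> 2"
begin

lemma card_ge_2: "real CARD('n) \<ge> 2"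
  using card by simp

lemma cone_integral_weight:
  "cone_integral (\<lambda>(x :: real^'n, t). cone_weight b g t) =
     Beta (b + CARD('n) / 2) (g + 1/2) * sphere_integral (\<lambda>_ :: real^'n. 1)"
  using cone_integral_product(2)[OF b g card, of "\<lambda>_. 1" 0 0 0] by simp

lemma cone_integrable_polys:
  fixes p :: "'n cone_point \<Rightarrow> real"
  assumes "p \<in> polys_le m"
  shows "cone_integrable (\<lambda>(x, t). p (x, t) * cone_weight b g t)"
  using assms
proof (induction rule: polys_le_induct)
  case (monomial c a k)
  have "cone_integrable (\<lambda>(x, t). monomial a x * (t ^ k * (1 - t\<^sup>2) ^ 0) * cone_weight b g t)"
    by (rule cone_integral_product(1)[OF b g card continuous_on_monomial monomial_scaleR])
  from cone_integral_cmult(2)[OF this, of c] show ?case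
    by (simp add: case_prod_unfold mult.assoc)
next
  case (add p q)
  from cone_integral_add(1)[OF add.IH] show ?case
    by (simp add: case_prod_unfold distrib_right)
qed

lemma cone_expect_add:
  fixes p q :: "'n cone_point \<Rightarrow> real"
  assumes "p \<in> polys_le m" "q \<in> polys_le n"
  shows "cone_expect b g (\<lambda>z. p z + q z) = cone_expect b g p + cone_expect b g q"
  using cone_integral_add(2)[OF assms[THEN cone_integrable_polys]]
  by (simp add: cone_expect_def case_prod_unfold distrib_right add_divide_distrib)

lemma cone_expect_cmult:
  fixes p :: "'n cone_point \<Rightarrow> real"
  shows "cone_expect b g (\<lambda>z. c * p z) = c * cone_expect b g p"
  using cone_integral_cmult(1)[of c "\<lambda>(x, t). p (x, t) * cone_weight b g t"]
  by (simp add: cone_expect_def case_prod_unfold mult.assoc)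

lemma cone_expect_sum:
  fixes p :: "'i \<Rightarrow> 'n cone_point \<Rightarrow> real"
  assumes "\<And>i. i \<in> I \<Longrightarrow> p i \<in> polys_le m"
  shows "cone_expect b g (\<lambda>z. \<Sum>i\<in>I. p i z) = (\<Sum>i\<in>I. cone_expect b g (p i))"
  using cone_integral_sum[of I "\<lambda>i (x, t). p i (x, t) * cone_weight b g t"] cone_integrable_polys[OF assms]
  by (simp add: cone_expect_def case_prod_unfold sum_distrib_right sum_divide_distrib)

definition al :: real where "al = b + (real CARD('n) - 1) / 2"

lemma al_simps: "al + 1/2 = b + CARD('n) / 2" "al - 1/2 = CARD('n) / 2 - 1 + b"
  by (simp_all add: al_def field_simps)

lemma al_bounds: "al > -1/2" "al + g > -1/2" "al + 1/2 > 0" "g + 1/2 > 0"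
  using b g card_ge_2 by (simp_all add: al_def field_simps)

text \<open>Homogeneity moves the radius out of the sphere integral. The third case serves odd
  \<open>m\<close>: the power of \<open>\<bar>t\<bar>\<close> is then not covered by
  \<open>radial_moment\<close>, but in the application the sphere integral vanishes.\<close>

lemma cone_expect_product:
  fixes A :: "real^'n \<Rightarrow> real"
  assumes A: "continuous_on UNIV A" and hom: "\<And>c x. A (c *\<^sub>R x) = c ^ m * A x"
  shows "odd k \<Longrightarrow> cone_expect b g (\<lambda>(x, t). A x * (t ^ k * (1 - t\<^sup>2) ^ l)) = 0"
    and "even k \<Longrightarrow> even m \<Longrightarrow> cone_expect b g (\<lambda>(x, t). A x * (t ^ k * (1 - t\<^sup>2) ^ l)) =
       radial_moment al g ((m + k) div 2) l * (sphere_integral A / sphere_integral (\<lambda>_ :: real^'n. 1))"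
    and "sphere_integral A = 0 \<Longrightarrow> cone_expect b g (\<lambda>(x, t). A x * (t ^ k * (1 - t\<^sup>2) ^ l)) = 0"
proof -
  have e: "cone_expect b g (\<lambda>(x, t). A x * (t ^ k * (1 - t\<^sup>2) ^ l)) =
     (if even k then Beta (b + (CARD('n) + m + k) / 2) (g + 1/2 + l) else 0) * sphere_integral A
      / (Beta (b + CARD('n) / 2) (g + 1/2) * sphere_integral (\<lambda>_ :: real^'n. 1))"
    using cone_integral_product(2)[OF b g card A hom, of k l]
    by (simp add: cone_expect_def cone_integral_weight)
  show "odd k \<Longrightarrow> cone_expect b g (\<lambda>(x, t). A x * (t ^ k * (1 - t\<^sup>2) ^ l)) = 0"
    "sphere_integral A = 0 \<Longrightarrow> cone_expect b g (\<lambda>(x, t). A x * (t ^ k * (1 - t\<^sup>2) ^ l)) = 0"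
    unfolding e by simp_all
  assume ev: "even k" "even m"
  then obtain j where j: "m + k = 2 * j" by (metis dvd_add evenE)
  have "b + (CARD('n) + m + k) / 2 = (al + 1/2) + real j"
  proof -
    have "real (CARD('n) + m + k) = CARD('n) + real (m + k)" by simp
    then show ?thesis unfolding j al_simps by (simp add: field_simps)
  qed
  moreover have "Beta (al + 1/2 + real j) (g + 1/2 + real l) = Beta (al + 1/2) (g + 1/2) *
     (pochhammer (al + 1/2) j * pochhammer (g + 1/2) l / pochhammer (al + 1/2 + (g + 1/2)) (j + l))"
    by (rule Beta_shift) (use al_bounds in auto)
  moreover have "al + 1/2 + (g + 1/2) = al + g + 1" by simp
  moreover have "Beta (al + 1/2) (g + 1/2) \<noteq> 0"
    using Beta_real_pos[OF al_bounds(3,4)] by simp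
  moreover have "(m + k) div 2 = j" using j by simp
  ultimately show "cone_expect b g (\<lambda>(x, t). A x * (t ^ k * (1 - t\<^sup>2) ^ l)) =
       radial_moment al g ((m + k) div 2) l * (sphere_integral A / sphere_integral (\<lambda>_ :: real^'n. 1))"
    unfolding e al_simps(1)[symmetric] radial_moment_def using ev(1) by (simp only: if_True) simp
qed

end

lemma gegen_functional_parity_0:
  assumes "has_parity h q" "odd (h + N)"
  shows "gegen_functional l (q * monom 1 N) = 0"
proof -
  have z: "coeff q i * gegen_moment l (i + N) = 0" for i
  proof (cases "coeff q i = 0")
    case False
    then have "odd (i + N)" using assms by (auto simp: has_parity_def)
    then show ?thesis by (simp add: gegen_moment_def gauss_moment_def)
  qed simp
  show ?thesis
    unfolding moment_functional_shift unfolding moment_functional_def z by simp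
qed

text \<open>Coefficient in the expansion of (h X + (1 - h) z2 Y + v V)^N with h = (1 - z1)/2: two
  binomial coefficients times the moments of \<open>h\<close>, \<open>z2\<close> and
  \<open>v\<close>.\<close>

definition kernel_coeff :: "real \<Rightarrow> real \<Rightarrow> real \<Rightarrow> nat \<Rightarrow> nat \<Rightarrow> nat \<Rightarrow> real" where
  "kernel_coeff d b g N p i = real (N choose p) * real (p choose i) * coupling_moment (d / 2) b i (p - i) *
     gegen_moment b (p - i) * gegen_moment (g - 1/2) (N - p)"

lemma kernel_coeff_odd: "odd (p - i) \<or> odd (N - p) \<Longrightarrow> kernel_coeff d b g N p i = 0"
  by (auto simp: kernel_coeff_def gegen_moment_def gauss_moment_def)

text \<open>The \<open>N\<close>-th moment of \<open>\<xi>\<close> over \<open>z\<close> and \<open>v\<close>, expanded by the binomial theorem. Only even exponents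
  \<open>p - i\<close> and \<open>N - p\<close> contribute, hence no square roots are left. The sign of \<open>s t\<close> is dropped.\<close>

definition even_kernel_moment :: "real \<Rightarrow> real \<Rightarrow> 'n::finite cone_point \<Rightarrow> 'n cone_point \<Rightarrow> nat \<Rightarrow> real" where
  "even_kernel_moment b g z w N = (\<Sum>p\<le>N. \<Sum>i\<le>p. kernel_coeff CARD('n) b g N p i *
     (fst z \<bullet> fst w) ^ i * (snd z * snd w) ^ (p - i) * ((1 - (snd z)\<^sup>2) * (1 - (snd w)\<^sup>2)) ^ ((N - p) div 2))"

definition even_kernel_poly :: "nat \<Rightarrow> real \<Rightarrow> real \<Rightarrow> 'n::finite cone_point \<Rightarrow> 'n cone_point \<Rightarrow> real" where
  "even_kernel_poly n b g z w =
     moment_functional (even_kernel_moment b g z w) (zonal_poly n (b + (real CARD('n) - 1) / 2 + g))"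

lemma even_kernel_moment_polys_le:
  fixes w :: "'n::finite cone_point"
  shows "(\<lambda>z. even_kernel_moment b g z w N) \<in> polys_le N"
  unfolding even_kernel_moment_def
proof (intro polys_le_sum)
  fix p i assume pi: "p \<in> {..N}" "i \<in> {..p}"
  define C where "C = kernel_coeff CARD('n) b g N p i *
     snd w ^ (p - i) * (1 - (snd w)\<^sup>2) ^ ((N - p) div 2)"
  have "(\<lambda>z. C * ((fst z \<bullet> fst w) ^ i * (snd z ^ (p - i) * (1 - (snd z)\<^sup>2) ^ ((N - p) div 2))))
     \<in> polys_le (i + ((p - i) + 2 * ((N - p) div 2)))"
    by (intro polys_le_cmult polys_le_kernel_factors)
  moreover have "i + ((p - i) + 2 * ((N - p) div 2)) \<le> N" using pi by simp
  ultimately have "(\<lambda>z. C * ((fst z \<bullet> fst w) ^ i * (snd z ^ (p - i) * (1 - (snd z)\<^sup>2) ^ ((N - p) div 2)))) \<in> polys_le N"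
    by (rule polys_le_mono)
  then show "(\<lambda>z. kernel_coeff CARD('n) b g N p i *
     (fst z \<bullet> fst w) ^ i * (snd z * snd w) ^ (p - i) * ((1 - (snd z)\<^sup>2) * (1 - (snd w)\<^sup>2)) ^ ((N - p) div 2)) \<in> polys_le N"
    by (simp add: C_def power_mult_distrib mult_ac)
qed

lemma even_kernel_poly_polys_le: "(\<lambda>z. even_kernel_poly n b g z w) \<in> polys_le n"
  unfolding even_kernel_poly_def moment_functional_def
  using degree_zonal_poly_le
  by (intro polys_le_sum polys_le_cmult polys_le_mono[OF even_kernel_moment_polys_le]) (auto intro: order_trans)

lemma even_kernel_moment_even:
  fixes w :: "'n::finite cone_point"
  shows "even_kernel_moment b g (x, - t) w N = even_kernel_moment b g (x, t) w N"
  unfolding even_kernel_moment_def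
proof (intro sum.cong refl)
  fix p i
  show "kernel_coeff CARD('n) b g N p i *
     (fst (x, - t) \<bullet> fst w) ^ i * (snd (x, - t) * snd w) ^ (p - i) * ((1 - (snd (x, - t))\<^sup>2) * (1 - (snd w)\<^sup>2)) ^ ((N - p) div 2)
     = kernel_coeff CARD('n) b g N p i *
     (fst (x, t) \<bullet> fst w) ^ i * (snd (x, t) * snd w) ^ (p - i) * ((1 - (snd (x, t))\<^sup>2) * (1 - (snd w)\<^sup>2)) ^ ((N - p) div 2)"
    by (cases "even (p - i)") (simp_all add: kernel_coeff_odd)
qed

lemma even_kernel_poly_even: "even_kernel_poly n b g (x, - t) w = even_kernel_poly n b g (x, t) w"
  by (simp add: even_kernel_poly_def moment_functional_def even_kernel_moment_even)

context cone_parameters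
begin

text \<open>The three conditional expectations are composed: \<open>qa\<close> results from the
  sphere, \<open>qc\<close> from feeding each power in \<open>qa\<close> through the coupling in
  \<open>z\<close>, and \<open>r\<close> from feeding each power in \<open>qc\<close> through the
  radial step. The values at 1 combine to the value of the monomial at \<open>w\<close>.\<close>

lemma cone_expect_even_kernel_moment:
  fixes a :: "'n \<Rightarrow> nat" and w :: "'n cone_point"
  assumes w: "w \<in> double_cone" and k: "even k"
  shows "\<exists>r. degree r \<le> sum a UNIV + k \<and> poly r 1 = monomial a (fst w) * snd w ^ k \<and>
     (\<forall>N. cone_expect b g (\<lambda>z. monomial a (fst z) * snd z ^ k * even_kernel_moment b g z w N) =
        gegen_functional (al + g) (r * monom 1 N))"
proof -
  obtain y s where ys: "w = (y, s)" by (cases w)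
  define \<rho> \<kappa> where "\<rho> = \<bar>s\<bar>" and "\<kappa> = sqrt (1 - s\<^sup>2)"
  have s1: "\<bar>s\<bar> \<le> 1" "norm y = \<rho>" using w by (auto simp: ys double_cone_def \<rho>_def)
  then have s2: "s\<^sup>2 \<le> 1" by (simp add: abs_square_le_1)
  have rk: "\<rho>\<^sup>2 + \<kappa>\<^sup>2 = 1" using s2 by (simp add: \<rho>_def \<kappa>_def)
  \<comment> \<open>At the apex the direction is arbitrary, since the factor
    \<open>\<rho> = 0\<close> removes it.\<close>
  obtain \<omega> :: "real^'n" where \<omega>: "norm \<omega> = 1" "y = \<rho> *\<^sub>R \<omega>"
  proof (cases "y = 0")
    case True
    obtain e :: "real^'n" where "norm e = 1" using vector_choose_size[of 1] by auto
    then show ?thesis using that[of e] True s1(2) by simp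
  next
    case False
    then have "norm (y /\<^sub>R norm y) = 1" "y = norm y *\<^sub>R (y /\<^sub>R norm y)" by simp_all
    then show ?thesis using that[of "y /\<^sub>R norm y"] unfolding s1(2) by blast
  qed
  define lam where "lam = CARD('n) / 2 - (1 :: real)"
  have lam: "lam + 1 = CARD('n) / 2" "lam > -1" "lam + b > -1/2" "al - 1/2 = lam + b"
    using b card_ge_2 by (simp_all add: lam_def al_simps(2))
  define h where "h = sum a UNIV"
  obtain qa where qa: "degree qa \<le> h" "has_parity h qa" "poly qa 1 = monomial a \<omega>"
    "\<And>N. sphere_integral (\<lambda>u. monomial a u * (u \<bullet> \<omega>) ^ N) =
       sphere_integral (\<lambda>_ :: real^'n. 1) * gegen_functional lam (qa * monom 1 N)"
    using sphere_conditional_expectation[OF \<omega>(1) card, of a] unfolding h_def lam_def by blast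
  have "\<forall>j. \<exists>q. degree q \<le> j \<and> has_parity j q \<and> poly q 1 = 1 \<and>
    (\<forall>p. (\<Sum>i\<le>p. real (p choose i) * coupling_moment (lam + 1) b i (p - i) * gegen_moment b (p - i) * gegen_moment lam (i + j))
       = gegen_functional (lam + b) (q * monom 1 p))"
    using coupling_conditional_expectation[OF lam(2,3), of _] b by auto
  then obtain Q where Q: "\<And>j. degree (Q j) \<le> j" "\<And>j. has_parity j (Q j)" "\<And>j. poly (Q j) 1 = 1"
    "\<And>j p. (\<Sum>i\<le>p. real (p choose i) * coupling_moment (lam + 1) b i (p - i) * gegen_moment b (p - i) * gegen_moment lam (i + j))
       = gegen_functional (lam + b) (Q j * monom 1 p)" by metis
  define qc where "qc = (\<Sum>j\<le>h. smult (coeff qa j) (Q j))"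
  have qc_deg: "degree qc \<le> h"
    unfolding qc_def by (intro degree_sum_le order_trans[OF degree_smult_le] order_trans[OF Q(1)]) auto
  have qc_par: "has_parity h qc"
    unfolding qc_def
  proof (intro has_parity_sum)
    fix j
    show "has_parity h (smult (coeff qa j) (Q j))"
    proof (cases "coeff qa j = 0")
      case False
      then have "even (j + h)" using qa(2) by (auto simp: has_parity_def)
      from has_parity_cong[OF this] show ?thesis using Q(2) by (auto intro: has_parity_smult)
    qed simp
  qed
  have qc_1: "poly qc 1 = monomial a \<omega>"
  proof -
    have "poly qa 1 = (\<Sum>j\<le>h. coeff qa j)"
      using qa(1) unfolding poly_altdef by (auto intro!: sum.mono_neutral_left intro: le_degree)
    then show ?thesis unfolding qc_def poly_sum using qa(3) Q(3) by simp
  qed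
  have couple: "(\<Sum>i\<le>p. real (p choose i) * coupling_moment (CARD('n) / 2) b i (p - i) * gegen_moment b (p - i) *
      gegen_functional lam (qa * monom 1 i)) = gegen_functional (lam + b) (qc * monom 1 p)" for p
  proof -
    have "gegen_functional lam (qa * monom 1 i) = (\<Sum>j\<le>h. coeff qa j * gegen_moment lam (i + j))" for i
      unfolding moment_functional_shift moment_functional_eq[OF qa(1)] by (simp add: add.commute)
    then have "(\<Sum>i\<le>p. real (p choose i) * coupling_moment (CARD('n) / 2) b i (p - i) * gegen_moment b (p - i) *
      gegen_functional lam (qa * monom 1 i)) =
      (\<Sum>i\<le>p. \<Sum>j\<le>h. coeff qa j * (real (p choose i) * coupling_moment (lam + 1) b i (p - i) * gegen_moment b (p - i) * gegen_moment lam (i + j)))"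
      unfolding lam(1) by (simp add: sum_distrib_left sum_distrib_right mult_ac)
    also have "\<dots> = (\<Sum>j\<le>h. coeff qa j * gegen_functional (lam + b) (Q j * monom 1 p))"
      unfolding Q(4)[symmetric] sum_distrib_left by (rule sum.swap)
    also have "\<dots> = gegen_functional (lam + b) (qc * monom 1 p)"
      by (simp add: qc_def sum_distrib_right moment_functional_sum moment_functional_smult)
    finally show ?thesis .
  qed
  define G where "G = h + k"
  define Rm where "Rm N p = radial_moment al g ((p + G) div 2) ((N - p) div 2)" for N p
  define Y where "Y N e = (\<Sum>p\<le>N. real (N choose p) * (\<rho> ^ p * \<kappa> ^ (N - p) *
      gegen_moment (g - 1/2) (N - p) * Rm N p * gegen_moment (al - 1/2) (p + e)))" for N e
  \<comment> \<open>The radial step needs \<open>e\<close> and \<open>G\<close> to differ by an even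
    number. This holds for the exponents that occur in \<open>qc\<close>, so the choice of
    \<open>R e\<close> is restricted to these.\<close>
  have "\<exists>q. degree q \<le> G \<and> poly q 1 = \<rho> ^ G \<and> (\<forall>N. Y N e
    = gegen_functional (al + g) (q * monom 1 N))" if "coeff qc e \<noteq> 0" for e
  proof -
    have "e \<le> h" using that qc_deg le_degree by (metis le_trans)
    moreover have "even (e + h)" using that qc_par by (auto simp: has_parity_def)
    ultimately have "G = e + 2 * ((h - e) div 2 + k div 2)" using k by (simp add: G_def)
    from radial_conditional_expectation[OF al_bounds(1) g al_bounds(2) rk this] show ?thesis
      unfolding Y_def Rm_def .
  qed
  then have "\<forall>e. \<exists>q. coeff qc e \<noteq> 0 \<longrightarrow> degree q \<le> G \<and> poly q 1 = \<rho> ^ G \<and> (\<forall>N. Y N e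
    = gegen_functional (al + g) (q * monom 1 N))" by blast
  from choice[OF this] obtain R where R': "\<forall>e. coeff qc e \<noteq> 0 \<longrightarrow> degree (R e) \<le> G \<and> poly (R e) 1 = \<rho> ^ G \<and> (\<forall>N. Y N e
    = gegen_functional (al + g) (R e * monom 1 N))" by (elim exE)
  note R = R'[rule_format, THEN conjunct1] R'[rule_format, THEN conjunct2, THEN conjunct1]
    R'[rule_format, THEN conjunct2, THEN conjunct2, rule_format]
  define r where "r = (\<Sum>e\<le>h. smult (coeff qc e) (R e))"
  have r_deg: "degree r \<le> G"
    unfolding r_def
  proof (intro degree_sum_le)
    fix e
    show "degree (smult (coeff qc e) (R e)) \<le> G" using R(1)[of e] by (cases "coeff qc e = 0") auto
  qed simp
  have r_1: "poly r 1 = monomial a y * s ^ k"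
  proof -
    have "poly r 1 = (\<Sum>e\<le>h. coeff qc e * \<rho> ^ G)"
      unfolding r_def poly_sum
    proof (intro sum.cong refl)
      fix e
      show "poly (smult (coeff qc e) (R e)) 1 = coeff qc e * \<rho> ^ G" using R(2)[of e] by (cases "coeff qc e = 0") auto
    qed
    also have "\<dots> = poly qc 1 * \<rho> ^ G"
    proof -
      have "poly qc 1 = (\<Sum>e\<le>h. coeff qc e)"
        using qc_deg unfolding poly_altdef by (auto intro!: sum.mono_neutral_left intro: le_degree)
      then show ?thesis by (simp add: sum_distrib_right)
    qed
    also have "\<dots> = monomial a y * s ^ k"
      unfolding qc_1 \<omega>(2) monomial_scaleR using k by (simp add: G_def h_def power_add \<rho>_def power_even_abs)
    finally show ?thesis .
  qed
  have main: "cone_expect b g (\<lambda>z. monomial a (fst z) * snd z ^ k * even_kernel_moment b g z w N) =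
        gegen_functional (al + g) (r * monom 1 N)" for N
  proof -
    define C where "C p i = kernel_coeff CARD('n) b g N p i *
     s ^ (p - i) * (1 - s\<^sup>2) ^ ((N - p) div 2)" for p i
    define T where "T p i = (\<lambda>(x :: real^'n, t :: real). (monomial a x * (x \<bullet> y) ^ i) * (t ^ (k + (p - i)) * (1 - t\<^sup>2) ^ ((N - p) div 2)))" for p i
    have Tp: "T p i \<in> polys_le (h + i + (k + (p - i)) + 2 * ((N - p) div 2))" for p i
    proof -
      have "(\<lambda>z. monomial a (fst z)) \<in> polys_le h"
        using polys_le_monomial[of a 0 h] by (simp add: h_def case_prod_unfold)
      from polys_le_mult[OF this polys_le_kernel_factors[of y i "k + (p - i)" "(N - p) div 2"]] show ?thesis
        by (simp add: T_def case_prod_unfold add_ac mult_ac)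
    qed
    have "(\<lambda>z. monomial a (fst z) * snd z ^ k * even_kernel_moment b g z w N) = (\<lambda>z. \<Sum>p\<le>N. \<Sum>i\<le>p. C p i * T p i z)"
    proof
      fix z :: "'n cone_point"
      have Tz: "T p i z = (monomial a (fst z) * (fst z \<bullet> y) ^ i) * (snd z ^ k * snd z ^ (p - i) * (1 - (snd z)\<^sup>2) ^ ((N - p) div 2))" for p i
        by (simp add: T_def case_prod_unfold power_add)
      show "monomial a (fst z) * snd z ^ k * even_kernel_moment b g z w N = (\<Sum>p\<le>N. \<Sum>i\<le>p. C p i * T p i z)"
        unfolding even_kernel_moment_def sum_distrib_left Tz C_def ys
        by (intro sum.cong refl) (simp add: power_mult_distrib mult_ac)
    qed
    then have "cone_expect b g (\<lambda>z. monomial a (fst z) * snd z ^ k * even_kernel_moment b g z w N) =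
       cone_expect b g (\<lambda>z. \<Sum>p\<le>N. \<Sum>i\<le>p. C p i * T p i z)" by (simp only:)
    also have "\<dots> = (\<Sum>p\<le>N. cone_expect b g (\<lambda>z. \<Sum>i\<le>p. C p i * T p i z))"
    proof (rule cone_expect_sum[where m = "h + N + k + N + N"])
      fix p assume "p \<in> {..N}"
      then show "(\<lambda>z. \<Sum>i\<le>p. C p i * T p i z) \<in> polys_le (h + N + k + N + N)"
        by (intro polys_le_sum polys_le_cmult polys_le_mono[OF Tp]) auto
    qed
    also have "\<dots> = (\<Sum>p\<le>N. \<Sum>i\<le>p. C p i * cone_expect b g (T p i))"
    proof (intro sum.cong refl)
      fix p assume "p \<in> {..N}"
      have "cone_expect b g (\<lambda>z. \<Sum>i\<le>p. C p i * T p i z) = (\<Sum>i\<le>p. cone_expect b g (\<lambda>z. C p i * T p i z))"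
        using \<open>p \<in> {..N}\<close>
        by (intro cone_expect_sum[where m = "h + N + k + N + N"] polys_le_cmult polys_le_mono[OF Tp]) auto
      then show "cone_expect b g (\<lambda>z. \<Sum>i\<le>p. C p i * T p i z) = (\<Sum>i\<le>p. C p i * cone_expect b g (T p i))"
        by (simp add: cone_expect_cmult)
    qed
    also have "\<dots> = (\<Sum>p\<le>N. \<Sum>i\<le>p. real (N choose p) * (\<rho> ^ p * \<kappa> ^ (N - p) * gegen_moment (g - 1/2) (N - p) * Rm N p) *
       (real (p choose i) * coupling_moment (CARD('n) / 2) b i (p - i) * gegen_moment b (p - i) *
      gegen_functional lam (qa * monom 1 i)))"
    proof (intro sum.cong refl)
      fix p i assume pi: "p \<in> {..N}" "i \<in> {..p}"
      show "C p i * cone_expect b g (T p i) = real (N choose p) * (\<rho> ^ p * \<kappa> ^ (N - p) * gegen_moment (g - 1/2) (N - p) * Rm N p) *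
       (real (p choose i) * coupling_moment (CARD('n) / 2) b i (p - i) * gegen_moment b (p - i) *
      gegen_functional lam (qa * monom 1 i))"
      proof (cases "odd (p - i) \<or> odd (N - p)")
        case True
        then show ?thesis by (auto simp: C_def kernel_coeff_odd gegen_moment_def gauss_moment_def)
      next
        case False
        have Ti: "T p i = (\<lambda>(x, t). (\<lambda>x. monomial a x * (x \<bullet> y) ^ i) x * (t ^ (k + (p - i)) * (1 - t\<^sup>2) ^ ((N - p) div 2)))"
          by (simp add: T_def)
        have cont: "continuous_on UNIV (\<lambda>x. monomial a x * (x \<bullet> y) ^ i)" by (intro continuous_intros)
        have hom: "monomial a (c *\<^sub>R x) * (c *\<^sub>R x \<bullet> y) ^ i = c ^ (h + i) * (monomial a x * (x \<bullet> y) ^ i)" for c x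
          by (simp add: monomial_scaleR h_def power_add power_mult_distrib mult_ac)
        have "sphere_integral (\<lambda>x. monomial a x * (x \<bullet> y) ^ i) = \<rho> ^ i * sphere_integral (\<lambda>x. monomial a x * (x \<bullet> \<omega>) ^ i)"
        proof -
          have e: "monomial a x * (x \<bullet> y) ^ i = \<rho> ^ i * (monomial a x * (x \<bullet> \<omega>) ^ i)" for x
            by (simp add: \<omega>(2) power_mult_distrib)
          show ?thesis unfolding sphere_integral_def e by simp
        qed
        then have S: "sphere_integral (\<lambda>x. monomial a x * (x \<bullet> y) ^ i) =
            sphere_integral (\<lambda>_ :: real^'n. 1) * (\<rho> ^ i * gegen_functional lam (qa * monom 1 i))"
          unfolding qa(4) by simp
        have E1: "cone_expect b g (T p i) = Rm N p * (\<rho> ^ i * gegen_functional lam (qa * monom 1 i))"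
        \<comment> \<open>For odd \<open>h + i\<close> both sides vanish by parity: the sphere
          integral on the left and the Gegenbauer functional of \<open>qa\<close> on the
          right.\<close>
        proof (cases "even (h + i)")
          case True
          have "h + i + (k + (p - i)) = p + G" using pi by (simp add: G_def)
          then show ?thesis
            using cone_expect_product(2)[OF cont hom, of "k + (p - i)" "(N - p) div 2"] True False k
              sphere_integral_1_pos[where 'n = 'n]
            unfolding Ti S Rm_def by simp
        next
          case odd: False
          then have z: "gegen_functional lam (qa * monom 1 i) = 0"
            by (intro gegen_functional_parity_0[OF qa(2)]) simp
          have "sphere_integral (\<lambda>x. monomial a x * (x \<bullet> y) ^ i) = 0" unfolding S z by simp
          from cone_expect_product(3)[OF cont hom this] show ?thesis unfolding Ti z by simp
        qed
        \<comment> \<open>\<open>\<rho> ^ i\<close> stems from \<open>y\<close> and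
          \<open>s ^ (p - i)\<close> from the product of the heights. Since \<open>p - i\<close> is
          even the sign of \<open>s\<close> disappears, and both combine to the power of the radius
          that the radial step expects.\<close>
        have E2: "s ^ (p - i) * \<rho> ^ i = \<rho> ^ p"
        proof -
          have "s ^ (p - i) = \<rho> ^ (p - i)" using False by (simp add: \<rho>_def power_even_abs)
          then show ?thesis using pi by (simp flip: power_add)
        qed
        have E3: "(1 - s\<^sup>2) ^ ((N - p) div 2) = \<kappa> ^ (N - p)"
        proof -
          have "even (N - p)" using False by blast
          then obtain l where "N - p = 2 * l" by (elim evenE)
          then show ?thesis using s2 by (simp add: \<kappa>_def power_mult)
        qed
        show ?thesis unfolding C_def kernel_coeff_def E1 E3 E2[symmetric] by (simp only: mult_ac)
      qed
    qed
    also have "\<dots> = (\<Sum>p\<le>N. real (N choose p) * (\<rho> ^ p * \<kappa> ^ (N - p) * gegen_moment (g - 1/2) (N - p) * Rm N p) *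
       gegen_functional (lam + b) (qc * monom 1 p))"
      unfolding sum_distrib_left[symmetric] couple ..
    also have "\<dots> = (\<Sum>p\<le>N. \<Sum>e\<le>h. coeff qc e * (real (N choose p) *
        (\<rho> ^ p * \<kappa> ^ (N - p) * gegen_moment (g - 1/2) (N - p) * Rm N p * gegen_moment (al - 1/2) (p + e))))"
      unfolding moment_functional_shift moment_functional_eq[OF qc_deg] lam(4) sum_distrib_left
      by (simp add: mult_ac add.commute)
    also have "\<dots> = (\<Sum>e\<le>h. coeff qc e * Y N e)"
      unfolding Y_def sum_distrib_left by (rule sum.swap)
    also have "\<dots> = (\<Sum>e\<le>h. coeff qc e * gegen_functional (al + g) (R e * monom 1 N))"
    proof (intro sum.cong refl)
      fix e
      show "coeff qc e * Y N e =
        coeff qc e * gegen_functional (al + g) (R e * monom 1 N)"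
        using R(3)[of e N] by (cases "coeff qc e = 0") auto
    qed
    also have "\<dots> = gegen_functional (al + g) (r * monom 1 N)"
      by (simp add: r_def sum_distrib_right moment_functional_sum moment_functional_smult)
    finally show ?thesis .
  qed
  have "degree r \<le> sum a UNIV + k \<and> poly r 1 = monomial a (fst w) * snd w ^ k"
    using r_deg r_1 by (simp add: G_def h_def ys)
  then show ?thesis using main by blast
qed

end

subsection \<open>Reproducing kernels\<close>

lemma cone_integral_odd:
  fixes f :: "'n::finite cone_point \<Rightarrow> real"
  assumes "\<And>x t. f (x, - t) = - f (x, t)"
  shows "cone_integral f = 0"
proof -
  define F where "F t = indicator {-1..1} t *\<^sub>R (\<bar>t\<bar> ^ (CARD('n) - 1) * (LINT u|sphere_measure. f (\<bar>t\<bar> *\<^sub>R u, t)))" for t :: real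
  have "F (- t) = - F t" for t
  proof -
    have "indicator {-1..1} (- t) = (indicator {-1..1} t :: real)" by (auto simp: indicator_def)
    then show ?thesis by (simp add: F_def assms)
  qed
  then have "integral\<^sup>L lborel F = - integral\<^sup>L lborel F"
    using lborel_integral_real_affine[of "-1" F 0] by simp
  moreover have "cone_integral f = integral\<^sup>L lborel F"
    by (simp add: cone_integral_def set_lebesgue_integral_def F_def[abs_def])
  ultimately show ?thesis by simp
qed

lemma cone_integral_restrict:
  fixes f :: "'n::finite cone_point \<Rightarrow> real"
  assumes f: "\<And>t. (\<lambda>u. f (\<bar>t\<bar> *\<^sub>R u, t)) \<in> borel_measurable borel"
  shows "cone_integral (\<lambda>z. if z \<in> double_cone then f z else 0) = cone_integral f"
  unfolding cone_integral_def
proof (rule set_lebesgue_integral_cong)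
  show "{-1..1} \<in> sets (lborel :: real measure)" by simp
  show "\<forall>t. t \<in> {-1..1} \<longrightarrow> \<bar>t\<bar> ^ (CARD('n) - 1) * (LINT u|sphere_measure. (if (\<bar>t\<bar> *\<^sub>R u, t) \<in> double_cone then f (\<bar>t\<bar> *\<^sub>R u, t) else 0))
     = \<bar>t\<bar> ^ (CARD('n) - 1) * (LINT u|sphere_measure. f (\<bar>t\<bar> *\<^sub>R u, t))"
  proof (intro allI impI arg_cong2[where f = "(*)"] refl)
    fix t :: real assume t: "t \<in> {-1..1}"
    have [measurable]: "(\<lambda>u. f (\<bar>t\<bar> *\<^sub>R u, t)) \<in> borel_measurable borel" by (rule f)
    have [measurable]: "Measurable.pred borel (\<lambda>u :: real^'n. (\<bar>t\<bar> *\<^sub>R u, t) \<in> double_cone)"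
      unfolding double_cone_def by simp
    show "(LINT u|sphere_measure. (if (\<bar>t\<bar> *\<^sub>R u, t) \<in> double_cone then f (\<bar>t\<bar> *\<^sub>R u, t) else 0)) =
       (LINT u|sphere_measure. f (\<bar>t\<bar> *\<^sub>R u, t))"
    proof (rule integral_cong_AE)
      show "AE u in sphere_measure. (if (\<bar>t\<bar> *\<^sub>R u, t) \<in> double_cone then f (\<bar>t\<bar> *\<^sub>R u, t) else 0) = f (\<bar>t\<bar> *\<^sub>R u, t)"
        using AE_sphere_measure_cone[of t] by eventually_elim (use t in auto)
    qed measurable
  qed
qed

lemma polys_le_measurable:
  fixes p :: "'n::finite cone_point \<Rightarrow> real"
  assumes "p \<in> polys_le n"
  shows "(\<lambda>u. p (\<bar>t\<bar> *\<^sub>R u, t)) \<in> borel_measurable borel"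
  using assms
proof (induction rule: polys_le_induct)
  case (monomial c a k)
  have "continuous_on UNIV (\<lambda>u. c * (monomial a (\<bar>t\<bar> *\<^sub>R u) * t ^ k))"
    unfolding monomial_scaleR by (intro continuous_intros)
  then show ?case by (simp add: borel_measurable_continuous_onI)
qed simp

lemma cone_inner_restrict:
  fixes p q :: "'n::finite cone_point \<Rightarrow> real"
  assumes "p \<in> polys_le m" "q \<in> polys_le n"
  shows "cone_inner b g (cone_restrict p) (cone_restrict q) = cone_inner b g p q"
proof -
  have "(\<lambda>(x, t). cone_restrict p (x, t) * cone_restrict q (x, t) * cone_weight b g t) =
     (\<lambda>z. if z \<in> double_cone then (\<lambda>(x, t). p (x, t) * q (x, t) * cone_weight b g t) z else 0)"
    by (auto simp: cone_restrict_def fun_eq_iff)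
  moreover have "cone_integral \<dots> = cone_integral (\<lambda>(x, t). p (x, t) * q (x, t) * cone_weight b g t)"
    using polys_le_measurable[OF assms(1)] polys_le_measurable[OF assms(2)]
    by (intro cone_integral_restrict) auto
  ultimately show ?thesis by (simp add: cone_inner_def)
qed

lemma cone_inner_commute: "cone_inner b g p q = cone_inner b g q p"
  by (simp add: cone_inner_def mult.commute mult.left_commute)

text \<open>No positivity of the inner product is needed: two reproducing kernels satisfy
  \<open>K z w = \<langle>K (\<cdot>, w), K' (\<cdot>, z)\<rangle> = K' w z\<close>.\<close>

lemma reproducing_kernel_eqI:
  fixes K :: "'n::finite cone_point \<Rightarrow> 'n cone_point \<Rightarrow> real"
  assumes K: "is_reproducing_kernel V b g K"
    and K0: "\<And>z w. z \<notin> double_cone \<or> w \<notin> double_cone \<Longrightarrow> K z w = 0"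
  shows "reproducing_kernel V b g = K"
  unfolding reproducing_kernel_def
proof (rule the_equality)
  show "is_reproducing_kernel V b g K \<and> (\<forall>z w. z \<notin> double_cone \<or> w \<notin> double_cone \<longrightarrow> K z w = 0)"
    using assms by blast
next
  fix K' :: "'n cone_point \<Rightarrow> 'n cone_point \<Rightarrow> real"
  assume K': "is_reproducing_kernel V b g K' \<and> (\<forall>z w. z \<notin> double_cone \<or> w \<notin> double_cone \<longrightarrow> K' z w = 0)"
  have sym: "K1 z w = K2 w z" if "is_reproducing_kernel V b g K1" "is_reproducing_kernel V b g K2"
    "z \<in> double_cone" "w \<in> double_cone" for K1 K2 z w
  proof -
    have "K1 z w = cone_inner b g (\<lambda>v. K1 v w) (\<lambda>v. K2 v z)"
      using that unfolding is_reproducing_kernel_def by simp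
    also have "\<dots> = cone_inner b g (\<lambda>v. K2 v z) (\<lambda>v. K1 v w)" by (rule cone_inner_commute)
    also have "\<dots> = K2 w z" using that unfolding is_reproducing_kernel_def by simp
    finally show ?thesis .
  qed
  show "K' = K"
  proof (intro ext)
    fix z w
    show "K' z w = K z w"
    proof (cases "z \<in> double_cone \<and> w \<in> double_cone")
      case True
      then have "K' z w = K w z" "K w z = K z w"
        using sym[of K' K z w] sym[of K K w z] K K' by auto
      then show ?thesis by simp
    next
      case False
      then have "z \<notin> double_cone \<or> w \<notin> double_cone" by blast
      then show ?thesis using K' K0 by metis
    qed
  qed
qed

context cone_parameters
begin

text \<open>The right side is the even part of \<open>p\<close> at \<open>w\<close>; it is linear in
  \<open>p\<close>, so monomials suffice. Odd powers of \<open>t\<close> give 0 by reflection. For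
  even powers the expectation becomes one under the Gegenbauer law, where the sum of zonal
  polynomials evaluates at 1.\<close>

lemma cone_expect_kernel_sum:
  fixes w :: "'n cone_point"
  assumes w: "w \<in> double_cone" and p: "p \<in> polys_le M"
  shows "(\<Sum>m\<le>M. cone_expect b g (\<lambda>z. p z * even_kernel_poly m b g z w)) = (p w + p (fst w, - snd w)) / 2"
  using p
proof (induction rule: polys_le_induct)
  case (monomial c a k)
  let ?q = "\<lambda>z :: 'n cone_point. monomial a (fst z) * snd z ^ k"
  have q: "?q \<in> polys_le M"
    using polys_le_monomial[OF monomial] by (simp add: case_prod_unfold)
  have scale: "cone_expect b g (\<lambda>z. (\<lambda>(x, t). c * (monomial a x * t ^ k)) z * f z) = c * cone_expect b g (\<lambda>z. ?q z * f z)" for f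
    using cone_expect_cmult[of c "\<lambda>z. ?q z * f z"] by (simp add: case_prod_unfold mult.assoc)
  show ?case
  proof (cases "even k")
    case False
    have "cone_expect b g (\<lambda>z. ?q z * even_kernel_poly m b g z w) = 0" for m
      unfolding cone_expect_def using False
      by (subst cone_integral_odd) (auto simp: even_kernel_poly_even cone_weight_def)
    then show ?thesis using False unfolding scale by (simp add: case_prod_unfold)
  next
    case True
    obtain r where r: "degree r \<le> sum a UNIV + k" "poly r 1 = ?q w"
      "\<And>N. cone_expect b g (\<lambda>z. ?q z * even_kernel_moment b g z w N) = gegen_functional (al + g) (r * monom 1 N)"
      using cone_expect_even_kernel_moment[OF w True, of a] by blast
    have "cone_expect b g (\<lambda>z. ?q z * even_kernel_poly m b g z w) = gegen_functional (al + g) (r * zonal_poly m (al + g))" for m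
    proof -
      have "(\<lambda>z. ?q z * even_kernel_poly m b g z w) =
         (\<lambda>z. \<Sum>N\<le>degree (zonal_poly m (al + g)). coeff (zonal_poly m (al + g)) N * (?q z * even_kernel_moment b g z w N))"
        by (simp add: fun_eq_iff even_kernel_poly_def al_def moment_functional_def sum_distrib_left mult_ac)
      then have "cone_expect b g (\<lambda>z. ?q z * even_kernel_poly m b g z w) =
         cone_expect b g (\<lambda>z. \<Sum>N\<le>degree (zonal_poly m (al + g)). coeff (zonal_poly m (al + g)) N * (?q z * even_kernel_moment b g z w N))"
        by (simp only:)
      also have "\<dots> = (\<Sum>N\<le>degree (zonal_poly m (al + g)). cone_expect b g (\<lambda>z. coeff (zonal_poly m (al + g)) N * (?q z * even_kernel_moment b g z w N)))"
      proof (rule cone_expect_sum)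
        fix N assume "N \<in> {..degree (zonal_poly m (al + g))}"
        then show "(\<lambda>z. coeff (zonal_poly m (al + g)) N * (?q z * even_kernel_moment b g z w N)) \<in> polys_le (M + degree (zonal_poly m (al + g)))"
          by (intro polys_le_cmult polys_le_mult q polys_le_mono[OF even_kernel_moment_polys_le]) simp
      qed
      also have "\<dots> = moment_functional (\<lambda>N. gegen_functional (al + g) (r * monom 1 N)) (zonal_poly m (al + g))"
        unfolding cone_expect_cmult r(3) moment_functional_def[of _ "zonal_poly m (al + g)"] ..
      also have "\<dots> = gegen_functional (al + g) (r * zonal_poly m (al + g))"
        by (rule moment_functional_mult)
      finally show ?thesis .
    qed
    then have "(\<Sum>m\<le>M. cone_expect b g (\<lambda>z. ?q z * even_kernel_poly m b g z w)) =
       gegen_functional (al + g) ((\<Sum>m\<le>M. zonal_poly m (al + g)) * r)"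
      by (simp add: sum_distrib_left moment_functional_sum mult.commute)
    also have "\<dots> = ?q w"
      using gegen_functional_sum_zonal_poly[of "al + g" r M] al_bounds(2) r(1,2) monomial by simp
    finally show ?thesis
      unfolding scale sum_distrib_left[symmetric] using True by (simp add: case_prod_unfold)
  qed
next
  case (add p q)
  have "cone_expect b g (\<lambda>z. (p z + q z) * even_kernel_poly m b g z w) =
     cone_expect b g (\<lambda>z. p z * even_kernel_poly m b g z w) + cone_expect b g (\<lambda>z. q z * even_kernel_poly m b g z w)" for m
    unfolding distrib_right
    by (rule cone_expect_add[OF polys_le_mult[OF add.hyps(1) even_kernel_poly_polys_le]
          polys_le_mult[OF add.hyps(2) even_kernel_poly_polys_le]])
  then show ?case using add.IH by (simp add: sum.distrib add_divide_distrib)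
qed

text \<open>With \<open>n = Suc k\<close>, the sums of kernels up to \<open>k\<close> and up to
  \<open>Suc k\<close> both give the even part of \<open>q\<close>, because \<open>q\<close> has
  degree at most \<open>k\<close>. Their difference is the kernel of degree
  \<open>n\<close>.\<close>

lemma even_kernel_poly_orth:
  fixes w :: "'n cone_point"
  assumes w: "w \<in> double_cone" and q: "q \<in> polys_le m" and "m < n"
  shows "cone_inner b g (\<lambda>z. even_kernel_poly n b g z w) q = 0"
proof -
  obtain k where n: "n = Suc k" using \<open>m < n\<close> by (cases n) auto
  have "q \<in> polys_le k" "q \<in> polys_le (Suc k)"
    using \<open>m < n\<close> unfolding n by (auto intro: polys_le_mono[OF q])
  from this[THEN cone_expect_kernel_sum[OF w]]
  have "cone_expect b g (\<lambda>z. q z * even_kernel_poly (Suc k) b g z w) = 0" by simp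
  then show ?thesis unfolding n by (simp add: cone_inner_eq mult.commute)
qed

text \<open>In the sum over all degrees the kernels below \<open>n\<close> contribute nothing, being
  polynomials of lower degree in \<open>z\<close>, to which \<open>p\<close> is orthogonal.\<close>

lemma even_kernel_poly_reproduces:
  fixes w :: "'n cone_point"
  assumes w: "w \<in> double_cone" and p: "p \<in> polys_le n" and even: "\<And>x t. p (x, - t) = p (x, t)"
    and orth: "\<And>m q. m < n \<Longrightarrow> q \<in> polys_le m \<Longrightarrow> cone_inner b g p q = 0"
  shows "cone_inner b g p (\<lambda>z. even_kernel_poly n b g z w) = p w"
proof -
  have "(\<Sum>m\<le>n. cone_expect b g (\<lambda>z. p z * even_kernel_poly m b g z w)) = p w"
    using cone_expect_kernel_sum[OF w p] even[of "fst w" "snd w"] by simp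
  moreover have "(\<Sum>m<n. cone_expect b g (\<lambda>z. p z * even_kernel_poly m b g z w)) = 0"
    using orth[OF _ even_kernel_poly_polys_le] by (intro sum.neutral) (auto simp: cone_inner_eq)
  ultimately show ?thesis
    by (simp add: cone_inner_eq flip: lessThan_Suc_atMost)
qed

lemma kernel_even_eq:
  fixes z w :: "'n cone_point"
  assumes "z \<in> double_cone" "w \<in> double_cone"
  shows "kernel_even n b g z w = even_kernel_poly n b g z w"
proof -
  define K where "K z w = (if z \<in> double_cone \<and> w \<in> double_cone then even_kernel_poly n b g z w else 0)" for z w :: "'n cone_point"
  have Kr: "(\<lambda>z. K z w) = cone_restrict (\<lambda>z. even_kernel_poly n b g z w)" if "w \<in> double_cone" for w
    using that by (auto simp: K_def cone_restrict_def fun_eq_iff)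
  have "is_reproducing_kernel (orth_even n b g) b g K"
    unfolding is_reproducing_kernel_def
  proof (intro conjI ballI)
    fix w :: "'n cone_point" assume w: "w \<in> double_cone"
    show "(\<lambda>z. K z w) \<in> orth_even n b g"
      unfolding Kr[OF w] orth_even_def
      using even_kernel_poly_polys_le even_kernel_poly_even even_kernel_poly_orth[OF w] by blast
    fix f :: "'n cone_point \<Rightarrow> real" assume "f \<in> orth_even n b g"
    then obtain p where p: "f = cone_restrict p" "p \<in> polys_le n" "\<And>x t. p (x, - t) = p (x, t)"
      "\<And>m q. m < n \<Longrightarrow> q \<in> polys_le m \<Longrightarrow> cone_inner b g p q = 0"
      unfolding orth_even_def by blast
    have "cone_inner b g p (\<lambda>z. even_kernel_poly n b g z w) = p w"
      by (rule even_kernel_poly_reproduces[OF w p(2,3)]) (rule p(4))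
    then show "cone_inner b g f (\<lambda>z. K z w) = f w"
      unfolding Kr[OF w] p(1) cone_inner_restrict[OF p(2) even_kernel_poly_polys_le]
      using w by (simp add: cone_restrict_def)
  qed
  then have "kernel_even n b g = K"
    unfolding kernel_even_def by (rule reproducing_kernel_eqI) (auto simp: K_def)
  then show ?thesis using assms by (simp add: K_def)
qed

text \<open>Raising \<open>b\<close> by 1 multiplies the weight by \<open>t\<^sup>2\<close>. The
  constant renormalises it: it is the reciprocal of the expectation of \<open>t\<^sup>2\<close> for
  the old weight, a quotient of two Beta values.\<close>

lemma cone_inner_snd:
  fixes p q :: "'n cone_point \<Rightarrow> real"
  shows "cone_inner (b + 1) g p q =
    (al + g + 1) / (al + 1/2) * cone_inner b g (\<lambda>z. snd z * p z) (\<lambda>z. snd z * q z)"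
proof -
  interpret P: cone_parameters "b + 1" g "TYPE('n)"
    using b g card by unfold_locales auto
  have w: "cone_weight (b + 1) g t = t * t * cone_weight b g t" for t
  proof -
    have "\<bar>t\<bar> powr (2 * (b + 1)) = \<bar>t\<bar> powr (2 * b) * \<bar>t\<bar> powr 2"
    proof -
      have e: "2 * (b + 1) = 2 * b + 2" by simp
      show ?thesis unfolding e by (rule powr_add)
    qed
    also have "\<bar>t\<bar> powr 2 = t * t" by (cases "t = 0") (simp_all add: powr_numeral power2_eq_square)
    finally show ?thesis by (simp add: cone_weight_def)
  qed
  have "Beta (b + CARD('n) / 2 + real 1) (g + 1/2 + real 0) = Beta (b + CARD('n) / 2) (g + 1/2) *
    (pochhammer (b + CARD('n) / 2) 1 * pochhammer (g + 1/2) 0 / pochhammer (b + CARD('n) / 2 + (g + 1/2)) (1 + 0))"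
    by (rule Beta_shift) (use al_bounds al_simps in auto)
  moreover have "b + CARD('n) / 2 = al + 1/2" by (simp add: al_simps)
  moreover have "al + 1/2 + (g + 1/2) = al + g + 1" by simp
  ultimately have B: "Beta (b + 1 + CARD('n) / 2) (g + 1/2) = Beta (b + CARD('n) / 2) (g + 1/2) * ((al + 1/2) / (al + g + 1))"
    by (simp add: add_ac)
  have "cone_integral (\<lambda>(x :: real^'n, t). cone_weight (b + 1) g t) =
      cone_integral (\<lambda>(x :: real^'n, t). cone_weight b g t) * ((al + 1/2) / (al + g + 1))"
    unfolding cone_integral_weight P.cone_integral_weight B by simp
  moreover have "cone_integral (\<lambda>(x, t). p (x, t) * q (x, t) * cone_weight (b + 1) g t) =
      cone_integral (\<lambda>(x, t). (snd (x, t) * p (x, t)) * (snd (x, t) * q (x, t)) * cone_weight b g t)"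
    by (simp add: w mult_ac)
  ultimately show ?thesis
    unfolding cone_inner_def by simp
qed

text \<open>Up to the constant, multiplication by \<open>t\<close> is an isometry from the even
  orthogonal polynomials of degree \<open>n - 1\<close> for \<open>b + 1\<close> onto the odd ones
  of degree \<open>n\<close> for \<open>b\<close>. It therefore carries one reproducing kernel to
  the other.\<close>

lemma kernel_odd_eq:
  fixes z w :: "'n cone_point"
  assumes n: "n \<ge> 1" and zw: "z \<in> double_cone" "w \<in> double_cone"
  shows "kernel_odd n b g z w =
    (al + g + 1) / (al + 1/2) * snd w * snd z * even_kernel_poly (n - 1) (b + 1) g z w"
proof -
  interpret P: cone_parameters "b + 1" g "TYPE('n)"
    using b g card by unfold_locales auto
  define c where "c = (al + g + 1) / (al + 1/2)"
  have c: "c \<noteq> 0" using al_bounds by (simp add: c_def)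
  define F where "F w = (\<lambda>z. (c * snd w) * (snd z * even_kernel_poly (n - 1) (b + 1) g z w))" for w :: "'n cone_point"
  define K where "K z w = (if z \<in> double_cone \<and> w \<in> double_cone then F w z else 0)" for z w :: "'n cone_point"
  have Kr: "(\<lambda>z. K z w) = cone_restrict (F w)" if "w \<in> double_cone" for w
    using that by (auto simp: K_def cone_restrict_def fun_eq_iff)
  have Fp: "F w \<in> polys_le n" for w
    using polys_le_mult[OF polys_le_snd even_kernel_poly_polys_le, of "n - 1" "b + 1" g w] n
    unfolding F_def by (intro polys_le_cmult) simp
  have inner: "cone_inner b g (\<lambda>z. snd z * q z) (F w) = snd w * cone_inner (b + 1) g q (\<lambda>z. even_kernel_poly (n - 1) (b + 1) g z w)" for q w
  proof -
    have "cone_inner b g (\<lambda>z. snd z * q z) (F w) =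
       c * snd w * cone_inner b g (\<lambda>z. snd z * q z) (\<lambda>z. snd z * even_kernel_poly (n - 1) (b + 1) g z w)"
      using cone_expect_cmult[of "c * snd w" "\<lambda>z. (snd z * q z) * (snd z * even_kernel_poly (n - 1) (b + 1) g z w)"]
      unfolding cone_inner_eq F_def by (simp add: mult_ac)
    then show ?thesis unfolding cone_inner_snd c_def by simp
  qed
  have Fodd: "F w (x, - t) = - F w (x, t)" for w x t
    by (simp add: F_def even_kernel_poly_even)
  \<comment> \<open>By parity only odd powers of \<open>t\<close> in \<open>q\<close> matter; these
    are \<open>t\<close> times a monomial of degree one less, where the orthogonality for
    \<open>b + 1\<close> applies.\<close>
  have Forth: "cone_inner b g (F w) q = 0" if w: "w \<in> double_cone" and q: "q \<in> polys_le m" and m: "m < n" for w q m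
    using q
  proof (induction rule: polys_le_induct)
    case (monomial c' a k)
    show ?case
    proof (cases "even k")
      case True
      then show ?thesis
        unfolding cone_inner_eq cone_expect_def
        by (subst cone_integral_odd) (auto simp: Fodd cone_weight_def)
    next
      case False
      then obtain j where k: "k = Suc j" by (cases k) auto
      have "(\<lambda>(x, t). monomial a x * t ^ j) \<in> polys_le (m - 1)"
        using monomial unfolding k by (intro polys_le_monomial) simp
      from polys_le_cmult[OF this, of c'] have "cone_inner (b + 1) g
          (\<lambda>z. even_kernel_poly (n - 1) (b + 1) g z w) (\<lambda>z. c' * (\<lambda>(x, t). monomial a x * t ^ j) z) = 0"
        using monomial m unfolding k by (intro P.even_kernel_poly_orth[OF w]) auto
      then have "cone_inner b g (\<lambda>z. snd z * (c' * (\<lambda>(x, t). monomial a x * t ^ j) z)) (F w) = 0"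
        unfolding inner by (simp add: cone_inner_commute[of "b + 1"])
      then show ?thesis
        by (simp add: cone_inner_commute[of b g "F w"] k case_prod_unfold mult_ac)
    qed
  next
    case (add p q)
    have "cone_inner b g (F w) (\<lambda>z. p z + q z) = cone_inner b g (F w) p + cone_inner b g (F w) q"
      unfolding cone_inner_eq distrib_left
      by (rule cone_expect_add[OF polys_le_mult[OF Fp add.hyps(1)] polys_le_mult[OF Fp add.hyps(2)]])
    then show ?case using add.IH by simp
  qed
  \<comment> \<open>Stated for the odd part of an arbitrary polynomial, so that induction over
    monomials is possible. The odd part of an odd polynomial is the polynomial itself.\<close>
  have factor: "\<exists>p'. p' \<in> polys_le (n - 1) \<and> (\<forall>x t. p' (x, - t) = p' (x, t)) \<and>
      (\<forall>x t. (p (x, t) - p (x, - t)) / 2 = t * p' (x, t))" if "p \<in> polys_le n" for p :: "'n cone_point \<Rightarrow> real"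
    using that
  proof (induction rule: polys_le_induct)
    case (monomial c' a k)
    show ?case
    proof (cases "even k")
      case True
      then show ?thesis using polys_le_const[of 0 "n - 1"] by (intro exI[of _ "\<lambda>_. 0"]) simp
    next
      case False
      then obtain j where k: "k = Suc j" and j: "even j" by (cases k) auto
      have "(\<lambda>(x, t). monomial a x * t ^ j) \<in> polys_le (n - 1)"
        using monomial unfolding k by (intro polys_le_monomial) simp
      from polys_le_cmult[OF this, of c'] j show ?thesis
        unfolding k by (intro exI[of _ "\<lambda>z. c' * (\<lambda>(x, t). monomial a x * t ^ j) z"]) simp
    qed
  next
    case (add p q)
    then obtain p' q' where p': "p' \<in> polys_le (n - 1)" "\<And>x t. p' (x, - t) = p' (x, t)"
      "\<And>x t. (p (x, t) - p (x, - t)) / 2 = t * p' (x, t)"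
      and q': "q' \<in> polys_le (n - 1)" "\<And>x t. q' (x, - t) = q' (x, t)"
      "\<And>x t. (q (x, t) - q (x, - t)) / 2 = t * q' (x, t)" by blast
    have "(p (x, t) + q (x, t) - (p (x, - t) + q (x, - t))) / 2 = t * (p' (x, t) + q' (x, t))" for x t
      unfolding distrib_left p'(3)[symmetric] q'(3)[symmetric] by (simp add: field_simps)
    then show ?case
      using polys_le_add[OF p'(1) q'(1)] p'(2) q'(2) by (intro exI[of _ "\<lambda>z. p' z + q' z"]) simp
  qed
  have "is_reproducing_kernel (orth_odd n b g) b g K"
    unfolding is_reproducing_kernel_def
  proof (intro conjI ballI)
    fix w :: "'n cone_point" assume w: "w \<in> double_cone"
    show "(\<lambda>z. K z w) \<in> orth_odd n b g"
      unfolding Kr[OF w] orth_odd_def using Fp Fodd Forth[OF w] by blast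
    fix f :: "'n cone_point \<Rightarrow> real" assume "f \<in> orth_odd n b g"
    then obtain p where p: "f = cone_restrict p" "p \<in> polys_le n" "\<And>x t. p (x, - t) = - p (x, t)"
      "\<And>m q. m < n \<Longrightarrow> q \<in> polys_le m \<Longrightarrow> cone_inner b g p q = 0"
      unfolding orth_odd_def by blast
    obtain p' where p': "p' \<in> polys_le (n - 1)" "\<And>x t. p' (x, - t) = p' (x, t)"
      "\<And>x t. (p (x, t) - p (x, - t)) / 2 = t * p' (x, t)"
      using factor[OF p(2)] by blast
    have pp: "p = (\<lambda>z. snd z * p' z)"
    proof
      fix z :: "'n cone_point"
      show "p z = snd z * p' z" using p'(3)[of "fst z" "snd z"] p(3)[of "fst z" "snd z"] by simp
    qed
    have "cone_inner (b + 1) g p' q = 0" if "m < n - 1" "q \<in> polys_le m" for m q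
    proof -
      have "(\<lambda>z. snd z * q z) \<in> polys_le (1 + m)"
        using that by (intro polys_le_mult polys_le_snd)
      then have "cone_inner b g p (\<lambda>z. snd z * q z) = 0" using that by (intro p(4)[of "1 + m"]) auto
      then show ?thesis unfolding cone_inner_snd pp by simp
    qed
    then have "cone_inner (b + 1) g p' (\<lambda>z. even_kernel_poly (n - 1) (b + 1) g z w) = p' w"
      by (intro P.even_kernel_poly_reproduces[OF w p'(1,2)])
    then have "cone_inner b g p (F w) = snd w * p' w"
      unfolding pp inner by simp
    then show "cone_inner b g f (\<lambda>z. K z w) = f w"
      unfolding Kr[OF w] p(1) cone_inner_restrict[OF p(2) Fp] using w by (simp add: cone_restrict_def pp)
  qed
  then have "kernel_odd n b g = K"
    unfolding kernel_odd_def by (rule reproducing_kernel_eqI) (auto simp: K_def)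
  then show ?thesis using zw by (simp add: K_def F_def c_def)
qed

end

subsection \<open>The integral formula and the limits\<close>

lemma has_bochner_integral_times:
  fixes f :: "'a::euclidean_space \<Rightarrow> real" and h :: "'b::euclidean_space \<Rightarrow> real"
  assumes "has_bochner_integral lborel f x" "has_bochner_integral lborel h y"
  shows "has_bochner_integral lborel (\<lambda>z. f (fst z) * h (snd z)) (x * y)"
proof -
  have f: "integrable lborel f" "integral\<^sup>L lborel f = x" and h: "integrable lborel h" "integral\<^sup>L lborel h = y"
    using assms by (auto simp: has_bochner_integral_iff)
  have [measurable]: "f \<in> borel_measurable borel" "h \<in> borel_measurable borel"
    using f(1) h(1) borel_measurable_integrable by (auto simp: measurable_lborel2)
  have i: "integrable (lborel \<Otimes>\<^sub>M lborel) (\<lambda>(a, c). f a * h c)"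
  proof (rule lborel_pair.Fubini_integrable)
    show "(\<lambda>(a, c). f a * h c) \<in> borel_measurable (lborel \<Otimes>\<^sub>M lborel)" by measurable
    have "(\<lambda>a. LINT c|lborel. norm (f a * h c)) = (\<lambda>a. \<bar>f a\<bar> * (LINT c|lborel. \<bar>h c\<bar>))"
      by (simp add: abs_mult)
    then show "integrable lborel (\<lambda>a. LINT c|lborel. norm ((\<lambda>(a, c). f a * h c) (a, c)))"
      using f(1) by (simp add: integrable_abs)
    show "AE a in lborel. integrable lborel (\<lambda>c. (\<lambda>(a, c). f a * h c) (a, c))"
      using h(1) by simp
  qed
  have "integral\<^sup>L (lborel \<Otimes>\<^sub>M lborel) (\<lambda>(a, c). f a * h c) = x * y"
    using lborel_pair.integral_fst'[OF i] f(2) h(2) by simp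
  then show ?thesis
    using i by (simp add: has_bochner_integral_iff lborel_prod case_prod_unfold)
qed

text \<open>Expanding the zonal polynomial in powers of \<open>xi\<close>, and these by the binomial
  theorem twice, separates the variables \<open>z1\<close>, \<open>z2\<close> and \<open>v\<close>.
  For \<open>b > 0\<close> and \<open>g > 0\<close> each factor is integrable, and the normalising
  constants cancel, which leaves the moments.\<close>

lemma kernel_integral_eq:
  fixes x y :: "real^'n::finite" and t s b g :: real
  assumes b: "b > 0" and g: "g > 0" and card: "CARD('n) \<ge> 2"
  defines "al \<equiv> b + (real CARD('n) - 1) / 2"
  shows "kernel_integral n b g (x, t) (y, s) =
    moment_functional (\<lambda>N. \<Sum>p\<le>N. \<Sum>i\<le>p. kernel_coeff CARD('n) b g N p i *
     ((x \<bullet> y) * sgn (s * t)) ^ i * (t * s) ^ (p - i) * (sqrt (1 - s\<^sup>2) * sqrt (1 - t\<^sup>2)) ^ (N - p))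
     (zonal_poly n (al + g))"
proof -
  define d where "d = real CARD('n)"
  have d: "d \<ge> 2" using card by (simp add: d_def)
  define Z where "Z = zonal_poly n (al + g)"
  define X Y V where "X = (x \<bullet> y) * sgn (s * t)" and "Y = t * s" and "V = sqrt (1 - s\<^sup>2) * sqrt (1 - t\<^sup>2)"
  define f1 where "f1 i j = (\<lambda>z. indicator {-1..1} z * (((1 - z) / 2) ^ i * ((1 + z) / 2) ^ j * ((1 - z) powr (d / 2 - 1) * (1 + z) powr (b - 1))))" for i j and z :: real
  define f2 where "f2 j = (\<lambda>z. indicator {-1..1} z * (z ^ j * (1 - z\<^sup>2) powr (b - 1/2)))" for j and z :: real
  define f3 where "f3 j = (\<lambda>v. indicator {-1..1} v * (v ^ j * (1 - v\<^sup>2) powr (g - 1/2 - 1/2)))" for j and v :: real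
  define C where "C N p i = coeff Z N * (real (N choose p) * real (p choose i) * X ^ i * Y ^ (p - i) * V ^ (N - p))" for N p i
  define G where "G z1 z2 v =
     (\<Sum>N\<le>degree Z. \<Sum>p\<le>N. \<Sum>i\<le>p. C N p i * (f1 i (p - i) z1 * (f2 (p - i) z2 * f3 (N - p) v)))" for z1 z2 v
  define B where "B = 2 powr (d / 2 + b - 1) * Beta (d / 2) b"
  define R where "R =
     (\<Sum>N\<le>degree Z. \<Sum>p\<le>N. \<Sum>i\<le>p. C N p i * ((B * coupling_moment (d / 2) b i (p - i)) *
        ((gegen_moment b (p - i) / gegenbauer_const b) * (gegen_moment (g - 1/2) (N - p) / gegenbauer_const (g - 1/2)))))"
  have B: "B > 0" using b d by (simp add: B_def Beta_real_pos)
  have gc: "gegenbauer_const b > 0" "gegenbauer_const (g - 1/2) > 0"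
    using b g by (auto intro!: gegenbauer_const_pos)
  have I1: "has_bochner_integral lborel (f1 i j) (B * coupling_moment (d / 2) b i j)" for i j
    unfolding f1_def B_def coupling_moment_def using b d by (intro has_bochner_integral_coupling_moment) auto
  have I2: "has_bochner_integral lborel (f2 j) (gegen_moment b j / gegenbauer_const b)" for j
    unfolding f2_def using b by (intro has_bochner_integral_gegen_moment) auto
  have I3: "has_bochner_integral lborel (f3 j) (gegen_moment (g - 1/2) j / gegenbauer_const (g - 1/2))" for j
    unfolding f3_def using g by (intro has_bochner_integral_gegen_moment) auto
  have "has_bochner_integral lborel
     (\<lambda>z. G (fst z) (fst (snd z)) (snd (snd z)))
     R"
    unfolding G_def R_def
    by (intro has_bochner_integral_sum has_bochner_integral_mult_right)
      (rule has_bochner_integral_times[OF I1 has_bochner_integral_times[OF I2 I3]])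
  then have int: "integral\<^sup>L lborel (\<lambda>z. G (fst z) (fst (snd z)) (snd (snd z)))
     = R"
    by (simp add: has_bochner_integral_iff)
  have "(real CARD('n) - 1) / 2 \<ge> 0" using d by (simp add: d_def)
  then have l: "al + g > 0" using b g unfolding al_def by linarith
  have integrand: "indicator ({-1..1} \<times> {-1..1} \<times> {-1..1}) (z1, z2, v) *
      (zonal n (al + g) (xi (x, t) (y, s) z1 z2 v) * (1 - z1) powr ((d - 2) / 2) * (1 + z1) powr (b - 1)
                * (1 - z2\<^sup>2) powr (b - 1/2) * (1 - v\<^sup>2) powr (g - 1)) =
     G z1 z2 v" for z1 z2 v
  proof -
    define W where "W = indicator {-1..1} z1 * indicator {-1..1} z2 * indicator {-1..1} v *
       ((1 - z1) powr (d / 2 - 1) * (1 + z1) powr (b - 1) * (1 - z2\<^sup>2) powr (b - 1/2) * (1 - v\<^sup>2) powr (g - 1))"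
    have pw: "xi (x, t) (y, s) z1 z2 v ^ N = (\<Sum>p\<le>N. \<Sum>i\<le>p. real (N choose p) * real (p choose i) * X ^ i * Y ^ (p - i) * V ^ (N - p)
       * (((1 - z1) / 2) ^ i * ((1 + z1) / 2) ^ (p - i) * z2 ^ (p - i) * v ^ (N - p)))" for N
    proof -
      define h1 h2 where "h1 = (1 - z1) / 2" and "h2 = (1 + z1) / 2"
      have xi: "xi (x, t) (y, s) z1 z2 v = (h1 * X + h2 * z2 * Y) + v * V"
        by (simp add: xi_def X_def Y_def V_def h1_def h2_def mult_ac)
      have inner: "(h1 * X + h2 * z2 * Y) ^ p = (\<Sum>i\<le>p. real (p choose i) * (h1 * X) ^ i * (h2 * z2 * Y) ^ (p - i))" for p
        by (rule binomial_ring)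
      show ?thesis
        unfolding xi binomial_ring[of "h1 * X + h2 * z2 * Y" "v * V" N] inner sum_distrib_left sum_distrib_right
          h1_def[symmetric] h2_def[symmetric]
        by (intro sum.cong refl) (simp add: power_mult_distrib mult_ac)
    qed
    have "zonal n (al + g) (xi (x, t) (y, s) z1 z2 v) = (\<Sum>N\<le>degree Z. coeff Z N * xi (x, t) (y, s) z1 z2 v ^ N)"
      unfolding poly_zonal_poly[OF l, symmetric] Z_def poly_altdef ..
    also have "\<dots> * W = G z1 z2 v"
      unfolding G_def pw sum_distrib_left sum_distrib_right
      by (intro sum.cong refl) (simp add: C_def f1_def f2_def f3_def W_def mult_ac)
    finally have "zonal n (al + g) (xi (x, t) (y, s) z1 z2 v) * W =
       G z1 z2 v" .
    moreover have e: "(d - 2) / 2 = d / 2 - 1" by (simp add: field_simps)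
    ultimately show ?thesis
      unfolding e by (simp add: W_def indicator_times mult_ac)
  qed
  have "(LINT (z1, z2, v):({-1..1} \<times> {-1..1} \<times> {-1..1})|lborel.
                zonal n (al + g) (xi (x, t) (y, s) z1 z2 v)
                * (1 - z1) powr ((d - 2) / 2) * (1 + z1) powr (b - 1)
                * (1 - z2\<^sup>2) powr (b - 1/2) * (1 - v\<^sup>2) powr (g - 1)) =
      R"
    unfolding set_lebesgue_integral_def int[symmetric]
  proof (intro Bochner_Integration.integral_cong refl)
    fix z :: "real \<times> real \<times> real"
    show "indicat_real ({-1..1} \<times> {-1..1} \<times> {-1..1}) z *\<^sub>R
         (case z of (z1, z2, v) \<Rightarrow> zonal n (al + g) (xi (x, t) (y, s) z1 z2 v)
                * (1 - z1) powr ((d - 2) / 2) * (1 + z1) powr (b - 1)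
                * (1 - z2\<^sup>2) powr (b - 1/2) * (1 - v\<^sup>2) powr (g - 1)) =
       (G (fst z) (fst (snd z)) (snd (snd z)))"
      using integrand[of "fst z" "fst (snd z)" "snd (snd z)"] by (simp only: case_prod_unfold real_scaleR_def prod.collapse)
  qed
  moreover have "jacobi_const ((d - 2) / 2) (b - 1) / 2 powr ((d - 2) / 2 + (b - 1) + 1) = 1 / B"
  proof -
    have e: "(d - 2) / 2 = d / 2 - 1" by (simp add: field_simps)
    have e': "d / 2 - 1 + (b - 1) + 2 = d / 2 + b" "d / 2 - 1 + 1 = d / 2" "b - 1 + 1 = b"
      "d / 2 - 1 + (b - 1) + 1 = d / 2 + b - 1"
      by simp_all
    show ?thesis unfolding jacobi_const_def B_def Beta_def e e' by simp
  qed
  ultimately have "kernel_integral n b g (x, t) (y, s) =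
      1 / B * gegenbauer_const b * gegenbauer_const (g - 1/2) *
      R"
    unfolding kernel_integral_def Let_def al_def d_def by simp
  also have "\<dots> = (\<Sum>N\<le>degree Z. coeff Z N * (\<Sum>p\<le>N. \<Sum>i\<le>p. kernel_coeff d b g N p i *
     X ^ i * Y ^ (p - i) * V ^ (N - p)))"
    unfolding R_def sum_distrib_left
  proof (intro sum.cong refl)
    fix N p i
    have "1 / B * gegenbauer_const b * gegenbauer_const (g - 1/2) * (c * ((B * u) * ((u2 / gegenbauer_const b) * (u3 / gegenbauer_const (g - 1/2))))) = c * u * u2 * u3"
      for c u u2 u3 :: real
      using B gc by (simp add: field_simps)
    then show "1 / B * gegenbauer_const b * gegenbauer_const (g - 1/2) * (C N p i * ((B * coupling_moment (d / 2) b i (p - i)) *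
        ((gegen_moment b (p - i) / gegenbauer_const b) * (gegen_moment (g - 1/2) (N - p) / gegenbauer_const (g - 1/2)))))
      = coeff Z N * (kernel_coeff d b g N p i *
     X ^ i * Y ^ (p - i) * V ^ (N - p))"
      by (simp only: C_def kernel_coeff_def) (simp only: mult_ac)
  qed
  finally show ?thesis
    unfolding moment_functional_def Z_def X_def Y_def V_def d_def .
qed

text \<open>Only even \<open>p - i\<close> and \<open>N - p\<close> contribute, and the zonal
  polynomial contains only powers \<open>N\<close> with the parity of \<open>n\<close>. So the
  exponent \<open>i\<close> of \<open>sgn (s * t)\<close> has the parity of \<open>n\<close>, and
  for \<open>s * t < 0\<close> the sign is exactly the factor \<open>(-1) ^ n\<close> of the
  formula.\<close>

lemma even_kernel_formula_eq:
  fixes x y :: "real^'n::finite" and t s b g :: real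
  assumes b: "b > 0" and g: "g > 0" and card: "CARD('n) \<ge> 2"
    and xt: "(x, t) \<in> double_cone" and ys: "(y, s) \<in> double_cone"
  shows "even_kernel_formula n b g (x, t) (y, s) = even_kernel_poly n b g (x, t) (y, s)"
proof -
  define e where "e = (if t * s < 0 then (-1 :: real) ^ n else 1)"
  define Z where "Z = zonal_poly n (b + (real CARD('n) - 1) / 2 + g)"
  have st: "t\<^sup>2 \<le> 1" "s\<^sup>2 \<le> 1"
    using xt ys by (auto simp: double_cone_def abs_square_le_1 abs_le_iff)
  have xy0: "x \<bullet> y = 0" if "t * s = 0"
    using that xt ys by (auto simp: double_cone_def)
  have "even_kernel_formula n b g (x, t) (y, s) = e * kernel_integral n b g (x, t) (y, s)"
    by (simp add: even_kernel_formula_def e_def)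
  also have "\<dots> = even_kernel_poly n b g (x, t) (y, s)"
    unfolding kernel_integral_eq[OF b g card] even_kernel_poly_def Z_def[symmetric] moment_functional_def even_kernel_moment_def
      sum_distrib_left
  proof (intro sum.cong refl)
    fix N p i assume "N \<in> {..degree Z}" and pi: "p \<in> {..N}" "i \<in> {..p}"
    show "e * (coeff Z N * (kernel_coeff CARD('n) b g N p i *
     ((x \<bullet> y) * sgn (s * t)) ^ i * (t * s) ^ (p - i) * (sqrt (1 - s\<^sup>2) * sqrt (1 - t\<^sup>2)) ^ (N - p)))
     = coeff Z N * (kernel_coeff CARD('n) b g N p i *
     (fst (x, t) \<bullet> fst (y, s)) ^ i * (snd (x, t) * snd (y, s)) ^ (p - i) *
     ((1 - (snd (x, t))\<^sup>2) * (1 - (snd (y, s))\<^sup>2)) ^ ((N - p) div 2))"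
    proof (cases "coeff Z N = 0 \<or> odd (p - i) \<or> odd (N - p)")
      case True
      then show ?thesis by (auto simp: kernel_coeff_odd)
    next
      case False
      then have ev: "even (n + N)" "even (p - i)" "even (N - p)"
        using coeff_zonal_poly_parity[of n "b + (real CARD('n) - 1) / 2 + g" N] by (auto simp: Z_def)
      then have "even (n + i)" using pi by auto
      have V: "(sqrt (1 - s\<^sup>2) * sqrt (1 - t\<^sup>2)) ^ (N - p) = ((1 - t\<^sup>2) * (1 - s\<^sup>2)) ^ ((N - p) div 2)"
      proof -
        obtain l where l: "N - p = 2 * l" using ev(3) by (elim evenE)
        then show ?thesis using st by (simp add: power_mult power_mult_distrib)
      qed
      have X: "e * ((x \<bullet> y) * sgn (s * t)) ^ i = (x \<bullet> y) ^ i"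
      proof -
        consider "t * s > 0" | "t * s = 0" | "t * s < 0" by linarith
        then show ?thesis
        proof cases
          case 1
          then have "sgn (s * t) = 1" by (simp add: mult.commute)
          then show ?thesis using 1 by (simp add: e_def)
        next
          case 2
          \<comment> \<open>One of the two points is the apex, so the inner product is 0. Both sides
            are then \<open>0 ^ i\<close>, including the value 1 for \<open>i = 0\<close>.\<close>
          have "e = 1" unfolding e_def 2 by simp
          then show ?thesis using xy0[OF 2] by simp
        next
          case 3
          then have sg: "sgn (s * t) = -1" by (simp add: mult.commute)
          have one: "(-1 :: real) ^ n * (-1) ^ i = 1"
            using \<open>even (n + i)\<close> by (simp flip: power_add)
          have "e = (-1) ^ n" using 3 by (simp add: e_def)
          then have "e * ((x \<bullet> y) * sgn (s * t)) ^ i = ((-1) ^ n * (-1) ^ i) * (x \<bullet> y) ^ i"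
            unfolding sg power_mult_distrib by (simp only: mult_ac)
          then show ?thesis unfolding one by simp
        qed
      qed
      show ?thesis
        unfolding V fst_conv snd_conv X[symmetric] by (simp only: mult_ac)
    qed
  qed
  finally show ?thesis .
qed

section \<open>Continuity in the parameters\<close>

lemma tendsto_pochhammer:
  fixes f :: "'a \<Rightarrow> real"
  assumes "(f \<longlongrightarrow> L) F"
  shows "((\<lambda>x. pochhammer (f x) n) \<longlongrightarrow> pochhammer L n) F"
  by (induction n) (auto simp: pochhammer_Suc intro!: tendsto_intros assms)

lemma tendsto_gegen_moment:
  fixes f :: "'a \<Rightarrow> real"
  assumes "(f \<longlongrightarrow> L) F" "L > -1"
  shows "((\<lambda>x. gegen_moment (f x) k) \<longlongrightarrow> gegen_moment L k) F"
  unfolding gegen_moment_def using assms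
  by (intro tendsto_intros tendsto_pochhammer pochhammer_nonzero) auto

lemma tendsto_coeff_zonal_poly:
  fixes f :: "'a \<Rightarrow> real"
  assumes "(f \<longlongrightarrow> L) F"
  shows "((\<lambda>x. coeff (zonal_poly n (f x)) i) \<longlongrightarrow> coeff (zonal_poly n L) i) F"
proof -
  have c: "((\<lambda>x. coeff (gegen_poly m (f x + 1)) i) \<longlongrightarrow> coeff (gegen_poly m (L + 1)) i) F" for m
    unfolding gegen_poly_def coeff_sum coeff_monom
  proof (intro tendsto_sum)
    fix k
    show "((\<lambda>x. if m - 2 * k = i then (-1) ^ k * pochhammer (f x + 1) (m - k) * 2 ^ (m - 2 * k) / (fact k * fact (m - 2 * k)) else 0)
       \<longlongrightarrow> (if m - 2 * k = i then (-1) ^ k * pochhammer (L + 1) (m - k) * 2 ^ (m - 2 * k) / (fact k * fact (m - 2 * k)) else 0)) F"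
      by (auto intro!: tendsto_intros tendsto_pochhammer assms)
  qed
  show ?thesis
    unfolding zonal_poly_def coeff_diff by (cases "n \<ge> 2") (auto intro!: tendsto_diff c)
qed

lemma tendsto_even_kernel_poly:
  fixes z w :: "'n::finite cone_point"
  assumes f: "(f \<longlongrightarrow> b) F" "b > -1/2" and h: "(h \<longlongrightarrow> g) F" "g > -1/2" and card: "CARD('n) \<ge> 2"
  shows "((\<lambda>x. even_kernel_poly n (f x) (h x) z w) \<longlongrightarrow> even_kernel_poly n b g z w) F"
proof -
  have cm: "((\<lambda>x. coupling_moment (CARD('n) / 2) (f x) i j) \<longlongrightarrow> coupling_moment (CARD('n) / 2) b i j) F" for i j
    unfolding coupling_moment_def using card f
    by (intro tendsto_intros tendsto_pochhammer pochhammer_nonzero) auto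
  have e: "even_kernel_poly n b g z w = (\<Sum>N\<le>n. coeff (zonal_poly n (b + (real CARD('n) - 1) / 2 + g)) N * even_kernel_moment b g z w N)" for b g
    unfolding even_kernel_poly_def by (rule moment_functional_eq[OF degree_zonal_poly_le])
  show ?thesis
    unfolding e even_kernel_moment_def kernel_coeff_def using f h
    by (intro tendsto_sum tendsto_mult tendsto_coeff_zonal_poly tendsto_gegen_moment cm tendsto_const tendsto_add tendsto_diff) auto
qed

text \<open>For positive parameters the formula is the polynomial kernel, which is continuous up to
  the limit parameters and is the reproducing kernel there too. An arbitrary filter covers the
  limits in one parameter and in both at once.\<close>

lemma (in cone_parameters) tendsto_even_kernel_formula:
  fixes x y :: "real^'n"
  assumes "(f \<longlongrightarrow> b) F" "(h \<longlongrightarrow> g) F" "eventually (\<lambda>u. f u > 0) F" "eventually (\<lambda>u. h u > 0) F"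
    and zw: "(x, t) \<in> double_cone" "(y, s) \<in> double_cone"
  shows "((\<lambda>u. even_kernel_formula n (f u) (h u) (x, t) (y, s)) \<longlongrightarrow> kernel_even n b g (x, t) (y, s)) F"
proof (rule Lim_transform_eventually)
  show "((\<lambda>u. even_kernel_poly n (f u) (h u) (x, t) (y, s)) \<longlongrightarrow> kernel_even n b g (x, t) (y, s)) F"
    unfolding kernel_even_eq[OF zw] by (rule tendsto_even_kernel_poly[OF assms(1) b assms(2) g card])
  show "eventually (\<lambda>u. even_kernel_poly n (f u) (h u) (x, t) (y, s) = even_kernel_formula n (f u) (h u) (x, t) (y, s)) F"
    using assms(3,4) by eventually_elim (simp add: even_kernel_formula_eq card zw)
qed

theorem theorem5p1:
  fixes \<alpha> \<beta> \<gamma> :: real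
  assumes "CARD('n::finite) \<ge> 2"
    and "\<beta> > -1/2" and "\<gamma> > -1/2"
    and "\<alpha> = \<beta> + (real CARD('n) - 1) / 2"
  shows
    "(\<forall>n\<ge>1. \<forall>(x :: real^'n) t y s. (x, t) \<in> double_cone \<longrightarrow> (y, s) \<in> double_cone \<longrightarrow>
        kernel_odd n \<beta> \<gamma> (x, t) (y, s) =
          (\<alpha> + \<gamma> + 1) / (\<alpha> + 1/2) * s * t * kernel_even (n - 1) (\<beta> + 1) \<gamma> (x, t) (y, s))
     \<and>
     (\<forall>n. \<forall>(x :: real^'n) t y s. (x, t) \<in> double_cone \<longrightarrow> (y, s) \<in> double_cone \<longrightarrow>
        (\<beta> > 0 \<and> \<gamma> > 0 \<longrightarrow>
           kernel_even n \<beta> \<gamma> (x, t) (y, s) = even_kernel_formula n \<beta> \<gamma> (x, t) (y, s)) \<and>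
        (\<beta> > 0 \<and> \<gamma> = 0 \<longrightarrow>
           ((\<lambda>\<gamma>'. even_kernel_formula n \<beta> \<gamma>' (x, t) (y, s))
              \<longlongrightarrow> kernel_even n \<beta> 0 (x, t) (y, s)) (at_right 0)) \<and>
        (\<beta> = 0 \<and> \<gamma> > 0 \<longrightarrow>
           ((\<lambda>\<beta>'. even_kernel_formula n \<beta>' \<gamma> (x, t) (y, s))
              \<longlongrightarrow> kernel_even n 0 \<gamma> (x, t) (y, s)) (at_right 0)) \<and>
        (\<beta> = 0 \<and> \<gamma> = 0 \<longrightarrow>
           ((\<lambda>(\<beta>', \<gamma>'). even_kernel_formula n \<beta>' \<gamma>' (x, t) (y, s))
              \<longlongrightarrow> kernel_even n 0 0 (x, t) (y, s)) (at_right 0 \<times>\<^sub>F at_right 0)))"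
proof -
  interpret cone_parameters \<beta> \<gamma> "TYPE('n)" using assms by unfold_locales auto
  interpret S: cone_parameters "\<beta> + 1" \<gamma> "TYPE('n)" using assms by unfold_locales auto
  have al: "al = \<alpha>" using assms(4) by (simp add: al_def)
  have idr: "((\<lambda>u. u) \<longlongrightarrow> (0::real)) (at_right 0)"
    by (rule tendsto_ident_at)
  have pos: "eventually (\<lambda>u. u > (0::real)) (at_right 0)"
    by (rule eventually_at_right_less)
  show ?thesis
  proof (intro conjI allI impI)
    fix n :: nat and x y :: "real^'n" and t s :: real
    assume "n \<ge> 1" and z: "(x, t) \<in> double_cone" and w: "(y, s) \<in> double_cone"
    then show "kernel_odd n \<beta> \<gamma> (x, t) (y, s) =
          (\<alpha> + \<gamma> + 1) / (\<alpha> + 1/2) * s * t * kernel_even (n - 1) (\<beta> + 1) \<gamma> (x, t) (y, s)"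
      by (simp add: kernel_odd_eq S.kernel_even_eq al)
  next
    fix n :: nat and x y :: "real^'n" and t s :: real
    assume z: "(x, t) \<in> double_cone" and w: "(y, s) \<in> double_cone"
    note lim = tendsto_even_kernel_formula[OF _ _ _ _ z w]
    {
      assume "\<beta> > 0 \<and> \<gamma> > 0"
      then show "kernel_even n \<beta> \<gamma> (x, t) (y, s) = even_kernel_formula n \<beta> \<gamma> (x, t) (y, s)"
        by (simp add: kernel_even_eq[OF z w] even_kernel_formula_eq[OF _ _ assms(1) z w])
    next
      assume "\<beta> > 0 \<and> \<gamma> = 0"
      then show "((\<lambda>\<gamma>'. even_kernel_formula n \<beta> \<gamma>' (x, t) (y, s)) \<longlongrightarrow> kernel_even n \<beta> 0 (x, t) (y, s)) (at_right 0)"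
        using lim[of "\<lambda>_. \<beta>" "at_right 0" "\<lambda>u. u" n] idr pos by simp
    next
      assume "\<beta> = 0 \<and> \<gamma> > 0"
      then show "((\<lambda>\<beta>'. even_kernel_formula n \<beta>' \<gamma> (x, t) (y, s)) \<longlongrightarrow> kernel_even n 0 \<gamma> (x, t) (y, s)) (at_right 0)"
        using lim[of "\<lambda>u. u" "at_right 0" "\<lambda>_. \<gamma>" n] idr pos by simp
    next
      assume h: "\<beta> = 0 \<and> \<gamma> = 0"
      let ?P = "at_right 0 \<times>\<^sub>F at_right 0 :: (real \<times> real) filter"
      have "(fst \<longlongrightarrow> 0) ?P" "(snd \<longlongrightarrow> 0) ?P"
        by (rule filterlim_compose[OF idr filterlim_fst] filterlim_compose[OF idr filterlim_snd])+
      moreover have "eventually (\<lambda>u. fst u > 0) ?P" "eventually (\<lambda>u. snd u > 0) ?P"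
        using eventually_prodI[OF pos pos] by (auto elim: eventually_mono)
      ultimately show "((\<lambda>(\<beta>', \<gamma>'). even_kernel_formula n \<beta>' \<gamma>' (x, t) (y, s)) \<longlongrightarrow> kernel_even n 0 0 (x, t) (y, s)) (at_right 0 \<times>\<^sub>F at_right 0)"
        using lim[of fst ?P snd n] h by (simp add: case_prod_unfold)
    }
  qed
qed

end
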